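(* The following two problems are decidable in PTIME. (Reachability) Given an $\mathcal E_{\mathsf{int}}$-automaton $(S,T)$, an initial state $s_0\in S$, a set of accepting states $F\subseteq S$ and a computable initial energy $x_0\in[0,\infty)$: does there exist a finite run of $(S,T)$ from $(s_0,x_0)$ which ends in a state in $F$? (Büchi acceptance) Given the same data: does there exist an infinite run of $(S,T)$ from $(s_0,x_0)$ which visits $F$ infinitely often?
   Context: Let $[0,\infty]_\bot=\{\bot\}\cup[0,\infty]$, where $\bot$ is an extra element below all others (meaning "undefined"). The integer update functions $f_k:[0,\infty]_\bot\to[0,\infty]_\bot$, for $k\in\mathbb Z$, are given by $f_k(x)=x+k$ if $x\ge\max(0,-k)$ and $f_k(x)=\bot$ otherwise (with $f_k(\infty)=\infty$, $f_k(\bot)=\bot$), together with $f_\infty$ given by $f_\infty(\bot)=\bot$ and $f_\infty(x)=\infty$ for $x\in[0,\infty]$. $\mathcal E_{\mathsf{int}}$ is the class of all integer update functions; $f_k$ is represented by $k$. An $\mathcal E_{\mathsf{int}}$-automaton $(S,T)$ consists of finite sets $S$ of states and $T\subseteq S\times\mathcal E_{\mathsf{int}}\times S$ of transitions. A global state is a pair $(s,x)$ with $s\in S$, $x\in[0,\infty]$; there is a transition from $(s,x)$ to $(s',x')$ if there is $(s,f,s')\in T$ with $x'=f(x)\ne\bot$. A run is a path in the graph of global states and transitions.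
   Formalization: The initial energy x0 is given by a name, and comparing named energies with integers is assumed decidable in PTIME; with x0 given by an arbitrary approximating program, already reachability via a single transition f_{-k} (that is, x0 ≥ k) would be undecidable. *)

theory Defs
  imports
    Complex_Main
    "HOL-Library.Extended_Nonnegative_Real"
    "HOL-Computational_Algebra.Polynomial"
begin

section \<open>Deterministic multi-tape Turing machines and polynomial time\<close>

datatype 'a symbol = Blank | Input 'a | Work nat

datatype move = Go_Left | Stay | Go_Right

text \<open>
  The states are the numbers below \<open>state_count\<close>: 0 is initial, 1 is accepting, 2 is rejecting, and
  the machine halts in 1 and 2. The transition function maps a state and the list of scanned
  symbols (one per tape) to the new state and, per tape, the symbol to write and the head movement.
\<close>

record 'a machine =
  tape_count :: nat
  state_count :: nat
  work_count :: nat
  delta :: "nat \<Rightarrow> 'a symbol list \<Rightarrow> nat \<times> ('a symbol \<times> move) list"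

definition tape_alphabet :: "'a machine \<Rightarrow> 'a symbol set" where
  "tape_alphabet M = insert Blank (range Input \<union> Work ` {..<work_count M})"

definition turing_machine :: "'a::finite machine \<Rightarrow> bool" where
  "turing_machine M \<longleftrightarrow> tape_count M \<ge> 1 \<and> state_count M \<ge> 3 \<and>
     (\<forall>q < state_count M. \<forall>xs. length xs = tape_count M \<longrightarrow> set xs \<subseteq> tape_alphabet M \<longrightarrow>
        fst (delta M q xs) < state_count M \<and>
        length (snd (delta M q xs)) = tape_count M \<and>
        fst ` set (snd (delta M q xs)) \<subseteq> tape_alphabet M)"

text \<open>A tape is two-way infinite; it is given by its content and the position of the head.\<close>

type_synonym 'a tape = "(int \<Rightarrow> 'a symbol) \<times> int"

type_synonym 'a config = "nat \<times> 'a tape list"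

definition scanned :: "'a tape \<Rightarrow> 'a symbol" where
  "scanned t = fst t (snd t)"

fun move_offset :: "move \<Rightarrow> int" where
  "move_offset Go_Left = -1"
| "move_offset Stay = 0"
| "move_offset Go_Right = 1"

definition act :: "'a symbol \<times> move \<Rightarrow> 'a tape \<Rightarrow> 'a tape" where
  "act a t = ((fst t)(snd t := fst a), snd t + move_offset (snd a))"

definition halted :: "'a config \<Rightarrow> bool" where
  "halted c \<longleftrightarrow> fst c = 1 \<or> fst c = 2"

definition accepting :: "'a config \<Rightarrow> bool" where
  "accepting c \<longleftrightarrow> fst c = 1"

definition machine_step :: "'a machine \<Rightarrow> 'a config \<Rightarrow> 'a config" where
  "machine_step M c = (if halted c then c
     else (let (q, as) = delta M (fst c) (map scanned (snd c)) in (q, map2 act as (snd c))))"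

definition word_content :: "'a list \<Rightarrow> int \<Rightarrow> 'a symbol" where
  "word_content w i = (if 0 \<le> i \<and> nat i < length w then Input (w ! nat i) else Blank)"

definition initial_config :: "'a machine \<Rightarrow> 'a list \<Rightarrow> 'a config" where
  "initial_config M w =
     (0, (word_content w, 0) # replicate (tape_count M - 1) (word_content [], 0))"

definition config_after :: "'a machine \<Rightarrow> nat \<Rightarrow> 'a list \<Rightarrow> 'a config" where
  "config_after M t w = (machine_step M ^^ t) (initial_config M w)"

definition decides_in_time :: "'a machine \<Rightarrow> 'a list set \<Rightarrow> (nat \<Rightarrow> nat) \<Rightarrow> bool" where
  "decides_in_time M L time \<longleftrightarrow>
     (\<forall>w. halted (config_after M (time (length w)) w) \<and>
          (accepting (config_after M (time (length w)) w) \<longleftrightarrow> w \<in> L))"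

definition decidable_in_ptime :: "'a::finite list set \<Rightarrow> bool" where
  "decidable_in_ptime L \<longleftrightarrow>
     (\<exists>M (p :: nat poly). turing_machine M \<and> decides_in_time M L (poly p))"

text \<open>The output of a computation is the content of the last tape.\<close>

definition computes :: "'a machine \<Rightarrow> 'a list \<Rightarrow> 'a list \<Rightarrow> bool" where
  "computes M w v \<longleftrightarrow>
     (\<exists>t. halted (config_after M t w) \<and> fst (last (snd (config_after M t w))) = word_content v)"


section \<open>Encoding of numbers and computable reals\<close>

datatype letter = Zero | One | Minus | Infinity | Comma | Bar

lemma UNIV_letter: "(UNIV :: letter set) = {Zero, One, Minus, Infinity, Comma, Bar}"
  using letter.exhaust by blast

instance letter :: finite
  by standard (simp add: UNIV_letter)

definition encode_digit :: "nat \<Rightarrow> letter" where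
  "encode_digit d = (if d = 0 then Zero else One)"

text \<open>Binary notation, most significant digit first.\<close>

fun encode_nat :: "nat \<Rightarrow> letter list" where
  "encode_nat n =
     (if n < 2 then [encode_digit n] else encode_nat (n div 2) @ [encode_digit (n mod 2)])"

declare encode_nat.simps [simp del]

definition encode_int :: "int \<Rightarrow> letter list" where
  "encode_int k = (if k < 0 then Minus # encode_nat (nat (- k)) else encode_nat (nat k))"

definition computable_real :: "real \<Rightarrow> bool" where
  "computable_real x \<longleftrightarrow>
     (\<exists>M (a :: nat \<Rightarrow> int). turing_machine M \<and>
        (\<forall>n. computes M (encode_nat n) (encode_int (a n))) \<and>
        (\<forall>n. \<bar>x - real_of_int (a n) / 2 ^ n\<bar> \<le> 1 / 2 ^ n))"


section \<open>Integer update functions and automata\<close>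

text \<open>
  \<open>None\<close> stands for the undefined energy and \<open>Some x\<close> for the energy \<open>x\<close> in \<open>[0, \<infinity>]\<close>. The guard makes
  the sum of extended reals below nonnegative, so that \<open>e2ennreal\<close> truncates nothing.
\<close>

type_synonym energy = "ennreal option"

datatype update_code = Add int | Add_Infinity

fun update :: "update_code \<Rightarrow> energy \<Rightarrow> energy" where
  "update u None = None"
| "update (Add k) (Some x) =
     (if ennreal (max 0 (- real_of_int k)) \<le> x
      then Some (e2ennreal (enn2ereal x + ereal (real_of_int k))) else None)"
| "update Add_Infinity (Some x) = Some \<infinity>"

definition int_updates :: "(energy \<Rightarrow> energy) set" where
  "int_updates = range update"

type_synonym 's transition = "'s \<times> (energy \<Rightarrow> energy) \<times> 's"

definition int_automaton :: "'s set \<Rightarrow> 's transition set \<Rightarrow> bool" where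
  "int_automaton S T \<longleftrightarrow> finite S \<and> finite T \<and> T \<subseteq> S \<times> int_updates \<times> S"

definition global_step ::
  "'s transition set \<Rightarrow> 's \<times> ennreal \<Rightarrow> 's \<times> ennreal \<Rightarrow> bool" where
  "global_step T g g' \<longleftrightarrow> (\<exists>f. (fst g, f, fst g') \<in> T \<and> f (Some (snd g)) = Some (snd g'))"

definition finite_run :: "'s transition set \<Rightarrow> ('s \<times> ennreal) list \<Rightarrow> bool" where
  "finite_run T r \<longleftrightarrow> r \<noteq> [] \<and> (\<forall>i. Suc i < length r \<longrightarrow> global_step T (r ! i) (r ! Suc i))"

definition infinite_run :: "'s transition set \<Rightarrow> (nat \<Rightarrow> 's \<times> ennreal) \<Rightarrow> bool" where
  "infinite_run T r \<longleftrightarrow> (\<forall>i. global_step T (r i) (r (Suc i)))"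

definition reachable_accepting ::
  "'s transition set \<Rightarrow> 's \<Rightarrow> 's set \<Rightarrow> real \<Rightarrow> bool" where
  "reachable_accepting T s0 F x0 \<longleftrightarrow>
     (\<exists>r. finite_run T r \<and> hd r = (s0, ennreal x0) \<and> fst (last r) \<in> F)"

definition buchi_accepting ::
  "'s transition set \<Rightarrow> 's \<Rightarrow> 's set \<Rightarrow> real \<Rightarrow> bool" where
  "buchi_accepting T s0 F x0 \<longleftrightarrow>
     (\<exists>r. infinite_run T r \<and> r 0 = (s0, ennreal x0) \<and> infinite {i. fst (r i) \<in> F})"


section \<open>The decision problems as languages\<close>

text \<open>
  States are natural numbers and finite sets are given by lists of their elements. The initial
  energy is given by a name: \<open>names\<close> is the set of legal names and \<open>val w\<close> is the real number named
  by \<open>w\<close>.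
\<close>

fun encode_update :: "update_code \<Rightarrow> letter list" where
  "encode_update (Add k) = encode_int k"
| "encode_update Add_Infinity = [Infinity]"

fun encode_transition :: "nat \<times> update_code \<times> nat \<Rightarrow> letter list" where
  "encode_transition (s, u, s') =
     encode_nat s @ [Comma] @ encode_update u @ [Comma] @ encode_nat s'"

definition encode_list :: "('b \<Rightarrow> letter list) \<Rightarrow> 'b list \<Rightarrow> letter list" where
  "encode_list enc xs = concat (map (\<lambda>x. enc x @ [Comma]) xs)"

definition encode_instance ::
  "nat list \<Rightarrow> (nat \<times> update_code \<times> nat) list \<Rightarrow> nat \<Rightarrow> nat list \<Rightarrow> letter list \<Rightarrow> letter list" where
  "encode_instance ss ts s0 fs w =
     encode_list encode_nat ss @ [Bar] @ encode_list encode_transition ts @ [Bar] @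
     encode_nat s0 @ [Bar] @ encode_list encode_nat fs @ [Bar] @ w"

definition transitions :: "(nat \<times> update_code \<times> nat) list \<Rightarrow> nat transition set" where
  "transitions ts = (\<lambda>(s, u, s'). (s, update u, s')) ` set ts"

definition valid_instance ::
  "letter list set \<Rightarrow> nat list \<Rightarrow> (nat \<times> update_code \<times> nat) list \<Rightarrow> nat \<Rightarrow> nat list \<Rightarrow>
   letter list \<Rightarrow> bool" where
  "valid_instance names ss ts s0 fs w \<longleftrightarrow>
     int_automaton (set ss) (transitions ts) \<and> s0 \<in> set ss \<and> set fs \<subseteq> set ss \<and> w \<in> names"

definition reachability_problem ::
  "letter list set \<Rightarrow> (letter list \<Rightarrow> real) \<Rightarrow> letter list set" where
  "reachability_problem names val =
     {encode_instance ss ts s0 fs w | ss ts s0 fs w.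
        valid_instance names ss ts s0 fs w \<and>
        reachable_accepting (transitions ts) s0 (set fs) (val w)}"

definition buchi_problem ::
  "letter list set \<Rightarrow> (letter list \<Rightarrow> real) \<Rightarrow> letter list set" where
  "buchi_problem names val =
     {encode_instance ss ts s0 fs w | ss ts s0 fs w.
        valid_instance names ss ts s0 fs w \<and>
        buchi_accepting (transitions ts) s0 (set fs) (val w)}"

text \<open>
  Evaluating an update function at the initial energy means comparing that energy with an integer.
  This is undecidable if reals are given by arbitrary algorithms that approximate them, so a
  polynomial bound only makes sense for names with which these comparisons are feasible. Examples
  are the binary notations of rational numbers, or one single name for a fixed real number.
  As \<open>k\<close> may be negative, deciding whether a word is a legal name is covered as well.
\<close>

definition integer_threshold_problem ::
  "letter list set \<Rightarrow> (letter list \<Rightarrow> real) \<Rightarrow> letter list set" where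
  "integer_threshold_problem names val =
     {encode_int k @ [Bar] @ w | k w. w \<in> names \<and> real_of_int k \<le> val w}"

end

theory Submission
  imports Defs
begin

text \<open>
  Only one number has to be computed for an instance: the least initial energy from which there is
  an accepting run. It is a natural number (or does not exist), it does not depend on the given
  initial energy, and comparing it with that energy is a single query to the threshold problem.

  Minimal energies are computed backwards, by Bellman-Ford rounds. A run that repeats a state
  without gaining energy can be shortened. If it gains energy in a cycle, then this cycle, started at
  its point of lowest energy, can be repeated from energy 0, so that this point needs energy 0 to
  reach everything that is reachable from it in the graph. After giving these points
  energy 0, as many rounds as there are transitions suffice. For Buchi acceptance, energies along an
  infinite run are well-quasi-ordered, so an accepting run contains a cycle through an accepting
  state that does not lose energy. If the energy is finite there, the cycle can again be
  started with energy 0 at its lowest point.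

  For the polynomial time bound, functions on data encoded as binary trees are computed by structured
  programs on stacks. Such a program is run by a Turing machine whose states are the residual
  programs of its small-step semantics.
\<close>

text \<open>Plain Bellman-Ford fails because an optimal run may have to go round a gaining cycle a
  number of times that is exponential in the length of the binary weights. A zero entry for a point
  of the cycle replaces all these repetitions. Finding such points in polynomial time rests on
  integrality: from energy 0 all later energies are natural numbers or infinite, so a gain is at
  least 1, and the test is whether energy 0 suffices to come back with energy 1. The shortest
  repetition in a run has at most as many steps as there are transitions, so the rounds can see it.
  Numbers in the tables stay short because a round lengthens them by at most the length of one
  weight. The update to infinity needs care for Buchi acceptance: with infinite energy a cycle may
  contain arbitrary losses. Since the initial energy is finite, infinite energy starts at an
  \<open>Add_Infinity\<close> edge, and what follows is a question about the bare graph.\<close>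

type_synonym 'a store = "nat \<Rightarrow> int \<Rightarrow> 'a symbol"

text \<open>Tests and actions are arbitrary functions of the scanned symbols, so \<open>Act\<close>
  covers any single step of a multi-tape machine. Tapes are indexed by all natural numbers;
  \<open>wf_com\<close> confines a program to finitely many.\<close>

datatype 'a com =
    Skip
  | Act "(nat \<Rightarrow> 'a symbol) \<Rightarrow> nat \<Rightarrow> 'a symbol \<times> move"
  | Seq "'a com" "'a com"
  | Cond "(nat \<Rightarrow> 'a symbol) \<Rightarrow> bool" "'a com" "'a com"
  | While "(nat \<Rightarrow> 'a symbol) \<Rightarrow> bool" "'a com"

definition heads :: "'a store \<Rightarrow> nat \<Rightarrow> 'a symbol" where
  "heads \<sigma> r = \<sigma> r 0"

text \<open>Tapes are seen from the head, which always stands at 0. A movement shifts the content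
  instead, so the semantics has no head positions.\<close>

definition move_view :: "'a symbol \<times> move \<Rightarrow> (int \<Rightarrow> 'a symbol) \<Rightarrow> int \<Rightarrow> 'a symbol" where
  "move_view a v i = (v(0 := fst a)) (i + move_offset (snd a))"

definition apply_acts :: "(nat \<Rightarrow> 'a symbol \<times> move) \<Rightarrow> 'a store \<Rightarrow> 'a store" where
  "apply_acts as \<sigma> r = move_view (as r) (\<sigma> r)"

definition stay :: "(nat \<Rightarrow> 'a symbol) \<Rightarrow> nat \<Rightarrow> 'a symbol \<times> move" where
  "stay h r = (h r, Stay)"

fun next_com :: "'a com \<Rightarrow> (nat \<Rightarrow> 'a symbol) \<Rightarrow> 'a com \<times> (nat \<Rightarrow> 'a symbol \<times> move)" where
  "next_com Skip h = (Skip, stay h)"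
| "next_com (Act f) h = (Skip, f h)"
| "next_com (Seq a b) h =
     (if a = Skip then (b, stay h) else (Seq (fst (next_com a h)) b, snd (next_com a h)))"
| "next_com (Cond t a b) h = (if t h then a else b, stay h)"
| "next_com (While t a) h = (if t h then Seq a (While t a) else Skip, stay h)"

definition com_step :: "'a com \<times> 'a store \<Rightarrow> 'a com \<times> 'a store" where
  "com_step x = (fst (next_com (fst x) (heads (snd x))),
     apply_acts (snd (next_com (fst x) (heads (snd x)))) (snd x))"

lemma apply_stay [simp]: "apply_acts (stay (heads \<sigma>)) \<sigma> = \<sigma>"
  by (auto simp: apply_acts_def stay_def heads_def move_view_def fun_eq_iff)

text \<open>As \<^const>\<open>Skip\<close> is a fixed point of \<^const>\<open>com_step\<close>, this says: within \<open>t\<close> steps.\<close>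

definition exec :: "'a com \<Rightarrow> 'a store \<Rightarrow> nat \<Rightarrow> 'a store \<Rightarrow> bool" where
  "exec c \<sigma> t \<sigma>' \<longleftrightarrow> (com_step ^^ t) (c, \<sigma>) = (Skip, \<sigma>')"

lemma com_step_Skip [simp]: "com_step (Skip, \<sigma>) = (Skip, \<sigma>)"
  by (simp add: com_step_def)

lemma com_steps_Skip [simp]: "(com_step ^^ t) (Skip, \<sigma>) = (Skip, \<sigma>)"
  by (induction t) auto

lemma exec_mono:
  assumes "exec c \<sigma> t \<sigma>'" "t \<le> t'"
  shows "exec c \<sigma> t' \<sigma>'"
proof -
  obtain k where "t' = k + t"
    using assms(2) le_iff_add by (metis add.commute)
  then show ?thesis
    using assms(1) by (simp add: exec_def funpow_add)
qed

lemma exec_Skip [intro]: "exec Skip \<sigma> t \<sigma>"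
  by (simp add: exec_def)

lemma exec_step: "com_step (c, \<sigma>) = (c', \<sigma>') \<Longrightarrow> exec c' \<sigma>' t \<sigma>'' \<Longrightarrow> exec c \<sigma> (Suc t) \<sigma>''"
  by (simp add: exec_def funpow_swap1)

lemma exec_Act: "exec (Act f) \<sigma> 1 (apply_acts (f (heads \<sigma>)) \<sigma>)"
  by (simp add: exec_def com_step_def)

text \<open>Only \<open>t' \<le> t\<close> can be claimed: \<open>a\<close> may finish early and
  idle as \<open>Skip\<close>, whereas \<open>Seq Skip b\<close> would go on to
  \<open>b\<close>.\<close>

lemma com_steps_Seq:
  "(com_step ^^ t) (a, \<sigma>) = (Skip, \<sigma>') \<Longrightarrow>
     \<exists>t' \<le> t. (com_step ^^ t') (Seq a b, \<sigma>) = (Seq Skip b, \<sigma>')"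
proof (induction t arbitrary: a \<sigma>)
  case 0
  then show ?case by auto
next
  case (Suc t)
  show ?case
  proof (cases "a = Skip")
    case True
    with Suc.prems have "\<sigma> = \<sigma>'" using com_steps_Skip[of "Suc t" \<sigma>] by simp
    then show ?thesis using True by (intro exI[of _ 0]) auto
  next
    case False
    obtain a' \<sigma>1 where step: "com_step (a, \<sigma>) = (a', \<sigma>1)" by fastforce
    then have "(com_step ^^ t) (a', \<sigma>1) = (Skip, \<sigma>')"
      using Suc.prems by (simp add: funpow_swap1)
    then obtain t' where "t' \<le> t" "(com_step ^^ t') (Seq a' b, \<sigma>1) = (Seq Skip b, \<sigma>')"
      using Suc.IH by blast
    moreover have "com_step (Seq a b, \<sigma>) = (Seq a' b, \<sigma>1)"
      using step False by (simp add: com_step_def)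
    ultimately show ?thesis
      by (intro exI[of _ "Suc t'"]) (simp add: funpow_swap1)
  qed
qed

lemma exec_Seq:
  assumes "exec a \<sigma> t1 \<sigma>1" "exec b \<sigma>1 t2 \<sigma>2"
  shows "exec (Seq a b) \<sigma> (t1 + t2 + 1) \<sigma>2"
proof -
  obtain t' where t': "t' \<le> t1" "(com_step ^^ t') (Seq a b, \<sigma>) = (Seq Skip b, \<sigma>1)"
    using com_steps_Seq assms(1) unfolding exec_def by blast
  \<comment> \<open>Discarding the finished first program takes the one extra step in the
    bound.\<close>
  have "com_step (Seq Skip b, \<sigma>1) = (b, \<sigma>1)"
    by (simp add: com_step_def)
  then have "exec (Seq Skip b) \<sigma>1 (t2 + 1) \<sigma>2"
    using exec_step assms(2) by fastforce
  then have "exec (Seq a b) \<sigma> ((t2 + 1) + t') \<sigma>2"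
    using t'(2) unfolding exec_def funpow_add by simp
  then show ?thesis
    using t'(1) by (auto elim: exec_mono)
qed

lemma exec_If_True: "t (heads \<sigma>) \<Longrightarrow> exec a \<sigma> n \<sigma>' \<Longrightarrow> exec (Cond t a b) \<sigma> (n + 1) \<sigma>'"
  by (auto intro: exec_step simp: com_step_def)

lemma exec_If_False: "\<not> t (heads \<sigma>) \<Longrightarrow> exec b \<sigma> n \<sigma>' \<Longrightarrow> exec (Cond t a b) \<sigma> (n + 1) \<sigma>'"
  by (auto intro: exec_step simp: com_step_def)

lemma exec_While_False: "\<not> t (heads \<sigma>) \<Longrightarrow> exec (While t a) \<sigma> (n + 1) \<sigma>"
  by (auto intro!: exec_step[of _ _ Skip \<sigma>] simp: com_step_def)

text \<open>The 2 counts the unfolding of the loop and the removal of the \<open>Skip\<close> left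
  by its body.\<close>

lemma exec_While_True:
  assumes "t (heads \<sigma>)" "exec a \<sigma> n \<sigma>1" "exec (While t a) \<sigma>1 m \<sigma>2"
  shows "exec (While t a) \<sigma> (n + m + 2) \<sigma>2"
proof -
  have "com_step (While t a, \<sigma>) = (Seq a (While t a), \<sigma>)"
    using assms(1) by (simp add: com_step_def)
  then show ?thesis
    using exec_step exec_Seq[OF assms(2,3)] by fastforce
qed

text \<open>A finite set closed under \<open>next_com\<close>: unfolding a loop only produces
  residuals of the body followed by the same loop. It supplies the control states of the compiled
  machine.\<close>

fun residuals :: "'a com \<Rightarrow> 'a com set" where
  "residuals Skip = {Skip}"
| "residuals (Act f) = {Act f, Skip}"
| "residuals (Seq a b) = (\<lambda>a'. Seq a' b) ` residuals a \<union> residuals b"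
| "residuals (Cond t a b) = insert (Cond t a b) (residuals a \<union> residuals b)"
| "residuals (While t a) = {While t a, Skip} \<union> (\<lambda>a'. Seq a' (While t a)) ` residuals a"

lemma finite_residuals: "finite (residuals c)"
  by (induction c) auto

lemma residuals_refl [simp]: "c \<in> residuals c"
  by (induction c) auto

lemma residuals_next: "d \<in> residuals c \<Longrightarrow> fst (next_com d h) \<in> residuals c"
proof (induction c arbitrary: d)
  case (Seq a b)
  then show ?case by (auto split: if_splits)
next
  case (Cond t a b)
  then show ?case by (auto split: if_splits)
next
  case (While t a)
  then show ?case by (auto split: if_splits)
qed auto

section \<open>Programs confined to finitely many tapes and symbols\<close>

definition symbols :: "nat \<Rightarrow> 'a symbol set" where
  "symbols W = insert Blank (range Input \<union> Work ` {..<W})"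

definition wf_act :: "nat \<Rightarrow> nat \<Rightarrow> ((nat \<Rightarrow> 'a symbol) \<Rightarrow> nat \<Rightarrow> 'a symbol \<times> move) \<Rightarrow> bool" where
  "wf_act K W f \<longleftrightarrow> (\<forall>h. (\<forall>r. h r \<in> symbols W) \<longrightarrow> (\<forall>r. fst (f h r) \<in> symbols W)) \<and>
     (\<forall>h. \<forall>r \<ge> K. f h r = (h r, Stay))"

fun wf_com :: "nat \<Rightarrow> nat \<Rightarrow> 'a com \<Rightarrow> bool" where
  "wf_com K W Skip \<longleftrightarrow> True"
| "wf_com K W (Act f) \<longleftrightarrow> wf_act K W f"
| "wf_com K W (Seq a b) \<longleftrightarrow> wf_com K W a \<and> wf_com K W b"
| "wf_com K W (Cond t a b) \<longleftrightarrow> wf_com K W a \<and> wf_com K W b"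
| "wf_com K W (While t a) \<longleftrightarrow> wf_com K W a"

lemma wf_actD:
  assumes "wf_act K W f"
  shows "(\<And>r. h r \<in> symbols W) \<Longrightarrow> fst (f h r) \<in> symbols W"
    and "r \<ge> K \<Longrightarrow> f h r = (h r, Stay)"
  using assms unfolding wf_act_def by simp_all

lemma wf_actI:
  assumes "\<And>h r. (\<And>r. h r \<in> symbols W) \<Longrightarrow> fst (f h r) \<in> symbols W"
    and "\<And>h r. r \<ge> K \<Longrightarrow> f h r = (h r, Stay)"
  shows "wf_act K W f"
  unfolding wf_act_def using assms by simp

lemma wf_act_mono:
  assumes "wf_act K W f" "K \<le> K'"
  shows "wf_act K' W f"
proof (rule wf_actI)
  show "fst (f h r) \<in> symbols W" if "\<And>r. h r \<in> symbols W" for h r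
    by (rule wf_actD(1)[OF assms(1) that])
  show "f h r = (h r, Stay)" if "r \<ge> K'" for h r
    by (rule wf_actD(2)[OF assms(1)]) (use that assms(2) in simp)
qed

lemma wf_com_mono: "wf_com K W c \<Longrightarrow> K \<le> K' \<Longrightarrow> wf_com K' W c"
  by (induction c) (auto intro: wf_act_mono)

lemma wf_residuals: "d \<in> residuals c \<Longrightarrow> wf_com K W c \<Longrightarrow> wf_com K W d"
proof (induction c arbitrary: d)
  case (Seq a b)
  from Seq.prems(1) consider a' where "d = Seq a' b" "a' \<in> residuals a" | "d \<in> residuals b"
    unfolding residuals.simps by blast
  then show ?case
  proof cases
    case 1
    then show ?thesis using Seq.IH(1)[of a'] Seq.prems(2) by (simp only: wf_com.simps)
  next
    case 2
    then show ?thesis using Seq.IH(2)[of d] Seq.prems(2) by (simp only: wf_com.simps)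
  qed
next
  case (Cond t a b)
  from Cond.prems(1) consider "d = Cond t a b" | "d \<in> residuals a" | "d \<in> residuals b"
    unfolding residuals.simps by blast
  then show ?case
  proof cases
    case 1
    then show ?thesis using Cond.prems(2) by (simp only:)
  next
    case 2
    then show ?thesis using Cond.IH(1)[of d] Cond.prems(2) by (simp only: wf_com.simps)
  next
    case 3
    then show ?thesis using Cond.IH(2)[of d] Cond.prems(2) by (simp only: wf_com.simps)
  qed
next
  case (While t a)
  from While.prems(1) consider "d = While t a" | "d = Skip" | a' where "d = Seq a' (While t a)" "a' \<in> residuals a"
    unfolding residuals.simps by blast
  then show ?case
  proof cases
    case 3
    then show ?thesis using While.IH[of a'] While.prems(2) by (simp only: wf_com.simps)
  qed (use While.prems(2) in simp_all)
qed auto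

lemma wf_next_symbols:
  assumes "wf_com K W c" "\<And>r. h r \<in> symbols W"
  shows "fst (snd (next_com c h) r) \<in> symbols W"
  using assms(1) by (induction c) (use assms(2) in \<open>simp_all add: stay_def wf_actD\<close>)

lemma wf_next_stay:
  assumes "wf_com K W c" "r \<ge> K"
  shows "snd (next_com c h) r = (h r, Stay)"
  using assms(1) by (induction c) (use assms(2) in \<open>simp_all add: stay_def wf_actD\<close>)

section \<open>Compilation of programs into Turing machines\<close>

locale compiled =
  fixes c :: "'a::finite com" and K W :: nat and acc :: "(nat \<Rightarrow> 'a symbol) \<Rightarrow> bool"
  assumes wf: "wf_com K W c" and K: "K \<ge> 1"
begin

text \<open>The whole program gets the initial state 0; the shift by 3 keeps all other residuals
  away from 0 and from the two halting states.\<close>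

definition number :: "'a com \<Rightarrow> nat" where
  "number d = (if d = c then 0 else to_nat_on (residuals c) d + 3)"

definition program_of :: "nat \<Rightarrow> 'a com" where
  "program_of q = (if q \<in> number ` residuals c then inv_into (residuals c) number q else Skip)"

definition head_list :: "'a symbol list \<Rightarrow> nat \<Rightarrow> 'a symbol" where
  "head_list xs r = (if r < K then xs ! r else Blank)"

text \<open>Once the program has become \<open>Skip\<close>, one more transition consults
  \<open>acc\<close> on the scanned symbols and enters state 1 or 2.\<close>

definition machine_of :: "'a machine" where
  "machine_of = \<lparr>tape_count = K, state_count = Max (number ` residuals c) + 3, work_count = W,
     delta = (\<lambda>q xs. let d = program_of q; h = head_list xs in
       (if d = Skip then if acc h then 1 else 2 else number (fst (next_com d h)),
        map (snd (next_com d h)) [0..<K]))\<rparr>"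

lemma inj_number: "inj_on number (residuals c)"
proof -
  have "inj_on (to_nat_on (residuals c)) (residuals c)"
    by (simp add: countable_finite finite_residuals inj_on_to_nat_on)
  then show ?thesis
    by (auto simp: inj_on_def number_def)
qed

lemma program_of_number [simp]: "d \<in> residuals c \<Longrightarrow> program_of (number d) = d"
  by (simp add: program_of_def inj_number)

lemma number_nonfinal: "number d \<noteq> 1" "number d \<noteq> 2" "number d \<noteq> Suc 0"
  by (auto simp: number_def)

lemma number_less: "d \<in> residuals c \<Longrightarrow> number d < state_count machine_of"
proof -
  assume "d \<in> residuals c"
  then have "number d \<le> Max (number ` residuals c)"
    by (simp add: finite_residuals)
  then show ?thesis by (simp add: machine_of_def)
qed

lemma program_of_residual: "program_of q = Skip \<or> program_of q \<in> residuals c"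
  by (auto simp: program_of_def inv_into_into)

lemma head_list_symbols: "length xs = K \<Longrightarrow> set xs \<subseteq> symbols W \<Longrightarrow> head_list xs r \<in> symbols W"
  by (metis head_list_def insertI1 nth_mem subsetD symbols_def)

lemma turing_machine_of: "turing_machine machine_of"
proof -
  have "fst (delta machine_of q xs) < state_count machine_of \<and>
      length (snd (delta machine_of q xs)) = tape_count machine_of \<and>
      fst ` set (snd (delta machine_of q xs)) \<subseteq> tape_alphabet machine_of"
    if xs: "length xs = tape_count machine_of" "set xs \<subseteq> tape_alphabet machine_of" for q xs
  proof (intro conjI)
    let ?d = "program_of q" and ?h = "head_list xs"
    have h: "?h r \<in> symbols W" for r
      using xs by (intro head_list_symbols) (auto simp: machine_of_def tape_alphabet_def symbols_def)
    have wfd: "wf_com K W ?d"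
      using program_of_residual[of q]
    proof
      assume "program_of q \<in> residuals c"
      then show ?thesis using wf_residuals wf by blast
    qed simp
    show "fst (delta machine_of q xs) < state_count machine_of"
    proof (cases "?d = Skip")
      case True
      then show ?thesis by (simp add: machine_of_def Let_def)
    next
      case False
      then have "fst (delta machine_of q xs) = number (fst (next_com ?d ?h))"
        by (simp add: machine_of_def Let_def)
      moreover have "fst (next_com ?d ?h) \<in> residuals c"
        using False program_of_residual residuals_next by blast
      ultimately show ?thesis
        using number_less by simp
    qed
    show "length (snd (delta machine_of q xs)) = tape_count machine_of"
      by (simp add: machine_of_def Let_def)
    show "fst ` set (snd (delta machine_of q xs)) \<subseteq> tape_alphabet machine_of"
      using wf_next_symbols[OF wfd, of ?h] h
      by (auto simp: machine_of_def Let_def tape_alphabet_def symbols_def[symmetric] simp del: fst_conv)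
  qed
  then show ?thesis
    using K by (auto simp: turing_machine_def) (auto simp: machine_of_def)
qed

definition simulates :: "'a config \<Rightarrow> 'a com \<times> 'a store \<Rightarrow> bool" where
  "simulates C x \<longleftrightarrow> fst C = number (fst x) \<and> fst x \<in> residuals c \<and> length (snd C) = K \<and>
     (\<forall>r. snd x r = (if r < K then (\<lambda>i. fst (snd C ! r) (snd (snd C ! r) + i)) else (\<lambda>_. Blank)))"

lemma simulatesD: "simulates C (d, \<sigma>) \<Longrightarrow> d \<in> residuals c \<and> fst C = number d"
  by (simp add: simulates_def)

lemma simulates_heads:
  assumes "simulates C x"
  shows "head_list (map scanned (snd C)) = heads (snd x)"
proof
  fix r
  show "head_list (map scanned (snd C)) r = heads (snd x) r"
    using assms by (cases "r < K") (auto simp: simulates_def head_list_def heads_def scanned_def)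
qed

lemma simulates_step:
  assumes sim: "simulates C (d, \<sigma>)" and "d \<noteq> Skip"
  shows "simulates (machine_step machine_of C) (com_step (d, \<sigma>))"
proof -
  have d: "d \<in> residuals c" and C: "fst C = number d" "length (snd C) = K"
    and \<sigma>: "\<And>r. \<sigma> r = (if r < K then (\<lambda>i. fst (snd C ! r) (snd (snd C ! r) + i)) else (\<lambda>_. Blank))"
    using sim by (auto simp: simulates_def)
  have h: "head_list (map scanned (snd C)) = heads \<sigma>"
    using simulates_heads[OF sim] by simp
  have nh: "\<not> halted C"
    using C number_nonfinal by (simp add: halted_def)
  let ?n = "next_com d (heads \<sigma>)"
  have step: "machine_step machine_of C = (number (fst ?n), map2 act (map (snd ?n) [0..<K]) (snd C))"
    using nh C d h \<open>d \<noteq> Skip\<close> by (simp add: machine_step_def machine_of_def Let_def)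
  \<comment> \<open>Shifting the content under a fixed head amounts to moving the head over a fixed
    content.\<close>
  have view: "move_view a (\<lambda>i. fst t (snd t + i)) = (\<lambda>i. fst (act a t) (snd (act a t) + i))"
    for a :: "'a symbol \<times> move" and t
    by (auto simp: move_view_def act_def fun_eq_iff algebra_simps)
  have stay: "snd ?n r = (heads \<sigma> r, Stay)" if "r \<ge> K" for r
    using wf_next_stay[OF wf_residuals[OF d wf] that] .
  have "apply_acts (snd ?n) \<sigma> r =
      (if r < K then (\<lambda>i. fst (act (snd ?n r) (snd C ! r)) (snd (act (snd ?n r) (snd C ! r)) + i))
       else (\<lambda>_. Blank))" for r
  proof (cases "r < K")
    case True
    then show ?thesis by (simp add: apply_acts_def \<sigma> view)
  next
    case False
    then show ?thesis by (auto simp: apply_acts_def stay move_view_def heads_def \<sigma> fun_eq_iff)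
  qed
  then show ?thesis
    using C residuals_next[OF d] step
    by (auto simp: simulates_def com_step_def)
qed

lemma simulates_halt:
  assumes sim: "simulates C (Skip, \<sigma>)"
  shows "halted (machine_step machine_of C)"
    and "accepting (machine_step machine_of C) \<longleftrightarrow> acc (heads \<sigma>)"
proof -
  have "Skip \<in> residuals c" and C: "fst C = number Skip"
    using simulatesD[OF sim] by blast+
  moreover have "head_list (map scanned (snd C)) = heads \<sigma>"
    using simulates_heads[OF sim] by simp
  moreover have "\<not> halted C"
    using C number_nonfinal by (simp add: halted_def)
  ultimately have "fst (machine_step machine_of C) = (if acc (heads \<sigma>) then 1 else 2)"
    by (simp add: machine_step_def machine_of_def Let_def)
  then show "halted (machine_step machine_of C)"
    and "accepting (machine_step machine_of C) \<longleftrightarrow> acc (heads \<sigma>)"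
    by (auto simp: halted_def accepting_def)
qed

lemma halted_steps: "halted C \<Longrightarrow> (machine_step M ^^ t) C = C"
  by (induction t) (auto simp: machine_step_def)

text \<open>The step beyond \<open>t\<close> is the verdict. If the program ends before
  \<open>t\<close>, the machine has halted and no longer changes.\<close>

lemma simulates_run:
  "simulates C (d, \<sigma>) \<Longrightarrow> (com_step ^^ t) (d, \<sigma>) = (Skip, \<sigma>') \<Longrightarrow>
     halted ((machine_step machine_of ^^ Suc t) C) \<and>
     (accepting ((machine_step machine_of ^^ Suc t) C) \<longleftrightarrow> acc (heads \<sigma>'))"
proof (induction t arbitrary: C d \<sigma>)
  case 0
  then have "simulates C (Skip, \<sigma>')" by simp
  from simulates_halt[OF this] show ?case by simp
next
  case (Suc t)
  show ?case
  proof (cases "d = Skip")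
    case True
    with Suc.prems(2) have "\<sigma>' = \<sigma>"
      using com_steps_Skip[of "Suc t" \<sigma>] by simp
    then have sim: "simulates C (Skip, \<sigma>')"
      using Suc.prems(1) True by simp
    have "(machine_step machine_of ^^ Suc (Suc t)) C = machine_step machine_of C"
      using halted_steps[OF simulates_halt(1)[OF sim], of "Suc t"]
      by (simp only: funpow_Suc_right[of "Suc t"] comp_apply)
    then show ?thesis
      using simulates_halt[OF sim] by (simp only:)
  next
    case False
    obtain d1 \<sigma>1 where s: "com_step (d, \<sigma>) = (d1, \<sigma>1)" by fastforce
    then have "(com_step ^^ t) (d1, \<sigma>1) = (Skip, \<sigma>')"
      using Suc.prems(2) by (simp add: funpow_swap1)
    then have "halted ((machine_step machine_of ^^ Suc t) (machine_step machine_of C)) \<and>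
       (accepting ((machine_step machine_of ^^ Suc t) (machine_step machine_of C)) \<longleftrightarrow> acc (heads \<sigma>'))"
      using Suc.IH[of "machine_step machine_of C" d1 \<sigma>1] simulates_step[OF Suc.prems(1) False] s
      by (simp only:)
    then show ?thesis by (simp only: funpow_Suc_right comp_apply)
  qed
qed

lemma simulates_initial:
  "simulates (initial_config machine_of w) (c, (\<lambda>_. word_content [])(0 := word_content w))"
proof -
  have blank: "word_content [] = (\<lambda>_. Blank :: 'a symbol)"
    by (auto simp: word_content_def)
  have tc: "tape_count machine_of = K"
    by (simp add: machine_of_def)
  have "((\<lambda>_. word_content [])(0 := word_content w)) r =
      (if r < K then (\<lambda>i. fst (snd (initial_config machine_of w) ! r)
         (snd (snd (initial_config machine_of w) ! r) + i)) else (\<lambda>_. Blank))" for r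
    using K by (cases r) (simp_all add: initial_config_def blank tc)
  then show ?thesis
    using K by (simp add: simulates_def initial_config_def tc number_def del: fun_upd_apply)
qed

end

lemma decidable_by_program:
  fixes c :: "'a::finite com" and p :: "nat poly"
  assumes wf: "wf_com K W c" "K \<ge> 1"
    and run: "\<And>w. \<exists>\<sigma>. exec c ((\<lambda>_. word_content [])(0 := word_content w)) (poly p (length w)) \<sigma> \<and>
      (acc (heads \<sigma>) \<longleftrightarrow> w \<in> L)"
  shows "decidable_in_ptime L"
proof -
  interpret compiled c K W acc
    using wf by unfold_locales
  \<comment> \<open>The added 1 pays for the step from \<open>Skip\<close> to the verdict.\<close>
  have "decides_in_time machine_of L (poly (p + 1))"
    unfolding decides_in_time_def config_after_def
  proof
    fix w
    obtain \<sigma> where \<sigma>: "exec c ((\<lambda>_. word_content [])(0 := word_content w)) (poly p (length w)) \<sigma>"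
      "acc (heads \<sigma>) \<longleftrightarrow> w \<in> L"
      using run by blast
    have "poly (p + 1) (length w) = Suc (poly p (length w))"
      by simp
    with \<sigma> simulates_run[OF simulates_initial \<sigma>(1)[unfolded exec_def]]
    show "halted ((machine_step machine_of ^^ poly (p + 1) (length w)) (initial_config machine_of w)) \<and>
      (accepting ((machine_step machine_of ^^ poly (p + 1) (length w)) (initial_config machine_of w)) \<longleftrightarrow> w \<in> L)"
      by (simp only:)
  qed
  then show ?thesis
    unfolding decidable_in_ptime_def using turing_machine_of by blast
qed

lemma move_view_stay [simp]: "move_view (v 0, Stay) v = v"
  by (auto simp: move_view_def fun_eq_iff)

section \<open>Calling a given machine\<close>

text \<open>The guard secures \<open>wf_act\<close>: \<open>delta M\<close> is controlled only on
  legal states and symbols, so for anything else under the heads nothing is done.\<close>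

definition call_act :: "'a machine \<Rightarrow> (nat \<Rightarrow> 'a symbol) \<Rightarrow> nat \<Rightarrow> 'a symbol \<times> move" where
  "call_act M h i = (let k = tape_count M; xs = map h [0..<k] in
     (case h k of
        Work q \<Rightarrow>
          if q < state_count M \<and> set xs \<subseteq> tape_alphabet M
          then if i < k then snd (delta M q xs) ! i
            else if i = k then (Work (fst (delta M q xs)), Stay) else (h i, Stay)
          else (h i, Stay)
      | _ \<Rightarrow> (h i, Stay)))"

abbreviation running :: "'a machine \<Rightarrow> (nat \<Rightarrow> 'a symbol) \<Rightarrow> bool" where
  "running M \<equiv> \<lambda>h. h (tape_count M) \<noteq> Work 1 \<and> h (tape_count M) \<noteq> Work 2"

abbreviation call_loop :: "'a machine \<Rightarrow> 'a com" where
  "call_loop M \<equiv> While (running M) (Act (call_act M))"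

text \<open>The state of the called machine is kept in the scanned cell of an additional tape.\<close>

definition call :: "'a machine \<Rightarrow> 'a com" where
  "call M = Seq (Act (\<lambda>h i. if i = tape_count M then (Work 0, Stay) else (h i, Stay)))
     (call_loop M)"

lemma tape_alphabet_symbols: "work_count M \<le> W \<Longrightarrow> tape_alphabet M \<subseteq> symbols W"
  by (auto simp: tape_alphabet_def symbols_def)

lemma turing_machineD:
  assumes "turing_machine M" "q < state_count M" "length xs = tape_count M" "set xs \<subseteq> tape_alphabet M"
  shows "fst (delta M q xs) < state_count M" "length (snd (delta M q xs)) = tape_count M"
    "i < tape_count M \<Longrightarrow> fst (snd (delta M q xs) ! i) \<in> tape_alphabet M"
proof -
  have *: "fst (delta M q xs) < state_count M \<and> length (snd (delta M q xs)) = tape_count M \<and>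
     fst ` set (snd (delta M q xs)) \<subseteq> tape_alphabet M"
    using assms unfolding turing_machine_def by blast
  then show "fst (delta M q xs) < state_count M" "length (snd (delta M q xs)) = tape_count M"
    by simp_all
  show "fst (snd (delta M q xs) ! i) \<in> tape_alphabet M" if "i < tape_count M"
    using * that by (metis image_subset_iff nth_mem)
qed

text \<open>Work symbols serve both as the work alphabet of \<open>M\<close> and as names of its
  states, hence the two bounds on \<open>W\<close>.\<close>

lemma wf_call:
  assumes M: "turing_machine M" and W: "work_count M \<le> W" "state_count M \<le> W"
  shows "wf_com (Suc (tape_count M)) W (call M)"
proof -
  have "wf_act (Suc (tape_count M)) W (\<lambda>h i. if i = tape_count M then (Work 0, Stay) else (h i, Stay))"
  proof (rule wf_actI, goal_cases)
    case (1 h r)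
    then show ?case using M W by (auto simp: symbols_def turing_machine_def)
  qed auto
  moreover have "wf_act (Suc (tape_count M)) W (call_act M)"
  proof (rule wf_actI, goal_cases)
    case (1 h r)
    let ?xs = "map h [0..<tape_count M]"
    show ?case
    proof (cases "\<exists>q. h (tape_count M) = Work q \<and> q < state_count M \<and> set ?xs \<subseteq> tape_alphabet M")
      case True
      then obtain q where q: "h (tape_count M) = Work q" "q < state_count M" "set ?xs \<subseteq> tape_alphabet M"
        by blast
      note D = turing_machineD[OF M q(2) _ q(3)]
      have "fst (call_act M h r) =
        (if r < tape_count M then fst (snd (delta M q ?xs) ! r)
         else if r = tape_count M then Work (fst (delta M q ?xs)) else h r)"
        using q by (simp add: call_act_def Let_def)
      then show ?thesis
        using D(1) D(3)[of r] 1[of r] W tape_alphabet_symbols[OF W(1)]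
        by (auto simp: symbols_def)
    next
      case False
      then have "call_act M h r = (h r, Stay)"
        by (auto simp: call_act_def Let_def split: symbol.splits)
      then show ?thesis using 1 by simp
    qed
  next
    case (2 h r)
    then show ?case by (simp add: call_act_def Let_def split: symbol.splits)
  qed
  ultimately show ?thesis
    by (simp add: call_def)
qed

context
  fixes M :: "'a::finite machine"
  assumes M: "turing_machine M"
begin

text \<open>The condition on the cells is an invariant that keeps the guard of
  \<open>call_act\<close> true.\<close>

definition called :: "'a config \<Rightarrow> 'a store \<Rightarrow> bool" where
  "called C \<sigma> \<longleftrightarrow> length (snd C) = tape_count M \<and> fst C < state_count M \<and>
     (\<forall>r < tape_count M. \<forall>i. fst (snd C ! r) i \<in> tape_alphabet M) \<and>
     (\<forall>r < tape_count M. \<sigma> r = (\<lambda>i. fst (snd C ! r) (snd (snd C ! r) + i))) \<and>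
     \<sigma> (tape_count M) 0 = Work (fst C)"

lemma called_step:
  assumes "called C \<sigma>" and nh: "\<not> halted C"
  shows "called (machine_step M C) (apply_acts (call_act M (heads \<sigma>)) \<sigma>)"
proof -
  define k where "k = tape_count M"
  obtain q ts where C: "C = (q, ts)" by fastforce
  have len: "length ts = k" and q: "q < state_count M"
    and cells: "\<And>r i. r < k \<Longrightarrow> fst (ts ! r) i \<in> tape_alphabet M"
    and \<sigma>: "\<And>r. r < k \<Longrightarrow> \<sigma> r = (\<lambda>i. fst (ts ! r) (snd (ts ! r) + i))"
    and \<sigma>k: "\<sigma> k 0 = Work q"
    using assms(1) unfolding called_def C k_def by auto
  have xs: "map (heads \<sigma>) [0..<k] = map scanned ts"
    using len by (intro nth_equalityI) (simp_all add: heads_def scanned_def \<sigma>)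
  have sub: "set (map scanned ts) \<subseteq> tape_alphabet M"
    using cells len by (metis (no_types, lifting) image_subsetI in_set_conv_nth list.set_map scanned_def)
  define q' as where "q' = fst (delta M q (map scanned ts))" and "as = snd (delta M q (map scanned ts))"
  note D = turing_machineD[OF M q _ sub, folded k_def, folded q'_def as_def]
  have step: "machine_step M C = (q', map2 act as ts)"
    using nh unfolding C machine_step_def by (simp add: q'_def as_def case_prod_unfold Let_def)
  have act: "call_act M (heads \<sigma>) r = (if r < k then as ! r else if r = k then (Work q', Stay) else (heads \<sigma> r, Stay))" for r
    using xs sub q \<sigma>k unfolding call_act_def Let_def k_def[symmetric] q'_def as_def
    by (simp add: heads_def)
  have view: "move_view a (\<lambda>i. fst t (snd t + i)) = (\<lambda>i. fst (act a t) (snd (act a t) + i))"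
    for a :: "'a symbol \<times> move" and t
    by (auto simp: move_view_def act_def fun_eq_iff algebra_simps)
  have la: "length as = k"
    using D(2) len by simp
  have cells': "fst (act (as ! r) (ts ! r)) i \<in> tape_alphabet M" if "r < k" for r i
    using that cells D(3)[of r] len by (simp add: act_def)
  show ?thesis
    unfolding called_def step k_def[symmetric]
    using la len D(1) cells'
    by (simp add: apply_acts_def act \<sigma> view move_view_def \<sigma>k)
qed

text \<open>Three steps per step of \<open>M\<close>: unfolding the loop, the action itself, and
  dropping the resulting \<open>Skip\<close>. The last step is the failing loop test.\<close>

lemma exec_call_loop:
  "called C \<sigma> \<Longrightarrow> halted ((machine_step M ^^ t) C) \<Longrightarrow>
     \<exists>\<sigma>'. exec (call_loop M)
        \<sigma> (3 * t + 1) \<sigma>' \<and> \<sigma>' (tape_count M) 0 = Work (fst ((machine_step M ^^ t) C))"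
proof (induction t arbitrary: C \<sigma>)
  case 0
  then have "heads \<sigma> (tape_count M) = Work (fst C)" "halted C"
    by (auto simp: called_def heads_def)
  then show ?case
    using exec_While_False[where n = 0 and \<sigma> = \<sigma>] by (intro exI[of _ \<sigma>]) (auto simp: halted_def heads_def)
next
  case (Suc t)
  have h: "heads \<sigma> (tape_count M) = Work (fst C)"
    using Suc.prems by (auto simp: called_def heads_def)
  show ?case
  proof (cases "halted C")
    case True
    then have "machine_step M C = C"
      by (simp add: machine_step_def)
    then have same: "(machine_step M ^^ n) C = C" for n
      by (induction n) simp_all
    have "exec (call_loop M)
        \<sigma> (3 * Suc t + 1) \<sigma>"
      by (rule exec_While_False) (use h True in \<open>auto simp: halted_def\<close>)
    then show ?thesis
      using h by (intro exI[of _ \<sigma>]) (simp only: same heads_def)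
  next
    case False
    obtain \<sigma>' where \<sigma>': "exec (call_loop M)
        (apply_acts (call_act M (heads \<sigma>)) \<sigma>) (3 * t + 1) \<sigma>'"
        "\<sigma>' (tape_count M) 0 = Work (fst ((machine_step M ^^ t) (machine_step M C)))"
      using Suc.IH[OF called_step[OF Suc.prems(1) False]] Suc.prems(2)
      unfolding funpow_Suc_right comp_apply by blast
    have "heads \<sigma> (tape_count M) \<noteq> Work 1 \<and> heads \<sigma> (tape_count M) \<noteq> Work 2"
      using h False by (simp add: halted_def)
    from exec_While_True[where t = "running M", OF this exec_Act \<sigma>'(1)]
    have "exec (call_loop M)
       \<sigma> (3 * Suc t + 1) \<sigma>'"
      by (rule exec_mono) simp
    then show ?thesis
      using \<sigma>'(2) unfolding funpow_Suc_right comp_apply by blast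
  qed
qed

lemma exec_call:
  assumes "halted (config_after M t w)"
  shows "\<exists>\<sigma>. exec (call M) ((\<lambda>_. word_content [])(0 := word_content w)) (3 * t + 3) \<sigma> \<and>
     \<sigma> (tape_count M) 0 = Work (fst (config_after M t w))"
proof -
  define \<sigma>0 :: "'a store" where "\<sigma>0 = (\<lambda>_. word_content [])(0 := word_content w)"
  define f :: "(nat \<Rightarrow> 'a symbol) \<Rightarrow> nat \<Rightarrow> 'a symbol \<times> move"
    where "f = (\<lambda>h i. if i = tape_count M then (Work 0, Stay) else (h i, Stay))"
  define \<sigma>1 where "\<sigma>1 = apply_acts (f (heads \<sigma>0)) \<sigma>0"
  have k: "tape_count M \<ge> 1" and sc: "state_count M \<ge> 3"
    using M by (auto simp: turing_machine_def)
  have \<sigma>1: "\<sigma>1 r = (if r = tape_count M then (\<sigma>0 r)(0 := Work 0) else \<sigma>0 r)" for r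
    by (auto simp: \<sigma>1_def apply_acts_def f_def heads_def move_view_def fun_eq_iff)
  have alph: "word_content v i \<in> tape_alphabet M" for v i
    by (simp add: word_content_def tape_alphabet_def)
  have "called (initial_config M w) \<sigma>1"
    unfolding called_def
  proof (intro conjI allI impI)
    fix r i assume r: "r < tape_count M"
    show "fst (snd (initial_config M w) ! r) i \<in> tape_alphabet M"
      using r by (cases r) (simp_all add: initial_config_def alph)
    show "\<sigma>1 r = (\<lambda>i. fst (snd (initial_config M w) ! r) (snd (snd (initial_config M w) ! r) + i))"
      using r unfolding \<sigma>1 \<sigma>0_def by (cases r) (simp_all add: initial_config_def)
  qed (use k sc in \<open>simp_all add: initial_config_def \<sigma>1\<close>)
  from exec_call_loop[OF this assms[unfolded config_after_def]]
  obtain \<sigma>' where \<sigma>': "exec (call_loop M)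
        \<sigma>1 (3 * t + 1) \<sigma>'" "\<sigma>' (tape_count M) 0 = Work (fst (config_after M t w))"
    unfolding config_after_def by blast
  have "exec (call M) \<sigma>0 (1 + (3 * t + 1) + 1) \<sigma>'"
    unfolding call_def f_def[symmetric]
    by (rule exec_Seq[OF _ \<sigma>'(1)]) (unfold \<sigma>1_def, rule exec_Act)
  then show ?thesis
    using \<sigma>'(2) unfolding \<sigma>0_def by (intro exI[of _ \<sigma>']) (simp add: numeral_eq_Suc)
qed

end

section \<open>Stack programs\<close>

type_synonym word = "letter list"

type_synonym contents = "nat \<Rightarrow> word"

text \<open>The head stands on the top of the stack, which extends to the right and is surrounded by
  blanks. Thus the initial store is already of this form, with the input on stack 0.\<close>

definition stacks :: "(contents) \<Rightarrow> letter store" where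
  "stacks s r = word_content (s r)"

definition run :: "letter com \<Rightarrow> (contents) \<Rightarrow> nat \<Rightarrow> (contents) \<Rightarrow> bool" where
  "run c s t s' \<longleftrightarrow> exec c (stacks s) t (stacks s')"

lemma heads_stacks: "heads (stacks s) r = (case s r of [] \<Rightarrow> Blank | a # _ \<Rightarrow> Input a)"
  by (simp add: heads_def stacks_def word_content_def split: list.split)

lemma run_mono: "run c s t s' \<Longrightarrow> t \<le> t' \<Longrightarrow> run c s t' s'"
  unfolding run_def by (rule exec_mono)

lemma run_Skip: "run Skip s t s"
  unfolding run_def by (rule exec_Skip)

lemma run_Seq:
  assumes "run a s t1 s1" "run b s1 t2 s2"
  shows "run (Seq a b) s (t1 + t2 + 1) s2"
  using assms unfolding run_def by (rule exec_Seq)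

lemma run_Cond:
  assumes "if t (heads (stacks s)) then run a s n s' else run b s n s'"
  shows "run (Cond t a b) s (n + 1) s'"
  using assms exec_If_True exec_If_False unfolding run_def by (auto split: if_splits)

lemma run_While_False: "\<not> t (heads (stacks s)) \<Longrightarrow> run (While t a) s (n + 1) s"
  unfolding run_def by (rule exec_While_False)

lemma run_While_True:
  assumes "t (heads (stacks s))" "run a s n s1" "run (While t a) s1 m s2"
  shows "run (While t a) s (n + m + 2) s2"
  using assms unfolding run_def by (rule exec_While_True)

definition nonempty :: "nat \<Rightarrow> (nat \<Rightarrow> letter symbol) \<Rightarrow> bool" where
  "nonempty r h \<longleftrightarrow> h r \<noteq> Blank"

definition top_is :: "nat \<Rightarrow> letter \<Rightarrow> (nat \<Rightarrow> letter symbol) \<Rightarrow> bool" where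
  "top_is r a h \<longleftrightarrow> h r = Input a"

lemma nonempty_stacks [simp]: "nonempty r (heads (stacks s)) \<longleftrightarrow> s r \<noteq> []"
  by (simp add: nonempty_def heads_stacks split: list.split)

lemma top_is_stacks [simp]: "top_is r a (heads (stacks s)) \<longleftrightarrow> s r \<noteq> [] \<and> hd (s r) = a"
  by (simp add: top_is_def heads_stacks split: list.split)

lemma move_view_push: "move_view (Input a, Stay) (move_view (word_content w 0, Go_Left) (word_content w))
    = word_content (a # w)"
  by (auto simp: move_view_def word_content_def fun_eq_iff nat_diff_distrib nth_Cons split: nat.split)

lemma move_view_pop: "move_view (Blank, Go_Right) (word_content w) = word_content (tl w)"
  by (auto simp: move_view_def word_content_def fun_eq_iff nth_tl nat_add_distrib)

text \<open>A machine step writes before it moves, so pushing takes two actions: step left, then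
  write.\<close>

definition shift_left :: "nat set \<Rightarrow> letter com" where
  "shift_left Q = Act (\<lambda>h i. (h i, if i \<in> Q then Go_Left else Stay))"

definition push :: "nat \<Rightarrow> letter \<Rightarrow> letter com" where
  "push r a = Seq (shift_left {r}) (Act (\<lambda>h i. if i = r then (Input a, Stay) else (h i, Stay)))"

definition pop :: "nat \<Rightarrow> letter com" where
  "pop r = Act (\<lambda>h i. if i = r then (Blank, Go_Right) else (h i, Stay))"

definition transfer :: "nat \<Rightarrow> nat set \<Rightarrow> letter com" where
  "transfer r Q = Seq (shift_left Q) (Act (\<lambda>h i. if i \<in> Q then (h r, Stay)
     else if i = r then (Blank, Go_Right) else (h i, Stay)))"

text \<open>With \<open>Q\<close> empty this erases the stack, with two targets it duplicates it.
  The order is reversed, so a second move restores it.\<close>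

definition move :: "nat \<Rightarrow> nat set \<Rightarrow> letter com" where
  "move r Q = While (nonempty r) (transfer r Q)"

lemma wf_push: "r < K \<Longrightarrow> wf_com K W (push r a)"
  unfolding push_def shift_left_def wf_com.simps
  by (intro conjI wf_actI) (auto simp: symbols_def)

lemma wf_pop: "r < K \<Longrightarrow> wf_com K W (pop r)"
  unfolding pop_def wf_com.simps
  by (intro conjI wf_actI) (auto simp: symbols_def)

lemma wf_transfer: "r < K \<Longrightarrow> Q \<subseteq> {..<K} \<Longrightarrow> wf_com K W (transfer r Q)"
  unfolding transfer_def shift_left_def wf_com.simps
  by (intro conjI wf_actI) (auto simp: symbols_def)

lemma wf_move: "r < K \<Longrightarrow> Q \<subseteq> {..<K} \<Longrightarrow> wf_com K W (move r Q)"
  unfolding move_def by (simp add: wf_transfer)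

lemma run_push:
  assumes "s' = s(r := a # s r)"
  shows "run (push r a) s 3 s'"
proof -
  let ?f = "\<lambda>h i. (h i, if i \<in> {r} then Go_Left else Stay) :: letter symbol \<times> move"
  let ?g = "\<lambda>h i. if i = r then (Input a, Stay) else (h i, Stay) :: letter symbol \<times> move"
  let ?s1 = "apply_acts (?f (heads (stacks s))) (stacks s)"
  have "apply_acts (?g (heads ?s1)) ?s1 = stacks s'"
  proof
    fix i
    show "apply_acts (?g (heads ?s1)) ?s1 i = stacks s' i"
      using move_view_push[of a "s r"]
      by (cases "i = r") (simp_all add: apply_acts_def heads_def stacks_def assms)
  qed
  then show ?thesis
    using exec_Seq[OF exec_Act[of ?f "stacks s"] exec_Act[of ?g ?s1]]
    unfolding run_def push_def shift_left_def by (simp add: numeral_eq_Suc)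
qed

lemma run_pop:
  assumes "s' = s(r := tl (s r))"
  shows "run (pop r) s 1 s'"
proof -
  let ?g = "\<lambda>h i. if i = r then (Blank, Go_Right) else (h i, Stay) :: letter symbol \<times> move"
  have "apply_acts (?g (heads (stacks s))) (stacks s) = stacks s'"
  proof
    fix i
    show "apply_acts (?g (heads (stacks s))) (stacks s) i = stacks s' i"
      using move_view_pop[of "s r"]
      by (cases "i = r") (simp_all add: apply_acts_def heads_def stacks_def assms)
  qed
  then show ?thesis
    using exec_Act[of ?g "stacks s"] unfolding run_def pop_def by simp
qed

lemma run_transfer:
  assumes "s r = a # w" "r \<notin> Q" "s' = (\<lambda>i. if i \<in> Q then a # s i else if i = r then w else s i)"
  shows "run (transfer r Q) s 3 s'"
proof -
  let ?f = "\<lambda>h i. (h i, if i \<in> Q then Go_Left else Stay) :: letter symbol \<times> move"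
  let ?g = "\<lambda>h i. if i \<in> Q then (h r, Stay) else if i = r then (Blank, Go_Right)
     else (h i, Stay) :: letter symbol \<times> move"
  let ?s1 = "apply_acts (?f (heads (stacks s))) (stacks s)"
  have hr: "heads ?s1 r = Input a"
    using assms(1,2) by (simp add: apply_acts_def heads_def stacks_def move_view_def word_content_def)
  have "apply_acts (?g (heads ?s1)) ?s1 = stacks s'"
  proof
    fix i
    consider "i \<in> Q" | "i \<notin> Q" "i = r" | "i \<notin> Q" "i \<noteq> r" by blast
    then show "apply_acts (?g (heads ?s1)) ?s1 i = stacks s' i"
    proof cases
      case 1
      then have "apply_acts (?g (heads ?s1)) ?s1 i = move_view (Input a, Stay) (?s1 i)"
        by (subst apply_acts_def) (simp add: hr)
      then show ?thesis
        using 1 move_view_push[of a "s i"] by (simp add: apply_acts_def heads_def stacks_def assms)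
    next
      case 2
      then show ?thesis
        using move_view_pop[of "s r"] assms(1) by (simp add: apply_acts_def heads_def stacks_def assms(2,3))
    next
      case 3
      then show ?thesis by (simp add: apply_acts_def heads_def stacks_def assms)
    qed
  qed
  then show ?thesis
    using exec_Seq[OF exec_Act[of ?f "stacks s"] exec_Act[of ?g ?s1]]
    unfolding run_def transfer_def shift_left_def by (simp add: numeral_eq_Suc)
qed

lemma run_move:
  assumes "r \<notin> Q" "s' = (\<lambda>i. if i \<in> Q then rev (s r) @ s i else if i = r then [] else s i)"
  shows "run (move r Q) s (5 * length (s r) + 1) s'"
  using assms
proof (induction "s r" arbitrary: s)
  case Nil
  then have "s' = s" by (auto simp: fun_eq_iff)
  then show ?case
    using run_While_False[of "nonempty r" s "transfer r Q" 0] Nil by (simp add: move_def)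
next
  case (Cons a w)
  let ?s1 = "\<lambda>i. if i \<in> Q then a # s i else if i = r then w else s i"
  have 1: "run (transfer r Q) s 3 ?s1"
    using Cons by (intro run_transfer) auto
  have "w = ?s1 r" using Cons by simp
  moreover have "s' = (\<lambda>i. if i \<in> Q then rev (?s1 r) @ ?s1 i else if i = r then [] else ?s1 i)"
    using Cons.prems Cons.hyps(2)[symmetric] by (auto simp: fun_eq_iff)
  ultimately have 2: "run (move r Q) ?s1 (5 * length (?s1 r) + 1) s'"
    using Cons.hyps(1)[of ?s1] Cons.prems(1) by blast
  have len: "length (s r) = Suc (length w)" "length (?s1 r) = length w"
    using Cons.hyps(2)[symmetric] Cons.prems(1) by simp_all
  have "nonempty r (heads (stacks s))"
    using Cons.hyps(2)[symmetric] by simp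
  from run_While_True[of "nonempty r", OF this 1 2[unfolded move_def]]
  have "run (move r Q) s (3 + (5 * length (?s1 r) + 1) + 2) s'"
    unfolding move_def .
  then show ?case
    unfolding len by (simp add: algebra_simps)
qed

primrec pushes :: "nat \<Rightarrow> word \<Rightarrow> letter com" where
  "pushes r [] = Skip"
| "pushes r (a # w) = Seq (pushes r w) (push r a)"

lemma wf_pushes: "r < K \<Longrightarrow> wf_com K W (pushes r w)"
  by (induction w) (simp_all add: wf_push)

lemma run_pushes: "s' = s(r := w @ s r) \<Longrightarrow> run (pushes r w) s (4 * length w) s'"
proof (induction w arbitrary: s')
  case Nil
  then show ?case using run_Skip by (simp add: run_def)
next
  case (Cons a w)
  have "run (push r a) (s(r := w @ s r)) 3 s'"
    using Cons.prems by (intro run_push) (auto simp: fun_eq_iff)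
  from run_Seq[OF Cons.IH[OF refl] this] show ?case by (simp add: algebra_simps)
qed

section \<open>Trees as words\<close>

datatype tree = Leaf | Node tree tree

text \<open>Preorder notation is self-delimiting: the end of a subtree is found by counting, so
  juxtaposition needs no separators.\<close>

primrec code :: "tree \<Rightarrow> word" where
  "code Leaf = [Zero]"
| "code (Node a b) = One # code a @ code b"

text \<open>Moves the first tree on stack 0 to stack \<open>k\<close>; stack \<open>k + 1\<close> counts the trees still to be read.\<close>

definition split_step :: "nat \<Rightarrow> letter com" where
  "split_step k = Cond (top_is 0 One) (Seq (transfer 0 {k}) (push (Suc k) One))
     (Seq (transfer 0 {k}) (pop (Suc k)))"

abbreviation split_loop :: "nat \<Rightarrow> letter com" where
  "split_loop k \<equiv> While (nonempty (Suc k)) (split_step k)"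

definition split_tree :: "nat \<Rightarrow> letter com" where
  "split_tree k = Seq (push (Suc k) One) (split_loop k)"

lemma wf_split_tree: "Suc k < K \<Longrightarrow> wf_com K W (split_tree k)"
  unfolding split_tree_def split_step_def by (simp add: wf_push wf_pop wf_transfer)

lemma run_split_step:
  assumes "k > 0"
  shows "run (split_step k) (s(0 := One # x, k := z, Suc k := One # n)) 8
      (s(0 := x, k := One # z, Suc k := One # One # n))"
    and "run (split_step k) (s(0 := Zero # x, k := z, Suc k := One # n)) 8
      (s(0 := x, k := Zero # z, Suc k := n))"
proof -
  have "run (transfer 0 {k}) (s(0 := One # x, k := z, Suc k := One # n)) 3
      (s(0 := x, k := One # z, Suc k := One # n))"
    using assms by (intro run_transfer[where w = x]) (auto simp: fun_eq_iff)
  moreover have "run (push (Suc k) One) (s(0 := x, k := One # z, Suc k := One # n)) 3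
      (s(0 := x, k := One # z, Suc k := One # One # n))"
    by (intro run_push) simp
  ultimately have "run (Seq (transfer 0 {k}) (push (Suc k) One)) (s(0 := One # x, k := z, Suc k := One # n)) 7
     (s(0 := x, k := One # z, Suc k := One # One # n))"
    using run_Seq by fastforce
  then show "run (split_step k) (s(0 := One # x, k := z, Suc k := One # n)) 8
      (s(0 := x, k := One # z, Suc k := One # One # n))"
    unfolding split_step_def using assms by (intro run_Cond[where n = 7, simplified]) simp
  have "run (transfer 0 {k}) (s(0 := Zero # x, k := z, Suc k := One # n)) 3
      (s(0 := x, k := Zero # z, Suc k := One # n))"
    using assms by (intro run_transfer[where w = x]) (auto simp: fun_eq_iff)
  moreover have "run (pop (Suc k)) (s(0 := x, k := Zero # z, Suc k := One # n)) 1
      (s(0 := x, k := Zero # z, Suc k := n))"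
    by (intro run_pop) simp
  ultimately have "run (Seq (transfer 0 {k}) (pop (Suc k))) (s(0 := Zero # x, k := z, Suc k := One # n)) 5
     (s(0 := x, k := Zero # z, Suc k := n))"
    using run_Seq by fastforce
  then have "run (Seq (transfer 0 {k}) (pop (Suc k))) (s(0 := Zero # x, k := z, Suc k := One # n)) 7
     (s(0 := x, k := Zero # z, Suc k := n))"
    by (rule run_mono) simp
  then show "run (split_step k) (s(0 := Zero # x, k := z, Suc k := One # n)) 8
      (s(0 := x, k := Zero # z, Suc k := n))"
    unfolding split_step_def using assms by (intro run_Cond[where n = 7, simplified]) simp
qed

text \<open>Stated in terms of an arbitrary continuation, because the loop does not stop between the
  two subtrees of a node. The induction hypotheses then chain. Each letter costs 8 steps of
  \<open>split_step\<close> and 2 of the loop.\<close>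

lemma run_split_loop:
  assumes "k > 0"
  shows "run (split_loop k) (s(0 := x, k := rev (code a) @ z, Suc k := n)) t s' \<Longrightarrow>
     run (split_loop k) (s(0 := code a @ x, k := z, Suc k := One # n))
       (t + 10 * length (code a)) s'"
proof (induction a arbitrary: x z n t)
  case Leaf
  have ne: "nonempty (Suc k) (heads (stacks (s(0 := Zero # x, k := z, Suc k := One # n))))"
    by simp
  from run_While_True[of "nonempty (Suc k)", OF ne run_split_step(2)[OF assms]
      Leaf[unfolded code.simps rev.simps append.simps]]
  have "run (split_loop k) (s(0 := Zero # x, k := z, Suc k := One # n)) (8 + t + 2) s'" .
  then show ?case
    unfolding code.simps append.simps by (rule run_mono) simp
next
  case (Node a b)
  have "run (split_loop k)
      (s(0 := code b @ x, k := rev (code a) @ One # z, Suc k := One # n)) (t + 10 * length (code b)) s'"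
    using Node by (intro Node.IH(2)) simp
  then have *: "run (split_loop k)
      (s(0 := code a @ code b @ x, k := One # z, Suc k := One # One # n))
      (t + 10 * length (code b) + 10 * length (code a)) s'"
    by (rule Node.IH(1))
  have ne: "nonempty (Suc k) (heads (stacks (s(0 := One # code a @ code b @ x, k := z, Suc k := One # n))))"
    by simp
  from run_While_True[of "nonempty (Suc k)", OF ne run_split_step(1)[OF assms] *]
  show ?case
    unfolding code.simps append.simps append_assoc by (rule run_mono) simp
qed

lemma run_split_tree:
  assumes "k > 0" "s 0 = code a @ x" "s (Suc k) = []" "s' = s(0 := x, k := rev (code a) @ s k)"
  shows "run (split_tree k) s (10 * length (code a) + 5) s'"
proof -
  have s: "s = s(0 := code a @ x, k := s k, Suc k := [])"
    using assms by (auto simp: fun_eq_iff)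
  have s': "s' = s(0 := x, k := rev (code a) @ s k, Suc k := [])"
    using assms by (auto simp: fun_eq_iff)
  have "run (split_loop k) s' (0 + 1) s'"
    by (rule run_While_False) (simp add: s')
  then have "run (split_loop k) (s(0 := code a @ x, k := s k, Suc k := [One])) (1 + 10 * length (code a)) s'"
    using run_split_loop[OF assms(1), of s x a "s k" "[]" 1 s'] s' by simp
  moreover have "run (push (Suc k) One) s 3 (s(0 := code a @ x, k := s k, Suc k := [One]))"
    using assms by (intro run_push) (auto simp: fun_eq_iff)
  ultimately show ?thesis
    unfolding split_tree_def using run_Seq by (fastforce simp: algebra_simps)
qed

section \<open>Polynomially bounded functions\<close>

definition poly_bounded :: "(nat \<Rightarrow> nat) \<Rightarrow> bool" where
  "poly_bounded T \<longleftrightarrow> (\<exists>p :: nat poly. \<forall>n. T n \<le> poly p n)"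

lemma poly_nat_mono: "m \<le> n \<Longrightarrow> poly p m \<le> poly (p :: nat poly) n"
  by (induction p) (auto intro!: add_mono mult_mono)

lemma poly_bounded_const [intro!]: "poly_bounded (\<lambda>_. c)"
  unfolding poly_bounded_def by (rule exI[of _ "[:c:]"]) simp

lemma poly_bounded_id [intro!]: "poly_bounded (\<lambda>n. n)"
  unfolding poly_bounded_def by (rule exI[of _ "[:0, 1:]"]) simp

lemma poly_bounded_add [intro!]:
  assumes "poly_bounded S" "poly_bounded T"
  shows "poly_bounded (\<lambda>n. S n + T n)"
proof -
  obtain p q where "\<forall>n. S n \<le> poly p n" "\<forall>n. T n \<le> poly q n"
    using assms unfolding poly_bounded_def by blast
  then have "S n + T n \<le> poly (p + q) n" for n
    by (simp add: add_mono)
  then show ?thesis unfolding poly_bounded_def by blast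
qed

lemma poly_bounded_mult [intro!]:
  assumes "poly_bounded S" "poly_bounded T"
  shows "poly_bounded (\<lambda>n. S n * T n)"
proof -
  obtain p q where "\<forall>n. S n \<le> poly p n" "\<forall>n. T n \<le> poly q n"
    using assms unfolding poly_bounded_def by blast
  then have "S n * T n \<le> poly (p * q) n" for n
    by (simp add: mult_mono)
  then show ?thesis unfolding poly_bounded_def by blast
qed

lemma poly_bounded_Suc [intro!]: "poly_bounded T \<Longrightarrow> poly_bounded (\<lambda>n. Suc (T n))"
  using poly_bounded_add[of T "\<lambda>_. 1"] by auto

lemma poly_bounded_comp:
  assumes "poly_bounded S" "poly_bounded T"
  shows "poly_bounded (\<lambda>n. S (T n))"
proof -
  obtain p q where p: "\<forall>n. S n \<le> poly p n" and q: "\<forall>n. T n \<le> poly q n"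
    using assms unfolding poly_bounded_def by blast
  have "S (T n) \<le> poly (pcompose p q) n" for n
    using p q poly_nat_mono[of "T n" "poly q n" p] by (auto simp: poly_pcompose intro: order_trans)
  then show ?thesis unfolding poly_bounded_def by blast
qed

text \<open>Polynomials with natural coefficients are monotone. Monotone bounds are wanted because
  time bounds get evaluated at estimates of a size.\<close>

lemma poly_bounded_obtain_mono:
  assumes "poly_bounded T"
  obtains S where "poly_bounded S" "mono S" "\<And>n. T n \<le> S n"
proof -
  obtain p :: "nat poly" where p: "\<forall>n. T n \<le> poly p n"
    using assms unfolding poly_bounded_def by blast
  show ?thesis
  proof (rule that[of "poly p"])
    show "poly_bounded (poly p)" unfolding poly_bounded_def by blast
    show "mono (poly p)" by (rule monoI) (rule poly_nat_mono)
  qed (use p in simp)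
qed

section \<open>Polynomial-time functions on encoded data\<close>

class encodable = fixes enc :: "'a \<Rightarrow> tree"

instantiation unit :: encodable
begin
definition enc_unit :: "unit \<Rightarrow> tree" where "enc_unit _ = Leaf"
instance ..
end

instantiation list :: (encodable) encodable
begin
primrec enc_list :: "'a list \<Rightarrow> tree" where
  "enc_list [] = Leaf"
| "enc_list (x # xs) = Node (enc x) (enc_list xs)"
instance ..
end

instantiation prod :: (encodable, encodable) encodable
begin
definition enc_prod :: "'a \<times> 'b \<Rightarrow> tree" where "enc_prod p = Node (enc (fst p)) (enc (snd p))"
instance ..
end

text \<open>Booleans, options and letters borrow the encoding of lists, so that
  \<open>polytime_case_list\<close> is the only primitive case distinction.\<close>

instantiation bool :: encodable
begin
definition enc_bool :: "bool \<Rightarrow> tree" where "enc_bool b = enc (if b then [()] else [])"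
instance ..
end

instantiation option :: (encodable) encodable
begin
definition enc_option :: "'a option \<Rightarrow> tree" where
  "enc_option o' = enc (case o' of None \<Rightarrow> [] | Some x \<Rightarrow> [x])"
instance ..
end

definition letters :: "word" where
  "letters = [Zero, One, Minus, Infinity, Comma, Bar]"

primrec letter_index :: "letter \<Rightarrow> nat" where
  "letter_index Zero = 0"
| "letter_index One = 1"
| "letter_index Minus = 2"
| "letter_index Infinity = 3"
| "letter_index Comma = 4"
| "letter_index Bar = 5"

lemma letters_nth: "letter_index a < length letters" "letters ! letter_index a = a"
  by (cases a; simp add: letters_def)+

instantiation letter :: encodable
begin
definition enc_letter :: "letter \<Rightarrow> tree" where "enc_letter a = enc (replicate (letter_index a) ())"
instance ..
end

definition bits :: "'a::encodable \<Rightarrow> word" where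
  "bits x = code (enc x)"

definition sz :: "'a::encodable \<Rightarrow> nat" where
  "sz x = length (bits x)"

lemma bits_Pair [simp]: "bits (x, y) = One # bits x @ bits y"
  by (simp add: bits_def enc_prod_def)

lemma bits_Nil [simp]: "bits [] = [Zero]"
  by (simp add: bits_def)

lemma bits_Cons [simp]: "bits (x # xs) = One # bits x @ bits xs"
  by (simp add: bits_def)

lemma sz_Pair [simp]: "sz (x, y) = Suc (sz x + sz y)"
  by (simp add: sz_def)

lemma sz_prod: "sz p = Suc (sz (fst p) + sz (snd p))"
  by (cases p) simp

lemma sz_Nil [simp]: "sz [] = 1"
  by (simp add: sz_def)

lemma sz_Cons [simp]: "sz (x # xs) = Suc (sz x + sz xs)"
  by (simp add: sz_def)

lemma sz_bool: "sz (b :: bool) \<le> 3"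
  by (simp add: sz_def bits_def enc_bool_def enc_unit_def)

lemma sz_None [simp]: "sz None = 1"
  by (simp add: sz_def bits_def enc_option_def)

lemma sz_Some [simp]: "sz (Some x) = Suc (Suc (sz x))"
  by (simp add: sz_def bits_def enc_option_def)

lemma sz_letter: "sz (a :: letter) \<le> 11"
  by (cases a) (simp_all add: sz_def bits_def enc_letter_def enc_unit_def numeral_eq_Suc)

lemma sz_append: "sz (xs @ ys) + 1 = sz xs + sz ys"
  by (induction xs) auto

lemma sz_pos: "sz x > 0"
  unfolding sz_def bits_def by (cases "enc x") auto

lemma length_le_sz: "length xs \<le> sz xs"
  by (induction xs) auto

lemma sz_member_le: "x \<in> set xs \<Longrightarrow> sz x \<le> sz xs"
  by (induction xs) auto

lemma sz_list_le: "(\<And>x. x \<in> set xs \<Longrightarrow> sz x \<le> m) \<Longrightarrow> sz xs \<le> Suc (length xs * Suc m)"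
  by (induction xs) (simp, fastforce)

text \<open>Stacks \<open>1, \<dots>, K - 1\<close> are scratch space, which is left empty; the others are untouched.\<close>

definition implements :: "letter com \<Rightarrow> nat \<Rightarrow> (nat \<Rightarrow> nat) \<Rightarrow> ('a::encodable \<Rightarrow> 'b::encodable) \<Rightarrow> bool" where
  "implements c K T f \<longleftrightarrow> K \<ge> 1 \<and> (\<forall>W. wf_com K W c) \<and>
     (\<forall>s x. s 0 = bits x \<longrightarrow> (\<forall>r. 0 < r \<and> r < K \<longrightarrow> s r = []) \<longrightarrow>
        run c s (T (sz x)) (s(0 := bits (f x))))"

text \<open>The size bound is carried along because in a composition the running time of the outer
  function depends on the size of the inner result.\<close>

definition polytime :: "('a::encodable \<Rightarrow> 'b::encodable) \<Rightarrow> bool" where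
  "polytime f \<longleftrightarrow> (\<exists>c K T. poly_bounded T \<and> implements c K T f) \<and>
     (\<exists>B. poly_bounded B \<and> (\<forall>x. sz (f x) \<le> B (sz x)))"

lemma implements_mono:
  assumes "implements c K T f" "K \<le> K'" "\<And>n. T n \<le> T' n"
  shows "implements c K' T' f"
proof -
  have "run c s (T' (sz x)) (s(0 := bits (f x)))"
    if "s 0 = bits x" "\<forall>r. 0 < r \<and> r < K' \<longrightarrow> s r = []" for s x
  proof -
    have "run c s (T (sz x)) (s(0 := bits (f x)))"
      using assms(1,2) that unfolding implements_def by force
    then show ?thesis using assms(3) by (rule run_mono)
  qed
  moreover have "K' \<ge> 1" "\<forall>W. wf_com K' W c"
    using assms(1,2) wf_com_mono unfolding implements_def by fastforce+
  ultimately show ?thesis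
    unfolding implements_def by blast
qed

lemma implementsD:
  assumes "implements c K T f"
  shows "K \<le> K' \<Longrightarrow> wf_com K' W c"
    and "s 0 = bits x \<Longrightarrow> (\<And>r. 0 < r \<Longrightarrow> r < K \<Longrightarrow> s r = []) \<Longrightarrow> s' = s(0 := bits (f x)) \<Longrightarrow>
      T (sz x) \<le> t \<Longrightarrow> run c s t s'"
proof -
  show "wf_com K' W c" if "K \<le> K'"
    using assms that wf_com_mono unfolding implements_def by blast
  show "run c s t s'" if "s 0 = bits x" "\<And>r. 0 < r \<Longrightarrow> r < K \<Longrightarrow> s r = []" "s' = s(0 := bits (f x))" "T (sz x) \<le> t"
  proof -
    have "run c s (T (sz x)) s'"
      using assms that(1,2,3) unfolding implements_def by blast
    then show ?thesis using that(4) by (rule run_mono)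
  qed
qed

lemma polytimeE:
  assumes "polytime f"
  obtains c K T where "implements c K T f" "mono T" "poly_bounded T" "\<And>x. sz (f x) \<le> T (sz x)" "K \<ge> 1"
proof -
  obtain c K T B where T: "poly_bounded T" "implements c K T f"
    and B: "poly_bounded B" "\<forall>x. sz (f x) \<le> B (sz x)"
    using assms unfolding polytime_def by blast
  obtain S where S: "poly_bounded S" "mono S" "\<And>n. T n + B n \<le> S n"
    using poly_bounded_obtain_mono[OF poly_bounded_add[OF T(1) B(1)]] by blast
  show ?thesis
  proof (rule that[of c K S])
    show "implements c K S f"
      using implements_mono[OF T(2) order_refl] S(3) add_leD1 by blast
    show "sz (f x) \<le> S (sz x)" for x
      using B(2) S(3) by (meson add_leD2 order_trans)
    show "K \<ge> 1" using T(2) unfolding implements_def by blast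
  qed (use S in auto)
qed

lemma polytime_size:
  assumes "polytime f"
  obtains B where "poly_bounded B" "mono B" "\<And>x. sz (f x) \<le> B (sz x)"
proof -
  show ?thesis
    by (rule polytimeE[OF assms]) (rule that)
qed

lemma polytimeI:
  assumes "poly_bounded T" "K \<ge> 1" "\<And>W. wf_com K W c"
    and "\<And>s x. s 0 = bits x \<Longrightarrow> (\<And>r. 0 < r \<Longrightarrow> r < K \<Longrightarrow> s r = []) \<Longrightarrow> run c s (T (sz x)) (s(0 := bits (f x)))"
    and "poly_bounded B" "\<And>x. sz (f x) \<le> B (sz x)"
  shows "polytime f"
proof -
  have "implements c K T f"
    unfolding implements_def using assms(2-4) by simp
  then show ?thesis
    unfolding polytime_def using assms(1,5,6) by blast
qed

named_theorems polytime_intros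

text \<open>Changes of type that leave the tree alone are free, for instance between a pair and a
  nonempty list, or between a boolean and a list of units.\<close>

lemma polytime_coerce:
  assumes "\<And>x. enc (f x) = enc x"
  shows "polytime f"
proof (rule polytimeI[where c = Skip and K = 1 and T = "\<lambda>n. n" and B = "\<lambda>n. n"])
  have "bits (f x) = bits x" for x
    by (simp add: bits_def assms)
  then show "s 0 = bits x \<Longrightarrow> run Skip s (sz x) (s(0 := bits (f x)))" for s :: "contents" and x
    by (metis exec_Skip fun_upd_triv run_def)
  show "sz (f x) \<le> sz x" for x
    by (simp add: sz_def bits_def assms)
qed auto

lemma polytime_id [polytime_intros]: "polytime (\<lambda>x. x)"
  by (rule polytime_coerce) simp

lemma polytime_const [polytime_intros]: "polytime (\<lambda>_. c)"
proof (rule polytimeI[where c = "Seq (move 0 {}) (pushes 0 (bits c))" and K = 1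
      and T = "\<lambda>n. 5 * n + 1 + 4 * sz c + 1" and B = "\<lambda>n. sz c"])
  fix s :: "contents" and x :: 'a assume s: "s 0 = bits x"
  have "run (move 0 {}) s (5 * length (s 0) + 1) (s(0 := []))"
    by (rule run_move) (auto simp: fun_eq_iff)
  moreover have "run (pushes 0 (bits c)) (s(0 := [])) (4 * sz c) (s(0 := bits c))"
    unfolding sz_def by (rule run_pushes) (auto simp: fun_eq_iff)
  ultimately show "run (Seq (move 0 {}) (pushes 0 (bits c))) s (5 * sz x + 1 + 4 * sz c + 1) (s(0 := bits c))"
    using run_Seq s by (simp only: sz_def)
qed (auto intro: wf_move wf_pushes)

lemma polytime_comp:
  fixes f :: "'b::encodable \<Rightarrow> 'c::encodable" and g :: "'a::encodable \<Rightarrow> 'b"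
  assumes "polytime f" "polytime g"
  shows "polytime (\<lambda>x. f (g x))"
proof -
  obtain cf Kf Tf where f: "implements cf Kf Tf f" "mono Tf" "poly_bounded Tf" "\<And>x. sz (f x) \<le> Tf (sz x)" "Kf \<ge> 1"
    using polytimeE[OF assms(1)] by blast
  obtain cg Kg Tg where g: "implements cg Kg Tg g" "mono Tg" "poly_bounded Tg" "\<And>x. sz (g x) \<le> Tg (sz x)" "Kg \<ge> 1"
    using polytimeE[OF assms(2)] by blast
  show ?thesis
  proof (rule polytimeI[where c = "Seq cg cf" and K = "max Kf Kg" and T = "\<lambda>n. Tg n + Tf (Tg n) + 1"
        and B = "\<lambda>n. Tf (Tg n)"])
    fix s :: "contents" and x :: 'a
    assume s: "s 0 = bits x" "\<And>r. 0 < r \<Longrightarrow> r < max Kf Kg \<Longrightarrow> s r = []"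
    have "run cg s (Tg (sz x)) (s(0 := bits (g x)))"
      by (rule implementsD(2)[OF g(1)]) (use s in auto)
    moreover have "run cf (s(0 := bits (g x))) (Tf (Tg (sz x))) (s(0 := bits (f (g x))))"
      by (rule implementsD(2)[OF f(1)]) (use s g(4) f(2) in \<open>auto simp: monoD\<close>)
    ultimately show "run (Seq cg cf) s (Tg (sz x) + Tf (Tg (sz x)) + 1) (s(0 := bits (f (g x))))"
      by (rule run_Seq)
  next
    show "sz (f (g x)) \<le> Tf (Tg (sz x))" for x :: 'a
      using f(4)[of "g x"] monoD[OF f(2) g(4)[of x]] by (rule order_trans)
  qed (use f g in \<open>auto intro: implementsD(1) poly_bounded_comp\<close>)
qed

lemma polytime_Pair [polytime_intros]:
  fixes f :: "'a::encodable \<Rightarrow> 'b::encodable" and g :: "'a \<Rightarrow> 'c::encodable"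
  assumes "polytime f" "polytime g"
  shows "polytime (\<lambda>x. (f x, g x))"
proof -
  obtain cf Kf Tf where f: "implements cf Kf Tf f" "mono Tf" "poly_bounded Tf" "\<And>x. sz (f x) \<le> Tf (sz x)" "Kf \<ge> 1"
    using polytimeE[OF assms(1)] by blast
  obtain cg Kg Tg where g: "implements cg Kg Tg g" "mono Tg" "poly_bounded Tg" "\<And>x. sz (g x) \<le> Tg (sz x)" "Kg \<ge> 1"
    using polytimeE[OF assms(2)] by blast
  define K where "K = max Kf Kg"
  have K: "K > 0" "Kf \<le> K" "Kg \<le> K"
    using f(5) by (auto simp: K_def)
  \<comment> \<open>Two reversed copies of the input are parked on \<open>K\<close> and
    \<open>Suc K\<close>, above the scratch space of both programs. \<open>f\<close> consumes the
    first; its reversed result waits on \<open>K\<close> while \<open>g\<close> runs on the second,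
    and finally lands on top of the result of \<open>g\<close>.\<close>
  define c where "c = Seq (move 0 {K, Suc K}) (Seq (move K {0}) (Seq cf (Seq (move 0 {K})
      (Seq (move (Suc K) {0}) (Seq cg (Seq (move K {0}) (push 0 One)))))))"
  show ?thesis
  proof (rule polytimeI[where c = c and K = "K + 2"
        and T = "\<lambda>n. 15 * n + 11 * Tf n + Tg n + 15" and B = "\<lambda>n. Tf n + Tg n + 1"])
    fix s :: "contents" and x :: 'a
    assume s: "s 0 = bits x" "\<And>r. 0 < r \<Longrightarrow> r < K + 2 \<Longrightarrow> s r = []"
    have sK: "s K = []" "s (Suc K) = []"
      using s K by simp_all
    define n u v w where "n = sz x" and "u = bits x" and "v = bits (f x)" and "w = bits (g x)"
    have len: "length u = n" "length v \<le> Tf n"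
      using f(4)[of x] by (simp_all add: n_def u_def v_def sz_def)
    have su: "s 0 = u"
      by (simp add: u_def s)
    have 1: "run (move 0 {K, Suc K}) s (5 * n + 1) (s(0 := [], K := rev u, Suc K := rev u))"
      using K su sK len(1) by (intro run_mono[OF run_move]) (auto simp: fun_eq_iff)
    have 2: "run (move K {0}) (s(0 := [], K := rev u, Suc K := rev u)) (5 * n + 1)
        (s(0 := u, Suc K := rev u))"
      using K su sK len(1) by (intro run_mono[OF run_move]) (auto simp: fun_eq_iff)
    have 3: "run cf (s(0 := u, Suc K := rev u)) (Tf n) (s(0 := v, Suc K := rev u))"
      by (rule implementsD(2)[OF f(1)]) (use s K in \<open>auto simp: n_def u_def v_def w_def\<close>)
    have 4: "run (move 0 {K}) (s(0 := v, Suc K := rev u)) (5 * Tf n + 1)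
        (s(0 := [], K := rev v, Suc K := rev u))"
      using K su sK len(2) by (intro run_mono[OF run_move]) (auto simp: fun_eq_iff)
    have 5: "run (move (Suc K) {0}) (s(0 := [], K := rev v, Suc K := rev u)) (5 * n + 1)
        (s(0 := u, K := rev v))"
      using K su sK len(1) by (intro run_mono[OF run_move]) (auto simp: fun_eq_iff)
    have 6: "run cg (s(0 := u, K := rev v)) (Tg n) (s(0 := w, K := rev v))"
      by (rule implementsD(2)[OF g(1)]) (use s K in \<open>auto simp: n_def u_def v_def w_def\<close>)
    have 7: "run (move K {0}) (s(0 := w, K := rev v)) (5 * Tf n + 1)
        (s(0 := v @ w))"
      using K su sK len(2) by (intro run_mono[OF run_move]) (auto simp: fun_eq_iff)
    have 8: "run (push 0 One) (s(0 := v @ w)) 3 (s(0 := bits (f x, g x)))"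
      by (rule run_push) (auto simp: u_def v_def w_def)
    have "run c s (5 * n + 1 + (5 * n + 1 + (Tf n + (5 * Tf n + 1 + (5 * n + 1 + (Tg n + (5 * Tf n + 1 + 3 + 1) + 1) + 1) + 1) + 1) + 1) + 1)
        (s(0 := bits (f x, g x)))"
      unfolding c_def
      by (rule run_Seq[OF 1 run_Seq[OF 2 run_Seq[OF 3 run_Seq[OF 4 run_Seq[OF 5 run_Seq[OF 6 run_Seq[OF 7 8]]]]]]])
    then show "run c s (15 * sz x + 11 * Tf (sz x) + Tg (sz x) + 15) (s(0 := bits (f x, g x)))"
      unfolding n_def[symmetric] by (rule run_mono) simp
  next
    show "sz (f x, g x) \<le> Tf (sz x) + Tg (sz x) + 1" for x :: 'a
      using f(4)[of x] g(4)[of x] by simp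
    show "wf_com (K + 2) W c" for W
      unfolding c_def using implementsD(1)[OF f(1)] implementsD(1)[OF g(1)] K
      by (simp add: wf_move wf_push)
  qed (use f g in auto)
qed

lemma polytime_fst_base: "polytime fst"
proof (rule polytimeI[where c = "Seq (pop 0) (Seq (split_tree 1) (Seq (move 0 {}) (move 1 {0})))" and K = 3
      and T = "\<lambda>n. 20 * n + 15" and B = "\<lambda>n. n"])
  fix s :: "contents" and p :: "'a \<times> 'b"
  assume s: "s 0 = bits p" "\<And>r. 0 < r \<Longrightarrow> r < 3 \<Longrightarrow> s r = []"
  obtain x y where p: "p = (x, y)" by fastforce
  have s12: "s (Suc 0) = []" "s (Suc (Suc 0)) = []"
    using s(2) by simp_all
  have 1: "run (pop 0) s 1 (s(0 := bits x @ bits y))"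
    by (rule run_pop) (simp add: s p)
  have 2: "run (split_tree 1) (s(0 := bits x @ bits y)) (10 * sz x + 5) (s(0 := bits y, 1 := rev (bits x)))"
    unfolding sz_def bits_def[of x]
    by (rule run_split_tree[where x = "bits y"]) (use s12 in \<open>auto simp: fun_eq_iff\<close>)
  have 3: "run (move 0 {}) (s(0 := bits y, 1 := rev (bits x))) (5 * sz y + 1) (s(0 := [], 1 := rev (bits x)))"
    by (intro run_mono[OF run_move]) (auto simp: fun_eq_iff sz_def)
  have 4: "run (move 1 {0}) (s(0 := [], 1 := rev (bits x))) (5 * sz x + 1) (s(0 := bits x))"
    using s12 by (intro run_mono[OF run_move]) (auto simp: fun_eq_iff sz_def)
  show "run (Seq (pop 0) (Seq (split_tree 1) (Seq (move 0 {}) (move 1 {0})))) s (20 * sz p + 15) (s(0 := bits (fst p)))"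
    using run_mono[OF run_Seq[OF 1 run_Seq[OF 2 run_Seq[OF 3 4]]], of "20 * sz p + 15"] by (simp add: p)
next
  show "sz (fst p) \<le> sz p" for p :: "'a \<times> 'b"
    by (simp add: sz_prod[of p])
qed (auto intro: wf_pop wf_split_tree wf_move)

lemma polytime_snd_base: "polytime snd"
proof (rule polytimeI[where c = "Seq (pop 0) (Seq (split_tree 1) (move 1 {}))" and K = 3
      and T = "\<lambda>n. 20 * n + 15" and B = "\<lambda>n. n"])
  fix s :: "contents" and p :: "'a \<times> 'b"
  assume s: "s 0 = bits p" "\<And>r. 0 < r \<Longrightarrow> r < 3 \<Longrightarrow> s r = []"
  obtain x y where p: "p = (x, y)" by fastforce
  have s12: "s (Suc 0) = []" "s (Suc (Suc 0)) = []"
    using s(2) by simp_all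
  have 1: "run (pop 0) s 1 (s(0 := bits x @ bits y))"
    by (rule run_pop) (simp add: s p)
  have 2: "run (split_tree 1) (s(0 := bits x @ bits y)) (10 * sz x + 5) (s(0 := bits y, 1 := rev (bits x)))"
    unfolding sz_def bits_def[of x]
    by (rule run_split_tree[where x = "bits y"]) (use s12 in \<open>auto simp: fun_eq_iff\<close>)
  have 3: "run (move 1 {}) (s(0 := bits y, 1 := rev (bits x))) (5 * sz x + 1) (s(0 := bits y))"
    using s12 by (intro run_mono[OF run_move]) (auto simp: fun_eq_iff sz_def)
  show "run (Seq (pop 0) (Seq (split_tree 1) (move 1 {}))) s (20 * sz p + 15) (s(0 := bits (snd p)))"
    using run_mono[OF run_Seq[OF 1 run_Seq[OF 2 3]], of "20 * sz p + 15"] by (simp add: p)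
next
  show "sz (snd p) \<le> sz p" for p :: "'a \<times> 'b"
    by (simp add: sz_prod[of p])
qed (auto intro: wf_pop wf_split_tree wf_move)

lemma polytime_fst [polytime_intros]: "polytime f \<Longrightarrow> polytime (\<lambda>x. fst (f x))"
  by (rule polytime_comp[OF polytime_fst_base])

lemma polytime_snd [polytime_intros]: "polytime f \<Longrightarrow> polytime (\<lambda>x. snd (f x))"
  by (rule polytime_comp[OF polytime_snd_base])

lemma polytime_comp2:
  assumes "polytime (\<lambda>p. h (fst p) (snd p))" "polytime f" "polytime g"
  shows "polytime (\<lambda>x. h (f x) (g x))"
  using polytime_comp[OF assms(1) polytime_Pair[OF assms(2,3)]] by simp

text \<open>The word for \<open>((a, as), x)\<close> is literally the word for
  \<open>(a # as, x)\<close>. After a look at the letter behind the tag of the pair, the nonempty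
  case only has to put the tag back.\<close>

lemma polytime_case_list:
  fixes f :: "'a::encodable \<Rightarrow> 'b::encodable" and l :: "'a \<Rightarrow> 'c::encodable list"
  assumes "polytime f" "polytime g" "polytime l"
  shows "polytime (\<lambda>x. case l x of [] \<Rightarrow> f x | a # as \<Rightarrow> g ((a, as), x))"
proof -
  have "polytime (\<lambda>x. (l x, x))"
    using assms(3) polytime_id by (rule polytime_Pair)
  then obtain cp Kp Tp where p: "implements cp Kp Tp (\<lambda>x. (l x, x))" "mono Tp" "poly_bounded Tp" "\<And>x. sz (l x, x) \<le> Tp (sz x)" "Kp \<ge> 1"
    using polytimeE by blast
  obtain cf Kf Tf where f: "implements cf Kf Tf f" "mono Tf" "poly_bounded Tf" "\<And>x. sz (f x) \<le> Tf (sz x)" "Kf \<ge> 1"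
    using polytimeE[OF assms(1)] by blast
  obtain cg Kg Tg where g: "implements cg Kg Tg g" "mono Tg" "poly_bounded Tg" "\<And>x. sz (g x) \<le> Tg (sz x)" "Kg \<ge> 1"
    using polytimeE[OF assms(2)] by blast
  define K where "K = max Kp (max Kf Kg)"
  have K: "K > 0" "Kf \<le> K" "Kg \<le> K" "Kp \<le> K"
    using f(5) by (auto simp: K_def)
  define c where "c = Seq cp (Seq (pop 0) (Cond (top_is 0 Zero) (Seq (pop 0) cf) (Seq (push 0 One) cg)))"
  let ?h = "\<lambda>x. case l x of [] \<Rightarrow> f x | a # as \<Rightarrow> g ((a, as), x)"
  show ?thesis
  proof (rule polytimeI[where c = c and K = K
        and T = "\<lambda>n. Tp n + Tf n + Tg (Tp n) + 10" and B = "\<lambda>n. Tf n + Tg (Tp n)"])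
    fix s :: "contents" and x :: 'a
    assume s: "s 0 = bits x" "\<And>r. 0 < r \<Longrightarrow> r < K \<Longrightarrow> s r = []"
    let ?s1 = "s(0 := bits (l x) @ bits x)" and ?s2 = "s(0 := bits (?h x))"
      and ?t = "Tf (sz x) + Tg (Tp (sz x)) + 4"
    have 1: "run cp s (Tp (sz x)) (s(0 := bits (l x, x)))"
      by (rule implementsD(2)[OF p(1)]) (use s K in auto)
    have 2: "run (pop 0) (s(0 := bits (l x, x))) 1 ?s1"
      by (rule run_pop) simp
    have 3: "run (Cond (top_is 0 Zero) (Seq (pop 0) cf) (Seq (push 0 One) cg))
        ?s1 (?t + 1) ?s2"
    proof (rule run_Cond, cases "l x")
      case Nil
      have "run (pop 0) ?s1 1 (s(0 := bits x))"
        by (rule run_pop) (simp add: Nil)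
      moreover have "run cf (s(0 := bits x)) (Tf (sz x)) ?s2"
        by (rule implementsD(2)[OF f(1)]) (use s K Nil in auto)
      ultimately have "run (Seq (pop 0) cf) ?s1 ?t ?s2"
        by (rule run_mono[OF run_Seq]) simp
      then show "if top_is 0 Zero (heads (stacks ?s1)) then run (Seq (pop 0) cf) ?s1 ?t ?s2
        else run (Seq (push 0 One) cg) ?s1 ?t ?s2"
        using Nil by simp
    next
      case (Cons a as)
      have e: "bits ((a, as), x) = One # bits (l x) @ bits x"
        by (simp add: Cons)
      have "run (push 0 One) ?s1 3 (s(0 := bits ((a, as), x)))"
        by (rule run_push) (simp only: e fun_upd_same fun_upd_upd)
      moreover have "sz ((a, as), x) = sz (l x, x)"
        by (simp add: Cons)
      then have "Tg (sz ((a, as), x)) \<le> Tg (Tp (sz x))"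
        using monoD[OF g(2) p(4)[of x]] by (simp only:)
      then have "run cg (s(0 := bits ((a, as), x))) (Tg (Tp (sz x))) ?s2"
        by (intro implementsD(2)[OF g(1)]) (use s K Cons in auto)
      ultimately have "run (Seq (push 0 One) cg) ?s1 ?t ?s2"
        by (rule run_mono[OF run_Seq]) simp
      then show "if top_is 0 Zero (heads (stacks ?s1)) then run (Seq (pop 0) cf) ?s1 ?t ?s2
        else run (Seq (push 0 One) cg) ?s1 ?t ?s2"
        using Cons by simp
    qed
    show "run c s (Tp (sz x) + Tf (sz x) + Tg (Tp (sz x)) + 10) ?s2"
      unfolding c_def by (rule run_mono[OF run_Seq[OF 1 run_Seq[OF 2 3]]]) simp
  next
    fix x :: 'a
    show "sz (?h x) \<le> Tf (sz x) + Tg (Tp (sz x))"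
    proof (cases "l x")
      case Nil
      then show ?thesis using f(4)[of x] by simp
    next
      case (Cons a as)
      have "sz ((a, as), x) = sz (l x, x)"
        by (simp add: Cons)
      then have "sz (g ((a, as), x)) \<le> Tg (Tp (sz x))"
        using g(4)[of "((a, as), x)"] monoD[OF g(2) p(4)[of x]] by (simp only:)
      then show ?thesis by (simp add: Cons)
    qed
  next
    show "wf_com K W c" for W
      unfolding c_def
      using implementsD(1)[OF f(1)] implementsD(1)[OF g(1)] implementsD(1)[OF p(1)] K
      by (simp add: wf_pop wf_push)
  qed (use f g p K in \<open>auto intro: poly_bounded_comp\<close>)
qed

text \<open>The counter is unary: the encoding of \<open>n x\<close> is parked on stack
  \<open>K\<close> and loses one letter per iteration. The bound \<open>B\<close> on all
  intermediate values matters because a polynomial size bound for \<open>F\<close>, iterated, would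
  permit exponential growth.\<close>

lemma polytime_funpow:
  fixes F :: "'b::encodable \<Rightarrow> 'b" and n :: "'a::encodable \<Rightarrow> 'c::encodable" and y :: "'a \<Rightarrow> 'b"
  assumes F: "polytime F" and n: "polytime n" and y: "polytime y"
    and B: "poly_bounded B" "\<And>x i. i \<le> sz (n x) \<Longrightarrow> sz ((F ^^ i) (y x)) \<le> B (sz x)"
  shows "polytime (\<lambda>x. (F ^^ sz (n x)) (y x))"
proof -
  have "polytime (\<lambda>x. (n x, y x))"
    using n y by (rule polytime_Pair)
  then obtain cp Kp Tp where p: "implements cp Kp Tp (\<lambda>x. (n x, y x))" "mono Tp" "poly_bounded Tp" "\<And>x. sz (n x, y x) \<le> Tp (sz x)" "Kp \<ge> 1"
    using polytimeE by blast
  obtain cf Kf Tf where f: "implements cf Kf Tf F" "mono Tf" "poly_bounded Tf" "\<And>x. sz (F x) \<le> Tf (sz x)" "Kf \<ge> 1"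
    using polytimeE[OF F] by blast
  define K where "K = max Kp Kf"
  have K: "K > 0" "Kf \<le> K" "Kp \<le> K"
    using f(5) by (auto simp: K_def)
  define loop where "loop = While (nonempty K) (Seq (pop K) cf)"
  define c where "c = Seq cp (Seq (pop 0) (Seq (split_tree K) loop))"
  have run_loop: "run loop (s(0 := bits z, K := w)) (length w * (T + 4) + 1) (s(0 := bits ((F ^^ length w) z), K := []))"
    if "\<And>r. 0 < r \<Longrightarrow> r < K \<Longrightarrow> s r = []" "\<And>i. i < length w \<Longrightarrow> Tf (sz ((F ^^ i) z)) \<le> T"
    for s :: "contents" and z w T
    using that(2)
  proof (induction w arbitrary: z)
    case Nil
    have "run loop (s(0 := bits z, K := [])) (0 + 1) (s(0 := bits z, K := []))"
      unfolding loop_def by (rule run_While_False) simp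
    then show ?case
      unfolding list.size funpow.simps id_apply by (rule run_mono) simp
  next
    case (Cons a w)
    have 1: "run (pop K) (s(0 := bits z, K := a # w)) 1 (s(0 := bits z, K := w))"
      by (rule run_pop) simp
    have 2: "run cf (s(0 := bits z, K := w)) T (s(0 := bits (F z), K := w))"
      using Cons.prems[of 0] by (intro implementsD(2)[OF f(1)]) (use that(1) K in \<open>auto simp: fun_eq_iff\<close>)
    have "Tf (sz ((F ^^ i) (F z))) \<le> T" if "i < length w" for i
      using Cons.prems[of "Suc i"] that by (simp add: funpow_swap1)
    then have 3: "run loop (s(0 := bits (F z), K := w)) (length w * (T + 4) + 1) (s(0 := bits ((F ^^ length w) (F z)), K := []))"
      by (rule Cons.IH)
    have ne: "nonempty K (heads (stacks (s(0 := bits z, K := a # w))))"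
      by simp
    have "run loop (s(0 := bits z, K := a # w)) (1 + T + 1 + (length w * (T + 4) + 1) + 2) (s(0 := bits ((F ^^ length w) (F z)), K := []))"
      unfolding loop_def by (rule run_While_True[OF ne run_Seq[OF 1 2] 3[unfolded loop_def]])
    then show ?case
      unfolding list.size funpow_Suc_right comp_apply add_0_right add_Suc_right
      by (rule run_mono) (simp add: algebra_simps)
  qed
  obtain B' where B': "poly_bounded B'" "mono B'" "\<And>n. B n \<le> B' n"
    using poly_bounded_obtain_mono[OF B(1)] by blast
  show ?thesis
  proof (rule polytimeI[where c = c and K = "K + 2"
        and T = "\<lambda>n. Tp n + 10 * Tp n + Tp n * (Tf (B' n) + 4) + 20" and B = B])
    fix s :: "contents" and x :: 'a
    assume s: "s 0 = bits x" "\<And>r. 0 < r \<Longrightarrow> r < K + 2 \<Longrightarrow> s r = []"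
    have sK: "s K = []" "s (Suc K) = []"
      using s K by simp_all
    have nT: "sz (n x) \<le> Tp (sz x)"
      using p(4)[of x] by simp
    have 1: "run cp s (Tp (sz x)) (s(0 := bits (n x, y x)))"
      by (rule implementsD(2)[OF p(1)]) (use s K in auto)
    have 2: "run (pop 0) (s(0 := bits (n x, y x))) 1 (s(0 := bits (n x) @ bits (y x)))"
      by (rule run_pop) simp
    have 3: "run (split_tree K) (s(0 := bits (n x) @ bits (y x))) (10 * sz (n x) + 5) (s(0 := bits (y x), K := rev (bits (n x))))"
      unfolding sz_def bits_def[of "n x"]
      by (rule run_split_tree[where x = "bits (y x)"]) (use K sK in \<open>auto simp: fun_eq_iff\<close>)
    have "Tf (sz ((F ^^ i) (y x))) \<le> Tf (B' (sz x))" if "i < length (rev (bits (n x)))" for i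
      using B(2)[of i x] B'(3)[of "sz x"] that
      by (intro monoD[OF f(2)]) (simp add: sz_def)
    then have 4: "run loop (s(0 := bits (y x), K := rev (bits (n x)))) (length (rev (bits (n x))) * (Tf (B' (sz x)) + 4) + 1)
        (s(0 := bits ((F ^^ length (rev (bits (n x)))) (y x)), K := []))"
      using s(2) by (intro run_loop) simp_all
    have l: "length (rev (bits (n x))) = sz (n x)"
      by (simp add: sz_def)
    have e: "s(0 := bits ((F ^^ sz (n x)) (y x)), K := []) = s(0 := bits ((F ^^ sz (n x)) (y x)))"
      using sK K by (auto simp: fun_eq_iff)
    have "sz (n x) * (Tf (B' (sz x)) + 4) \<le> Tp (sz x) * (Tf (B' (sz x)) + 4)"
      using nT by (rule mult_right_mono) simp
    then show "run c s (Tp (sz x) + 10 * Tp (sz x) + Tp (sz x) * (Tf (B' (sz x)) + 4) + 20) (s(0 := bits ((F ^^ sz (n x)) (y x))))"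
      unfolding c_def
      using nT by (intro run_mono[OF run_Seq[OF 1 run_Seq[OF 2 run_Seq[OF 3 4[unfolded l e]]]]]) linarith
  next
    show "sz ((F ^^ sz (n x)) (y x)) \<le> B (sz x)" for x :: 'a
      by (rule B(2)) simp
    show "wf_com (K + 2) W c" for W
      unfolding c_def loop_def
      using implementsD(1)[OF f(1)] implementsD(1)[OF p(1)] K
      by (simp add: wf_pop wf_split_tree)
  qed (use f p B B' in \<open>auto intro!: poly_bounded_comp[of Tf]\<close>)
qed

section \<open>Reductions\<close>

primrec dispatch :: "nat \<Rightarrow> (letter \<Rightarrow> letter com) \<Rightarrow> word \<Rightarrow> letter com" where
  "dispatch r F [] = Skip"
| "dispatch r F (a # as) = Cond (top_is r a) (F a) (dispatch r F as)"

lemma wf_dispatch: "(\<And>a. wf_com K W (F a)) \<Longrightarrow> wf_com K W (dispatch r F as)"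
  by (induction as) auto

lemma run_dispatch:
  assumes "s r = a # w" "run (F a) s t s'"
  shows "a \<in> set as \<Longrightarrow> run (dispatch r F as) s (t + length as) s'"
proof (induction as)
  case (Cons b as)
  have "run (Cond (top_is r b) (F b) (dispatch r F as)) s (t + length as + 1) s'"
  proof (rule run_Cond)
    show "if top_is r b (heads (stacks s)) then run (F b) s (t + length as) s'
        else run (dispatch r F as) s (t + length as) s'"
      using Cons assms by (auto intro: run_mono)
  qed
  then show ?case by simp
qed simp

abbreviation load_loop :: "letter com" where
  "load_loop \<equiv> While (nonempty 1) (Seq (dispatch 1 (\<lambda>a. pushes 0 (One # bits a)) letters) (pop 1))"

text \<open>The input tape holds a raw word, whereas the programs above expect the tree encoding of
  a list of letters. The word is reversed first because the list is built from its end.\<close>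

definition load_word :: "letter com" where
  "load_word = Seq (move 0 {1}) (Seq (push 0 Zero)
     load_loop)"

lemma letters_complete [simp]: "a \<in> set letters"
  by (cases a) (simp_all add: letters_def)

lemma run_load_loop:
  "run load_loop
     (s(0 := bits v, 1 := w)) (70 * length w + 1) (s(0 := bits (rev w @ v), 1 := []))"
proof (induction w arbitrary: v)
  case Nil
  have "run load_loop
     (s(0 := bits v, 1 := [])) (0 + 1) (s(0 := bits v, 1 := []))"
    by (rule run_While_False) simp
  then show ?case
    unfolding list.size rev.simps append.simps by (rule run_mono) simp
next
  case (Cons a w)
  have "run (pushes 0 (One # bits a)) (s(0 := bits v, 1 := a # w)) (4 * length (One # bits a)) (s(0 := bits (a # v), 1 := a # w))"
    by (rule run_pushes) (auto simp: fun_eq_iff)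
  then have "run (dispatch 1 (\<lambda>a. pushes 0 (One # bits a)) letters) (s(0 := bits v, 1 := a # w))
      (4 * length (One # bits a) + length letters) (s(0 := bits (a # v), 1 := a # w))"
    by (intro run_dispatch) simp_all
  \<comment> \<open>At most 12 letters to push, with 4 steps each, and 6 tests to find out
    which.\<close>
  moreover have "4 * length (One # bits a) + length letters \<le> 60"
    using sz_letter[of a] by (simp add: sz_def letters_def)
  ultimately have 1: "run (dispatch 1 (\<lambda>a. pushes 0 (One # bits a)) letters) (s(0 := bits v, 1 := a # w))
      60 (s(0 := bits (a # v), 1 := a # w))"
    by (rule run_mono)
  have 2: "run (pop 1) (s(0 := bits (a # v), 1 := a # w)) 1 (s(0 := bits (a # v), 1 := w))"
    by (rule run_pop) simp
  have ne: "nonempty 1 (heads (stacks (s(0 := bits v, 1 := a # w))))"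
    by simp
  have "run load_loop
     (s(0 := bits v, 1 := a # w)) (60 + 1 + 1 + (70 * length w + 1) + 2) (s(0 := bits (rev w @ a # v), 1 := []))"
    by (rule run_While_True[OF ne run_Seq[OF 1 2] Cons.IH])
  then have "run load_loop
     (s(0 := bits v, 1 := a # w)) (70 * length (a # w) + 1) (s(0 := bits (rev w @ a # v), 1 := []))"
    by (rule run_mono) simp
  then show ?case
    unfolding rev.simps append_assoc append.simps .
qed

lemma run_load_word:
  assumes "s 0 = w" "s 1 = []" "s' = s(0 := bits w)"
  shows "run load_word s (75 * length w + 8) s'"
proof -
  have 1: "run (move 0 {1}) s (5 * length w + 1) (s(0 := [], 1 := rev w))"
    using assms by (intro run_mono[OF run_move]) (auto simp: fun_eq_iff)
  have 2: "run (push 0 Zero) (s(0 := [], 1 := rev w)) 3 (s(0 := bits ([] :: word), 1 := rev w))"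
    by (rule run_push) (auto simp: fun_eq_iff)
  have "s(0 := bits (rev (rev w) @ []), 1 := []) = s'"
    using assms by (auto simp: fun_eq_iff)
  note 3 = run_load_loop[of s "[]" "rev w", unfolded this]
  show ?thesis
    unfolding load_word_def by (rule run_mono[OF run_Seq[OF 1 run_Seq[OF 2 3]]]) simp
qed

text \<open>A letter is the list \<open>replicate k ()\<close> of its index \<open>k\<close>,
  written as \<open>k\<close> times \<open>One\<close>, \<open>Zero\<close> and a closing
  \<open>Zero\<close>; each level strips one unit.\<close>

primrec decode_letter :: "word \<Rightarrow> letter com" where
  "decode_letter [] = Skip"
| "decode_letter (a # as) = Cond (top_is 0 Zero) (Seq (pop 0) (push 1 a))
     (Seq (pop 0) (Seq (pop 0) (decode_letter as)))"

abbreviation unload_loop :: "letter com" where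
  "unload_loop \<equiv> While (top_is 0 One) (Seq (pop 0) (decode_letter letters))"

definition unload_word :: "letter com" where
  "unload_word = Seq unload_loop (Seq (pop 0) (move 1 {0}))"

lemma bits_unit [simp]: "bits () = [Zero]"
  by (simp add: bits_def enc_unit_def)

lemma bits_letter: "bits (a :: letter) = bits (replicate (letter_index a) ())"
  by (simp add: bits_def enc_letter_def)

lemma run_decode_letter:
  "k < length as \<Longrightarrow> s 0 = bits (replicate k ()) @ y \<Longrightarrow> s' = s(0 := y, 1 := as ! k # s 1) \<Longrightarrow>
     run (decode_letter as) s (8 * (k + 1)) s'"
proof (induction as arbitrary: k s)
  case (Cons a as)
  show ?case
  proof (cases k)
    case 0
    have 1: "run (pop 0) s 1 (s(0 := y))"
      using Cons.prems(2) 0 by (intro run_pop) simp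
    have 2: "run (push 1 a) (s(0 := y)) 3 s'"
      using Cons.prems(3) 0 by (intro run_push) (simp add: fun_eq_iff)
    have 3: "run (Seq (pop 0) (push 1 a)) s 7 s'"
      by (rule run_mono[OF run_Seq[OF 1 2]]) simp
    have "run (decode_letter (a # as)) s (7 + 1) s'"
      unfolding decode_letter.simps
    proof (rule run_Cond)
      show "if top_is 0 Zero (heads (stacks s)) then run (Seq (pop 0) (push 1 a)) s 7 s'
          else run (Seq (pop 0) (Seq (pop 0) (decode_letter as))) s 7 s'"
        using 3 0 Cons.prems(2) by simp
    qed
    then show ?thesis using 0 by simp
  next
    case (Suc j)
    let ?s1 = "s(0 := Zero # bits (replicate j ()) @ y)" and ?s2 = "s(0 := bits (replicate j ()) @ y)"
    have 1: "run (pop 0) s 1 ?s1" and 2: "run (pop 0) ?s1 1 ?s2"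
      using Cons.prems(2) Suc by (intro run_pop; simp)+
    have 3: "run (decode_letter as) ?s2 (8 * (j + 1)) s'"
      using Cons.prems Suc by (intro Cons.IH) auto
    have 4: "run (Seq (pop 0) (Seq (pop 0) (decode_letter as))) s (8 * (j + 1) + 4) s'"
      by (rule run_mono[OF run_Seq[OF 1 run_Seq[OF 2 3]]]) simp
    have "run (decode_letter (a # as)) s (8 * (j + 1) + 4 + 1) s'"
      unfolding decode_letter.simps
    proof (rule run_Cond)
      show "if top_is 0 Zero (heads (stacks s)) then run (Seq (pop 0) (push 1 a)) s (8 * (j + 1) + 4) s'
          else run (Seq (pop 0) (Seq (pop 0) (decode_letter as))) s (8 * (j + 1) + 4) s'"
        using 4 Suc Cons.prems(2) by simp
    qed
    then show ?thesis using Suc by (auto elim: run_mono)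
  qed
qed simp

lemma run_unload_loop:
  "run unload_loop (s(0 := bits v, 1 := w)) (60 * length v + 1)
     (s(0 := [Zero], 1 := rev v @ w))"
proof (induction v arbitrary: w)
  case Nil
  have "run unload_loop (s(0 := [Zero], 1 := w)) (0 + 1) (s(0 := [Zero], 1 := w))"
    by (rule run_While_False) simp
  then show ?case
    unfolding list.size rev.simps append.simps bits_Nil by (rule run_mono) simp
next
  case (Cons a v)
  have 1: "run (pop 0) (s(0 := bits (a # v), 1 := w)) 1 (s(0 := bits a @ bits v, 1 := w))"
    by (rule run_pop) (auto simp: fun_eq_iff)
  have "run (decode_letter letters) (s(0 := bits a @ bits v, 1 := w)) (8 * (letter_index a + 1)) (s(0 := bits v, 1 := a # w))"
    using letters_nth[of a] by (intro run_decode_letter[where y = "bits v"]) (auto simp: fun_eq_iff bits_letter)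
  moreover have "letter_index a \<le> 5"
    by (cases a) simp_all
  ultimately have 2: "run (decode_letter letters) (s(0 := bits a @ bits v, 1 := w)) 48 (s(0 := bits v, 1 := a # w))"
    by (elim run_mono) simp
  have ne: "top_is 0 One (heads (stacks (s(0 := bits (a # v), 1 := w))))"
    by simp
  have "run unload_loop (s(0 := bits (a # v), 1 := w))
      (1 + 48 + 1 + (60 * length v + 1) + 2) (s(0 := [Zero], 1 := rev v @ a # w))"
    by (rule run_While_True[OF ne run_Seq[OF 1 2] Cons.IH])
  then have "run unload_loop (s(0 := bits (a # v), 1 := w))
      (60 * length (a # v) + 1) (s(0 := [Zero], 1 := rev v @ a # w))"
    by (rule run_mono) simp
  then show ?case
    unfolding rev.simps append_assoc append.simps .
qed

lemma run_unload_word: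
  assumes "s 0 = bits v" "s 1 = []" "s' = s(0 := v)"
  shows "run unload_word s (65 * length v + 10) s'"
proof -
  have "s(0 := bits v, 1 := []) = s"
    using assms by (auto simp: fun_eq_iff)
  note 1 = run_unload_loop[of s v "[]", unfolded this]
  have 2: "run (pop 0) (s(0 := [Zero], 1 := rev v @ [])) 1 (s(0 := [], 1 := rev v))"
    by (rule run_pop) (auto simp: fun_eq_iff)
  have 3: "run (move 1 {0}) (s(0 := [], 1 := rev v)) (5 * length v + 1) s'"
    using assms by (intro run_mono[OF run_move]) (auto simp: fun_eq_iff)
  show ?thesis
    unfolding unload_word_def by (rule run_mono[OF run_Seq[OF 1 run_Seq[OF 2 3]]]) simp
qed

lemma wf_decode_letter: "K \<ge> 2 \<Longrightarrow> wf_com K W (decode_letter as)"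
  by (induction as) (auto simp: wf_pop wf_push)

lemma sz_word_le: "sz (w :: word) \<le> 12 * length w + 1"
proof (induction w)
  case (Cons a w)
  then show ?case using sz_letter[of a] by simp
qed simp

text \<open>After \<open>unload_word\<close>, stack 0 holds the raw word \<open>f w\<close> and all
  others are empty, just as at the start of the machine for \<open>L'\<close>. The final state of
  that machine is left as a work symbol on the extra tape of \<open>call\<close>, where the verdict
  is read off.\<close>

theorem decidable_by_reduction:
  fixes f :: "word \<Rightarrow> word"
  assumes f: "polytime f" and L': "decidable_in_ptime L'" and L: "\<And>w. w \<in> L \<longleftrightarrow> f w \<in> L'"
  shows "decidable_in_ptime L"
proof -
  obtain M and q :: "nat poly" where M: "turing_machine M" "decides_in_time M L' (poly q)"
    using L' unfolding decidable_in_ptime_def by blast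
  obtain cf Kf Tf where cf: "implements cf Kf Tf f" "mono Tf" "poly_bounded Tf" "\<And>x. sz (f x) \<le> Tf (sz x)" "Kf \<ge> 1"
    using polytimeE[OF f] by blast
  define K where "K = max (max 2 Kf) (Suc (tape_count M))"
  define W where "W = max (work_count M) (state_count M)"
  define c where "c = Seq load_word (Seq cf (Seq unload_word (call M)))"
  define T where "T n = 75 * n + 8 + Tf (12 * n + 1) + 65 * Tf (12 * n + 1) + 10 + 3 * poly q (Tf (12 * n + 1)) + 6" for n
  have "poly_bounded (poly q)"
    unfolding poly_bounded_def by blast
  then have "poly_bounded T"
    unfolding T_def using cf(3)
    by (auto intro!: poly_bounded_comp[of Tf] poly_bounded_comp[of "poly q"])
  then obtain p where p: "\<And>n. T n \<le> poly p n"
    unfolding poly_bounded_def by blast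
  have "wf_com K W c"
    unfolding c_def
    using implementsD(1)[OF cf(1), of K] wf_com_mono[OF wf_call[OF M(1)], of W K]
    by (auto simp: K_def W_def load_word_def unload_word_def intro!: wf_move wf_push wf_dispatch wf_pushes wf_pop wf_decode_letter)
  moreover have "K \<ge> 1"
    by (simp add: K_def)
  moreover have "\<exists>\<sigma>. exec c ((\<lambda>_. word_content [])(0 := word_content w)) (poly p (length w)) \<sigma> \<and>
      (heads \<sigma> (tape_count M) = Work 1 \<longleftrightarrow> w \<in> L)" for w
  proof -
    define s0 where "s0 = (\<lambda>_ :: nat. [] :: word)"
    have st: "(\<lambda>_. word_content [])(0 := word_content v) = stacks (s0(0 := v))" for v
      by (auto simp: fun_eq_iff stacks_def s0_def)
    define u where "u = Tf (12 * length w + 1)"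
    have szw: "Tf (sz w) \<le> u"
      unfolding u_def by (rule monoD[OF cf(2) sz_word_le])
    have lf: "length (f w) \<le> u"
      using length_le_sz[of "f w"] cf(4)[of w] szw by simp
    have 1: "run load_word (s0(0 := w)) (75 * length w + 8) (s0(0 := bits w))"
      by (rule run_load_word) (simp_all add: s0_def)
    have 2: "run cf (s0(0 := bits w)) u (s0(0 := bits (f w)))"
      by (rule implementsD(2)[OF cf(1)]) (use szw in \<open>simp_all add: s0_def\<close>)
    have 3: "run unload_word (s0(0 := bits (f w))) (65 * u + 10) (s0(0 := f w))"
      by (rule run_mono[OF run_unload_word]) (use lf in \<open>simp_all add: s0_def\<close>)
    define t where "t = poly q (length (f w))"
    have t: "t \<le> poly q u"
      unfolding t_def using lf by (rule poly_nat_mono)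
    have h: "halted (config_after M t (f w))" "accepting (config_after M t (f w)) \<longleftrightarrow> f w \<in> L'"
      using M(2) unfolding decides_in_time_def t_def by auto
    obtain \<sigma> where \<sigma>: "exec (call M) (stacks (s0(0 := f w))) (3 * t + 3) \<sigma>"
      "\<sigma> (tape_count M) 0 = Work (fst (config_after M t (f w)))"
      using exec_call[OF M(1) h(1)] unfolding st by blast
    have "exec c (stacks (s0(0 := w))) (75 * length w + 8 + (u + (65 * u + 10 + (3 * t + 3) + 1) + 1) + 1) \<sigma>"
      unfolding c_def
      by (rule exec_Seq[OF 1[unfolded run_def] exec_Seq[OF 2[unfolded run_def] exec_Seq[OF 3[unfolded run_def] \<sigma>(1)]]])
    moreover have "75 * length w + 8 + (u + (65 * u + 10 + (3 * t + 3) + 1) + 1) + 1 \<le> poly p (length w)"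
      using p[of "length w"] t unfolding T_def u_def[symmetric] by simp
    ultimately have "exec c (stacks (s0(0 := w))) (poly p (length w)) \<sigma>"
      by (rule exec_mono)
    moreover have "heads \<sigma> (tape_count M) = Work 1 \<longleftrightarrow> w \<in> L"
      using \<sigma>(2) h(2) L[of w] by (simp add: heads_def accepting_def)
    ultimately show ?thesis
      unfolding st by blast
  qed
  ultimately show ?thesis
    by (rule decidable_by_program[where acc = "\<lambda>h. h (tape_count M) = Work 1"])
qed

section \<open>Polynomial-time list functions\<close>

lemma polytime_Cons [polytime_intros]:
  fixes f :: "'a::encodable \<Rightarrow> 'b::encodable"
  assumes "polytime f" "polytime g"
  shows "polytime (\<lambda>x. f x # g x)"
proof -
  have "polytime (\<lambda>p. fst p # (snd p :: 'b list))"
    by (rule polytime_coerce) (simp add: enc_prod_def)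
  from polytime_comp2[OF this assms] show ?thesis .
qed

lemma polytime_list_case [polytime_intros]:
  assumes "polytime l" "polytime f" "polytime (\<lambda>p. g (fst p) (fst (snd p)) (snd (snd p)))"
  shows "polytime (\<lambda>x. case l x of [] \<Rightarrow> f x | a # as \<Rightarrow> g x a as)"
proof -
  have "polytime (\<lambda>p. (snd p, fst p))"
    by (intro polytime_intros)
  from polytime_comp[OF assms(3) this]
  have "polytime (\<lambda>p. g (snd p) (fst (fst p)) (snd (fst p)))"
    by simp
  from polytime_case_list[OF assms(2) this assms(1)] show ?thesis
    unfolding fst_conv snd_conv .
qed

lemma polytime_If [polytime_intros]:
  assumes "polytime b" "polytime f" "polytime g"
  shows "polytime (\<lambda>x. if b x then f x else g x)"
proof -
  have "polytime (\<lambda>b. if b then [()] else [])"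
    by (rule polytime_coerce) (simp only: enc_bool_def)
  note polytime_comp[OF this assms(1)]
  moreover have "polytime (\<lambda>p. f (fst p))"
    by (rule polytime_comp[OF assms(2)]) (intro polytime_intros)
  ultimately have "polytime (\<lambda>x. case if b x then [()] else [] of [] \<Rightarrow> g x | a # as \<Rightarrow> f x)"
    using assms(3) by (intro polytime_list_case)
  moreover have "(case if b x then [()] else [] of [] \<Rightarrow> g x | a # as \<Rightarrow> f x) = (if b x then f x else g x)" for x
    by simp
  ultimately show ?thesis by simp
qed

lemma polytime_Some [polytime_intros]:
  fixes f :: "'a::encodable \<Rightarrow> 'b::encodable"
  assumes "polytime f"
  shows "polytime (\<lambda>x. Some (f x))"
proof -
  have "polytime (\<lambda>p :: 'b \<times> unit. Some (fst p))"
    by (rule polytime_coerce) (simp add: enc_option_def enc_prod_def enc_unit_def)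
  from polytime_comp[OF this polytime_Pair[OF assms polytime_const[of "()"]]] show ?thesis by simp
qed

lemma polytime_case_option [polytime_intros]:
  assumes "polytime l" "polytime f" "polytime (\<lambda>p. g (fst p) (snd p))"
  shows "polytime (\<lambda>x. case l x of None \<Rightarrow> f x | Some a \<Rightarrow> g x a)"
proof -
  have "polytime (\<lambda>o'. case o' of None \<Rightarrow> [] | Some a \<Rightarrow> [a])"
    by (rule polytime_coerce) (simp only: enc_option_def)
  note polytime_comp[OF this assms(1)]
  moreover have "polytime (\<lambda>p. g (fst p) (fst (snd p)))"
    by (rule polytime_comp2[OF assms(3)]) (intro polytime_intros)+
  ultimately have "polytime (\<lambda>x. case (case l x of None \<Rightarrow> [] | Some a \<Rightarrow> [a]) of [] \<Rightarrow> f x | a # as \<Rightarrow> g x a)"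
    using assms(2) by (intro polytime_list_case)
  moreover have "(case (case l x of None \<Rightarrow> [] | Some a \<Rightarrow> [a]) of [] \<Rightarrow> f x | a # as \<Rightarrow> g x a)
      = (case l x of None \<Rightarrow> f x | Some a \<Rightarrow> g x a)" for x
    by (simp split: option.split)
  ultimately show ?thesis by simp
qed

lemma polytime_case_prod [polytime_intros]:
  assumes "polytime (\<lambda>x. g x (fst (f x)) (snd (f x)))"
  shows "polytime (\<lambda>x. case f x of (a, b) \<Rightarrow> g x a b)"
  using assms by (simp add: case_prod_unfold)

lemma polytime_conj [polytime_intros]: "polytime f \<Longrightarrow> polytime g \<Longrightarrow> polytime (\<lambda>x. f x \<and> g x)"
proof -
  assume fg: "polytime f" "polytime g"
  have "polytime (\<lambda>x. if f x then g x else False)"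
    by (intro polytime_If fg polytime_const)
  moreover have "(\<lambda>x. if f x then g x else False) = (\<lambda>x. f x \<and> g x)"
    by auto
  ultimately show ?thesis by (simp only:)
qed

lemma polytime_not [polytime_intros]: "polytime f \<Longrightarrow> polytime (\<lambda>x. \<not> f x)"
proof -
  assume f: "polytime f"
  have "polytime (\<lambda>x. if f x then False else True)"
    by (intro polytime_If f polytime_const)
  moreover have "(\<lambda>x. if f x then False else True) = (\<lambda>x. \<not> f x)"
    by auto
  ultimately show ?thesis by (simp only:)
qed

lemma polytime_disj [polytime_intros]: "polytime f \<Longrightarrow> polytime g \<Longrightarrow> polytime (\<lambda>x. f x \<or> g x)"
  using polytime_not[OF polytime_conj[OF polytime_not[of f] polytime_not[of g]]] by simp

text \<open>Reduction to \<open>polytime_funpow\<close>. The size bound ranges over prefixes of the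
  list because these give the intermediate accumulators.\<close>

lemma polytime_fold:
  fixes xs :: "'a::encodable \<Rightarrow> 'b::encodable list" and b :: "'a \<Rightarrow> 'c::encodable"
  assumes f: "polytime (\<lambda>p. f (fst p) (fst (snd p)) (snd (snd p)))" and xs: "polytime xs" and b: "polytime b"
    and B: "poly_bounded B" "\<And>x ys zs. xs x = ys @ zs \<Longrightarrow> sz (fold (f x) ys (b x)) \<le> B (sz x)"
  shows "polytime (\<lambda>x. fold (f x) (xs x) (b x))"
proof -
  \<comment> \<open>The state consists of the remaining list, the accumulator and the parameter. On
    an empty list \<open>F\<close> is the identity, so iterating it \<open>sz (xs x)\<close> times,
    at least once per element, gives the fold.\<close>
  define F :: "('b list \<times> 'c) \<times> 'a \<Rightarrow> ('b list \<times> 'c) \<times> 'a" where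
    "F = (\<lambda>p. case fst (fst p) of [] \<Rightarrow> p | a # as \<Rightarrow> ((as, f (snd p) a (snd (fst p))), snd p))"
  have F: "polytime F"
    unfolding F_def
  proof (rule polytime_list_case)
    have "polytime (\<lambda>q :: (('b list \<times> 'c) \<times> 'a) \<times> 'b \<times> 'b list. (snd (fst q), fst (snd q), snd (fst (fst q))))"
      by (intro polytime_intros)
    from polytime_comp[OF f this]
    show "polytime (\<lambda>q :: (('b list \<times> 'c) \<times> 'a) \<times> 'b \<times> 'b list.
        ((snd (snd q), f (snd (fst q)) (fst (snd q)) (snd (fst (fst q)))), snd (fst q)))"
      by (intro polytime_intros) simp
  qed (intro polytime_intros)+
  have iter: "(F ^^ i) ((ys, c), x) = ((drop i ys, fold (f x) (take i ys) c), x)" for i ys c x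
  proof (induction i arbitrary: ys c)
    case (Suc i)
    have "F (([], c), x) = (([], c), x)" "F ((a # as, c), x) = ((as, f x a c), x)" for a as
      by (simp_all add: F_def)
    with Suc show ?case
      by (cases ys) (simp_all add: funpow_Suc_right del: funpow.simps)
  qed simp
  obtain S where S: "poly_bounded S" "\<And>x. sz (xs x) \<le> S (sz x)"
    using polytime_size[OF xs] by metis
  have "polytime (\<lambda>x. (F ^^ sz (xs x)) ((xs x, b x), x))"
  proof (rule polytime_funpow[OF F xs])
    show "polytime (\<lambda>x. ((xs x, b x), x))"
      using xs b by (intro polytime_intros)
    show "poly_bounded (\<lambda>n. S n + B n + n + 2)"
      using S B by auto
    fix x i
    have "sz (drop i (xs x)) \<le> sz (xs x)"
      using sz_append[of "take i (xs x)" "drop i (xs x)"] sz_pos[of "take i (xs x)"] by simp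
    moreover have "sz (fold (f x) (take i (xs x)) (b x)) \<le> B (sz x)"
      by (rule B(2)[of _ _ "drop i (xs x)"]) simp
    ultimately show "sz ((F ^^ i) ((xs x, b x), x)) \<le> S (sz x) + B (sz x) + sz x + 2"
      using S(2)[of x] by (simp add: iter)
  qed
  then have "polytime (\<lambda>x. snd (fst ((F ^^ sz (xs x)) ((xs x, b x), x))))"
    by (intro polytime_intros)
  moreover have "snd (fst ((F ^^ sz (xs x)) ((xs x, b x), x))) = fold (f x) (xs x) (b x)" for x
    using length_le_sz[of "xs x"] by (simp add: iter)
  ultimately show ?thesis by simp
qed

text \<open>The usable criterion: if a step adds an amount that depends on the parameter and the
  element but not on the accumulator, sizes add up to a polynomial.\<close>

lemma polytime_fold_additive:
  fixes xs :: "'a::encodable \<Rightarrow> 'b::encodable list" and b :: "'a \<Rightarrow> 'c::encodable"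
  assumes f: "polytime (\<lambda>p. f (fst p) (fst (snd p)) (snd (snd p)))" and xs: "polytime xs" and b: "polytime b"
    and Q: "poly_bounded Q" "\<And>x a c. sz (f x a c) \<le> sz c + Q (sz x + sz a)"
  shows "polytime (\<lambda>x. fold (f x) (xs x) (b x))"
proof -
  obtain S where S: "poly_bounded S" "\<And>x. sz (xs x) \<le> S (sz x)"
    using polytime_size[OF xs] by metis
  obtain Bb where Bb: "poly_bounded Bb" "\<And>x. sz (b x) \<le> Bb (sz x)"
    using polytime_size[OF b] by metis
  obtain R where R: "poly_bounded R" "mono R" "\<And>n. Q n \<le> R n"
    using poly_bounded_obtain_mono[OF Q(1)] by blast
  show ?thesis
  proof (rule polytime_fold[OF f xs b, of "\<lambda>n. Bb n + S n * R (n + S n)"])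
    show "poly_bounded (\<lambda>n. Bb n + S n * R (n + S n))"
      using Bb S R by (auto intro!: poly_bounded_comp[of R])
    fix x ys zs assume e: "xs x = ys @ zs"
    define m where "m = R (sz x + S (sz x))"
    have "sz (fold (f x) ys c) \<le> sz c + length ys * m" if "set ys \<subseteq> set (xs x)" for ys c
      using that
    proof (induction ys arbitrary: c)
      case (Cons a ys)
      have "sz a \<le> S (sz x)"
        using sz_member_le[of a "xs x"] S(2)[of x] Cons.prems by simp
      then have "R (sz x + sz a) \<le> m"
        unfolding m_def by (intro monoD[OF R(2)]) simp
      then have "sz (f x a c) \<le> sz c + m"
        using Q(2)[of x a c] R(3)[of "sz x + sz a"] by simp
      then show ?case
        using Cons.IH[of "f x a c"] Cons.prems by simp
    qed simp
    from this[of ys "b x"] have "sz (fold (f x) ys (b x)) \<le> sz (b x) + length ys * m"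
      by (simp add: e)
    moreover have "length ys * m \<le> S (sz x) * m"
      using length_le_sz[of "xs x"] S(2)[of x] by (intro mult_right_mono) (simp_all add: e)
    ultimately show "sz (fold (f x) ys (b x)) \<le> Bb (sz x) + S (sz x) * R (sz x + S (sz x))"
      using Bb(2)[of x] unfolding m_def[symmetric] by linarith
  qed
qed

lemma polytime_rev [polytime_intros]:
  fixes f :: "'a::encodable \<Rightarrow> 'b::encodable list"
  assumes "polytime f"
  shows "polytime (\<lambda>x. rev (f x))"
proof -
  have "polytime (\<lambda>x. fold Cons (f x) [])"
    by (rule polytime_fold_additive[where Q = "\<lambda>n. n + 1"]) (intro polytime_intros assms | auto)+
  moreover have "fold Cons ys [] = rev ys" for ys :: "'b list"
    by (simp add: fold_Cons_rev)
  ultimately show ?thesis by simp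
qed

lemma polytime_append [polytime_intros]:
  assumes "polytime f" "polytime g"
  shows "polytime (\<lambda>x. f x @ g x)"
proof -
  have "polytime (\<lambda>x. fold Cons (rev (f x)) (g x))"
    by (rule polytime_fold_additive[where Q = "\<lambda>n. n + 1"]) (intro polytime_intros assms | auto)+
  then show ?thesis by (simp add: fold_Cons_rev)
qed

lemma polytime_map [polytime_intros]:
  fixes f :: "'a::encodable \<Rightarrow> 'b::encodable \<Rightarrow> 'c::encodable"
  assumes f: "polytime (\<lambda>p. f (fst p) (snd p))" and xs: "polytime xs"
  shows "polytime (\<lambda>x. map (f x) (xs x))"
proof -
  obtain S where S: "poly_bounded S" "mono S" "\<And>p. sz (f (fst p) (snd p)) \<le> S (sz p)"
    using polytime_size[OF f] by metis
  have "polytime (\<lambda>x. fold (\<lambda>a b. f x a # b) (rev (xs x)) [])"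
  proof (rule polytime_fold_additive[where Q = "\<lambda>n. S (n + 1) + 1"])
    show "polytime (\<lambda>p. f (fst p) (fst (snd p)) # snd (snd p))"
      by (rule polytime_Cons[OF polytime_comp2[OF f]]) (intro polytime_intros)+
    show "poly_bounded (\<lambda>n. S (n + 1) + 1)"
      using S by (auto intro!: poly_bounded_comp[of S])
    show "sz (f x a # c) \<le> sz c + (S (sz x + sz a + 1) + 1)" for x a c
      using S(3)[of "(x, a)"] by simp
  qed (intro polytime_intros xs)+
  moreover have "fold (\<lambda>a b. g a # b) (rev ys) c = map g ys @ c" for g :: "'b \<Rightarrow> 'c" and ys c
    by (induction ys arbitrary: c) auto
  ultimately show ?thesis by simp
qed

lemma polytime_concat [polytime_intros]:
  fixes f :: "'a::encodable \<Rightarrow> 'b::encodable list list"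
  assumes "polytime f"
  shows "polytime (\<lambda>x. concat (f x))"
proof -
  have "polytime (\<lambda>x. fold (\<lambda>a b. a @ b) (rev (f x)) [])"
  proof (rule polytime_fold_additive[where Q = "\<lambda>n. n"])
    show "sz (a @ c) \<le> sz c + (sz x + sz a)" for x :: 'a and a c :: "'b list"
      using sz_append[of a c] by simp
  qed (intro polytime_intros assms | auto)+
  moreover have "fold (\<lambda>a b. a @ b) (rev ys) c = concat ys @ c" for ys :: "'b list list" and c
    by (induction ys arbitrary: c) auto
  ultimately show ?thesis by simp
qed

lemma polytime_filter [polytime_intros]:
  fixes P :: "'a::encodable \<Rightarrow> 'b::encodable \<Rightarrow> bool"
  assumes f: "polytime (\<lambda>p. P (fst p) (snd p))" and xs: "polytime xs"
  shows "polytime (\<lambda>x. filter (P x) (xs x))"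
proof -
  have "polytime (\<lambda>x. concat (map (\<lambda>a. if P x a then [a] else []) (xs x)))"
    by (intro polytime_intros f xs)
  moreover have "concat (map (\<lambda>a. if Q a then [a] else []) ys) = filter Q ys" for Q and ys :: "'b list"
    by (induction ys) auto
  ultimately show ?thesis by simp
qed

lemma polytime_eq_Nil [polytime_intros]:
  fixes f :: "'a::encodable \<Rightarrow> 'b::encodable list"
  assumes "polytime f"
  shows "polytime (\<lambda>x. f x = [])"
proof -
  have "polytime (\<lambda>x. case f x of [] \<Rightarrow> True | a # as \<Rightarrow> False)"
    by (intro polytime_intros assms)
  moreover have "(case l of [] \<Rightarrow> True | a # as \<Rightarrow> False) = (l = [])" for l :: "'b list"
    by (cases l) auto
  ultimately show ?thesis by simp
qed

lemma polytime_list_ex [polytime_intros]: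
  assumes f: "polytime (\<lambda>p. P (fst p) (snd p))" and xs: "polytime xs"
  shows "polytime (\<lambda>x. list_ex (P x) (xs x))"
proof -
  have "polytime (\<lambda>x. \<not> filter (P x) (xs x) = [])"
    by (intro polytime_not polytime_eq_Nil polytime_intros f xs)
  then show ?thesis
    by (simp add: filter_empty_conv list_ex_iff)
qed

lemma polytime_list_all [polytime_intros]:
  assumes f: "polytime (\<lambda>p. P (fst p) (snd p))" and xs: "polytime xs"
  shows "polytime (\<lambda>x. list_all (P x) (xs x))"
proof -
  have "polytime (\<lambda>x. \<not> list_ex (\<lambda>a. \<not> P x a) (xs x))"
    by (intro polytime_intros f xs)
  then show ?thesis
    by (simp add: list_all_iff list_ex_iff)
qed

lemma polytime_list_eq:
  assumes "polytime (\<lambda>p :: 'a \<times> 'a::encodable. fst p = snd p)"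
  shows "polytime (\<lambda>p :: 'a list \<times> 'a list. fst p = snd p)"
proof -
  \<comment> \<open>The second list is consumed in step with the first. They are equal if no
    mismatch occurs, the second does not run out early, and nothing of it is left over.\<close>
  define step where "step = (\<lambda>(a :: 'a) (st :: 'a list \<times> bool).
    case fst st of [] \<Rightarrow> ([], False) | b # bs \<Rightarrow> (bs, snd st \<and> a = b))"
  have "polytime (\<lambda>p :: 'a list \<times> 'a list. fold (\<lambda>a st. step a st) (fst p) (snd p, True))"
  proof (rule polytime_fold_additive[where Q = "\<lambda>n. 3"])
    show "polytime (\<lambda>p :: ('a list \<times> 'a list) \<times> 'a \<times> 'a list \<times> bool. step (fst (snd p)) (snd (snd p)))"
      unfolding step_def by (intro polytime_intros polytime_comp2[where h = "(=)", OF assms])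
    show "sz (step a c) \<le> sz c + 3" for a and c :: "'a list \<times> bool"
      using sz_bool[of "snd c \<and> a = hd (fst c)"] sz_bool[of False]
      by (auto simp: step_def sz_prod[of c] split: list.splits)
  qed (intro polytime_intros | auto)+
  then have "polytime (\<lambda>p :: 'a list \<times> 'a list. snd (fold step (fst p) (snd p, True)) \<and> fst (fold step (fst p) (snd p, True)) = [])"
    by (intro polytime_intros polytime_eq_Nil) auto
  moreover have "(snd (fold step xs (ys, b)) \<and> fst (fold step xs (ys, b)) = []) \<longleftrightarrow> b \<and> xs = ys" for xs ys b
  proof (induction xs arbitrary: ys b)
    case (Cons x xs)
    then show ?case by (cases ys) (auto simp: step_def)
  qed auto
  ultimately show ?thesis by simp
qed

text \<open>Letters are compared through their unary indices, which are lists over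
  \<open>unit\<close>, where equality of elements is constantly true.\<close>

lemma polytime_letter_eq: "polytime (\<lambda>p :: letter \<times> letter. fst p = snd p)"
proof -
  have "polytime (\<lambda>p :: unit \<times> unit. fst p = snd p)"
    using polytime_const[of True] by simp
  note eq = polytime_list_eq[OF this]
  have u: "polytime (\<lambda>a. replicate (letter_index a) ())"
    by (rule polytime_coerce) (simp add: enc_letter_def)
  have "polytime (\<lambda>p :: letter \<times> letter. replicate (letter_index (fst p)) () = replicate (letter_index (snd p)) ())"
    by (rule polytime_comp2[where h = "(=)", OF eq]) (rule polytime_comp[OF u], intro polytime_intros)+
  moreover have "replicate (letter_index a) () = replicate (letter_index b) () \<longleftrightarrow> a = b" for a b
    by (cases a; cases b) (simp_all add: numeral_eq_Suc)
  ultimately show ?thesis by simp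
qed

lemmas polytime_eq_letter [polytime_intros] = polytime_comp2[where h = "(=)", OF polytime_letter_eq]
lemmas polytime_eq_word [polytime_intros] = polytime_comp2[where h = "(=)", OF polytime_list_eq[OF polytime_letter_eq]]

section \<open>Runs\<close>

text \<open>The relation \<open>global_step\<close> with update functions replaced by their codes,
  so that transitions are data an algorithm can handle.\<close>

definition estep :: "('s \<times> update_code \<times> 's) set \<Rightarrow> 's \<times> ennreal \<Rightarrow> 's \<times> ennreal \<Rightarrow> bool" where
  "estep E g g' \<longleftrightarrow> (\<exists>u. (fst g, u, fst g') \<in> E \<and> update u (Some (snd g)) = Some (snd g'))"

abbreviation reaches :: "('s \<times> update_code \<times> 's) set \<Rightarrow> 's \<times> ennreal \<Rightarrow> 's \<times> ennreal \<Rightarrow> bool" where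
  "reaches E \<equiv> (estep E)\<^sup>*\<^sup>*"

abbreviation reaches1 :: "('s \<times> update_code \<times> 's) set \<Rightarrow> 's \<times> ennreal \<Rightarrow> 's \<times> ennreal \<Rightarrow> bool" where
  "reaches1 E \<equiv> (estep E)\<^sup>+\<^sup>+"

abbreviation steps :: "('s \<times> update_code \<times> 's) set \<Rightarrow> nat \<Rightarrow> 's \<times> ennreal \<Rightarrow> 's \<times> ennreal \<Rightarrow> bool" where
  "steps E n \<equiv> estep E ^^ n"

section \<open>Integer updates under shifts of the energy\<close>

lemma update_Add_ennreal:
  assumes "0 \<le> r"
  shows "update (Add k) (Some (ennreal r)) =
    (if - real_of_int k \<le> r then Some (ennreal (r + real_of_int k)) else None)"
proof -
  have "enn2ereal (ennreal r) + ereal (real_of_int k) = ereal (r + real_of_int k)"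
    using assms by (simp add: enn2ereal_ennreal)
  then show ?thesis
    using assms by (simp add: ennreal_le_iff e2ennreal_ereal)
qed

lemma update_top [simp]: "update u (Some \<infinity>) = Some \<infinity>"
proof (cases u)
  case (Add k)
  then show ?thesis by (simp add: infinity_ennreal_def e2ennreal_infty)
qed simp

lemma update_shift:
  assumes "update u (Some x) = Some y"
  shows "update u (Some (x + d)) = Some (y + d)"
proof (cases u)
  case (Add k)
  show ?thesis
  proof (cases "x = \<infinity> \<or> d = \<infinity>")
    case True
    then show ?thesis using assms update_top[of u] by (auto simp: infinity_ennreal_def)
  next
    case False
    then obtain r e where re: "x = ennreal r" "0 \<le> r" "d = ennreal e" "0 \<le> e"
      by (metis ennreal_cases infinity_ennreal_def)
    have "- real_of_int k \<le> r" "y = ennreal (r + real_of_int k)"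
      using assms re by (auto simp: Add update_Add_ennreal simp del: update.simps split: if_splits)
    then show ?thesis
      using re by (simp add: Add update_Add_ennreal algebra_simps flip: ennreal_plus del: update.simps)
  qed
next
  case Add_Infinity
  then show ?thesis using assms by (auto simp: infinity_ennreal_def)
qed

text \<open>Converse of \<open>update_shift\<close>: an amount never undercut can be taken away from
  both ends. This is what lowers a cycle until its minimum is 0.\<close>

lemma update_unshift:
  assumes "update u (Some x) = Some y" "m \<le> x" "m \<le> y" "m \<noteq> \<infinity>"
  shows "update u (Some (x - m)) = Some (y - m)"
proof (cases u)
  case (Add k)
  show ?thesis
  proof (cases "x = \<infinity>")
    case True
    then show ?thesis using assms update_top[of u] by (auto simp: infinity_ennreal_def)
  next
    case False
    then obtain r e where re: "x = ennreal r" "0 \<le> r" "m = ennreal e" "0 \<le> e"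
      using assms(4) by (metis ennreal_cases infinity_ennreal_def)
    have k: "- real_of_int k \<le> r" "y = ennreal (r + real_of_int k)"
      using assms(1) re by (auto simp: Add update_Add_ennreal simp del: update.simps split: if_splits)
    then have "e \<le> r" "e \<le> r + real_of_int k"
      using assms(2,3) re by auto
    then show ?thesis
      using re k by (simp add: Add update_Add_ennreal ennreal_minus algebra_simps del: update.simps)
  qed
next
  case Add_Infinity
  then show ?thesis using assms by (auto simp: infinity_ennreal_def)
qed

lemma update_nat:
  assumes "update u (Some (of_nat n)) = Some y"
  shows "y = \<infinity> \<or> (\<exists>m. y = of_nat m)"
proof (cases u)
  case (Add k)
  have "- real_of_int k \<le> real n" "y = ennreal (real n + real_of_int k)"
    using assms update_Add_ennreal[of "real n" k]
    by (auto simp: Add ennreal_of_nat_eq_real_of_nat simp del: update.simps split: if_splits)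
  moreover from this(1) have "real n + real_of_int k = real (nat (int n + k))"
    by simp
  ultimately show ?thesis
    by (metis ennreal_of_nat_eq_real_of_nat)
next
  case Add_Infinity
  then show ?thesis using assms by auto
qed

lemma update_finite:
  assumes "update u (Some x) = Some y" "y \<noteq> \<infinity>"
  shows "x \<noteq> \<infinity> \<and> (\<exists>k. enn2real y = enn2real x + real_of_int k)"
proof (cases u)
  case (Add k)
  have x: "x \<noteq> \<infinity>"
    using assms update_top[of u] by auto
  then obtain r where r: "x = ennreal r" "0 \<le> r"
    by (metis ennreal_cases infinity_ennreal_def)
  have "- real_of_int k \<le> r" "y = ennreal (r + real_of_int k)"
    using assms r by (auto simp: Add update_Add_ennreal simp del: update.simps split: if_splits)
  then show ?thesis
    using r x by auto
next
  case Add_Infinity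
  then show ?thesis using assms by auto
qed

lemma steps_shift: "steps E n (q, x) (q', y) \<Longrightarrow> steps E n (q, x + d) (q', y + d)"
proof (induction n arbitrary: q' y)
  case (Suc n)
  then obtain p z where "steps E n (q, x) (p, z)" "estep E (p, z) (q', y)"
    by auto
  then have "steps E n (q, x + d) (p, z + d)" "estep E (p, z + d) (q', y + d)"
    using Suc.IH update_shift unfolding estep_def by fastforce+
  then show ?case by auto
qed simp

lemma steps_mono:
  assumes "steps E n (q, x) (q', y)" "x \<le> x'"
  shows "\<exists>y' \<ge> y. steps E n (q, x') (q', y')"
proof -
  obtain d where "x' = x + d"
    using assms(2) by (auto simp: le_iff_add)
  then show ?thesis
    using steps_shift[OF assms(1), of d] by (intro exI[of _ "y + d"]) (simp add: le_iff_add)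
qed

lemma reach_mono:
  assumes "reaches E (q, x) (q', y)" "x \<le> x'"
  shows "\<exists>y' \<ge> y. reaches E (q, x') (q', y')"
  using assms steps_mono unfolding rtranclp_power by metis

lemma steps_top: "steps E n (q, \<infinity>) (q', y) \<Longrightarrow> y = \<infinity>"
proof (induction n arbitrary: q' y)
  case (Suc n)
  then obtain p z where "steps E n (q, \<infinity>) (p, z)" "estep E (p, z) (q', y)"
    by auto
  moreover from this(1) have "z = \<infinity>"
    by (rule Suc.IH)
  ultimately show ?case
    using update_top by (auto simp: estep_def)
qed simp

text \<open>Integrality, applied with \<open>a = 0\<close> to turn a positive gain into a gain of at
  least 1.\<close>

lemma steps_nat: "steps E n (q, of_nat a) (q', y) \<Longrightarrow> y = \<infinity> \<or> (\<exists>m. y = of_nat m)"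
proof (induction n arbitrary: q' y)
  case (Suc n)
  then obtain p z where "steps E n (q, of_nat a) (p, z)" and s: "estep E (p, z) (q', y)"
    by auto
  then have z: "z = \<infinity> \<or> (\<exists>m. z = of_nat m)"
    using Suc.IH by blast
  obtain u where u: "update u (Some z) = Some y"
    using s by (auto simp: estep_def)
  from z show ?case
  proof
    assume "z = \<infinity>"
    then show ?thesis using u update_top[of u] by simp
  next
    assume "\<exists>m. z = of_nat m"
    then obtain m where "z = of_nat m" ..
    then show ?thesis using u update_nat by blast
  qed
qed auto

lemma relpowp_path:
  assumes "\<And>l. i \<le> l \<Longrightarrow> l < j \<Longrightarrow> R (f l) (f (Suc l))" "i \<le> j"
  shows "(R ^^ (j - i)) (f i) (f j)"
  unfolding relpowp_fun_conv
  by (rule exI[of _ "\<lambda>l. f (i + l)"]) (use assms in auto)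

text \<open>
  A cycle that does not lose energy can be started at its point of lowest energy, and then no
  initial energy is needed.
\<close>

lemma rotate_cycle:
  assumes "steps E d (q, x) (q, x')" "x \<le> x'" "x \<noteq> \<infinity>" "d > 0"
  obtains s m a b w \<delta> where "a > 0" "a + b = d" "steps E b (q, x) (s, m)"
    "steps E a (s, m) (q, x')" "steps E a (s, 0) (q, w)" "steps E b (q, w) (s, \<delta>)" "x < x' \<Longrightarrow> 0 < \<delta>"
proof -
  obtain f where f: "f 0 = (q, x)" "f d = (q, x')" "\<And>i. i < d \<Longrightarrow> estep E (f i) (f (Suc i))"
    using assms(1) unfolding relpowp_fun_conv by blast
  \<comment> \<open>The time of lowest energy. Time \<open>d\<close> is left out of the choice so
    that the part after \<open>k\<close>, of length \<open>a = d - k\<close>, is nonempty; it cannot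
    be lower than time 0 because the cycle does not lose.\<close>
  define k where "k = arg_min_on (\<lambda>i. snd (f i)) {..<d}"
  have k: "k < d" "\<And>i. i < d \<Longrightarrow> snd (f k) \<le> snd (f i)"
    unfolding k_def using arg_min_if_finite(1)[of "{..<d}" "\<lambda>i. snd (f i)"]
      arg_min_least[of "{..<d}" _ "\<lambda>i. snd (f i)"] assms(4) by auto
  define m where "m = snd (f k)"
  have mx: "m \<le> x"
    using k(2)[of 0] assms(4) f(1) by (simp add: m_def)
  have min: "m \<le> snd (f i)" if "i \<le> d" for i
  proof (cases "i = d")
    case True
    then show ?thesis using mx assms(2) f(2) by simp
  next
    case False
    then show ?thesis using k(2)[of i] that by (simp add: m_def)
  qed
  have m: "m \<noteq> \<infinity>"
    using mx assms(3) by (auto simp: infinity_ennreal_def top_unique)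
  define g where "g i = (fst (f i), snd (f i) - m)" for i
  have g: "estep E (g i) (g (Suc i))" if "i < d" for i
    using f(3)[OF that] update_unshift[OF _ min[of i] min[of "Suc i"] m] that
    unfolding estep_def g_def by auto
  let ?s = "fst (f k)"
  have gk: "g k = (?s, 0)"
    using m by (simp add: g_def m_def)
  \<comment> \<open>\<open>\<delta>\<close> is the gain of one round. The first part of the lowered
    cycle, entered with this surplus, ends at \<open>\<delta>\<close> instead of 0.\<close>
  obtain \<delta> where \<delta>: "x' - m = (x - m) + \<delta>"
    using assms(2) by (metis ennreal_minus_mono le_iff_add order_refl)
  have A: "steps E (d - k) (f k) (f d)" "steps E (d - k) (g k) (g d)"
    using relpowp_path[of k d "estep E" f] relpowp_path[of k d "estep E" g] f(3) g k(1) by auto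
  have B: "steps E k (f 0) (f k)" "steps E k (g 0) (g k)"
    using relpowp_path[of 0 k "estep E" f] relpowp_path[of 0 k "estep E" g] f(3) g k(1) by auto
  have "steps E k (q, (x - m) + \<delta>) (?s, 0 + \<delta>)"
    using B(2) unfolding gk by (intro steps_shift) (simp add: g_def f)
  moreover have "0 < \<delta>" if "x < x'"
  proof (rule ccontr)
    assume "\<not> 0 < \<delta>"
    then have "x' - m = x - m" using \<delta> by simp
    then have "x' = x"
      using mx assms(2) by (metis diff_add_cancel_ennreal order_trans)
    then show False using that by simp
  qed
  ultimately show ?thesis
    using A B k(1) \<delta> gk by (intro that[of "d - k" k ?s m "x' - m" \<delta>]) (auto simp: f g_def m_def)
qed

section \<open>Binary numbers\<close>

type_synonym num_bits = "bool list"

text \<open>Least significant bit first; zeros at the far end are allowed, so a number has many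
  representations.\<close>

primrec nval :: "num_bits \<Rightarrow> nat" where
  "nval [] = 0"
| "nval (b # bs) = of_bool b + 2 * nval bs"

definition head_bit :: "num_bits \<Rightarrow> bool" where
  "head_bit bs = (case bs of [] \<Rightarrow> False | b # _ \<Rightarrow> b)"

text \<open>One scan serves as adder and subtractor, which differ only in the carry. The list
  \<open>a @ b\<close> acts as a clock whose ticks suffice for all bits of the result.\<close>

definition serial :: "(bool \<Rightarrow> bool \<Rightarrow> bool \<Rightarrow> bool) \<Rightarrow> num_bits \<Rightarrow> num_bits \<Rightarrow> bool \<times> num_bits" where
  "serial carry a b = (case fold (\<lambda>_ (a, b, c, out).
      (tl a, tl b, carry (head_bit a) (head_bit b) c, ((head_bit a \<noteq> head_bit b) \<noteq> c) # out))
      (a @ b) (a, b, False, []) of (_, _, c, out) \<Rightarrow> (c, rev out))"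

text \<open>The carry is the majority of the three bits.\<close>

definition add_bits :: "num_bits \<Rightarrow> num_bits \<Rightarrow> num_bits" where
  "add_bits a b = snd (serial (\<lambda>x y c. if x then y \<or> c else y \<and> c) a b)"

text \<open>The borrow is the majority with \<open>x\<close> negated; a borrow left at the end says
  that \<open>a\<close> is less than \<open>b\<close>.\<close>

definition sub_bits :: "num_bits \<Rightarrow> num_bits \<Rightarrow> bool \<times> num_bits" where
  "sub_bits = serial (\<lambda>x y c. if x then y \<and> c else y \<or> c)"

definition monus_bits :: "num_bits \<Rightarrow> num_bits \<Rightarrow> num_bits" where
  "monus_bits a b = (if fst (sub_bits a b) then [] else snd (sub_bits a b))"

definition le_bits :: "num_bits \<Rightarrow> num_bits \<Rightarrow> bool" where
  "le_bits a b \<longleftrightarrow> \<not> fst (sub_bits b a)"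

lemma nval_append: "nval (xs @ ys) = nval xs + 2 ^ length xs * nval ys"
  by (induction xs) (auto simp: algebra_simps)

lemma nval_less: "nval xs < 2 ^ length xs"
  by (induction xs) (auto simp: of_bool_def)

lemma nval_head_tl: "nval bs = of_bool (head_bit bs) + 2 * nval (tl bs)"
  by (cases bs) (auto simp: head_bit_def)

text \<open>\<open>\<sigma>\<close> is 1 for addition and -1 for subtraction: full adder and full
  subtractor obey the same equation up to the sign of the second operand and of the carry.\<close>

lemma serial_invariant:
  fixes \<sigma> :: int
  assumes carry: "\<And>x y c. int (of_bool ((x \<noteq> y) \<noteq> c)) + 2 * \<sigma> * int (of_bool (carry x y c))
      = int (of_bool x) + \<sigma> * int (of_bool y) + \<sigma> * int (of_bool c)"
    and res: "serial carry a b = (c, out)"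
  shows "int (nval out) + 2 ^ length out * \<sigma> * of_bool c = int (nval a) + \<sigma> * int (nval b)"
    and "length out = length a + length b"
proof -
  define step where "step = (\<lambda>(_ :: bool) (a, b, c, out).
      (tl a, tl b, carry (head_bit a) (head_bit b) c, ((head_bit a \<noteq> head_bit b) \<noteq> c) # out))"
  have inv: "fold step ds (a, b, c, out) = (a', b', c', out') \<Longrightarrow>
      a' = drop (length ds) a \<and> b' = drop (length ds) b \<and> length out' = length out + length ds \<and>
      int (nval (rev out')) + 2 ^ length out' * (int (nval a') + \<sigma> * int (nval b') + \<sigma> * of_bool c') =
      int (nval (rev out)) + 2 ^ length out * (int (nval a) + \<sigma> * int (nval b) + \<sigma> * of_bool c)"
    for ds a b c out a' b' c' out'
  proof (induction ds arbitrary: a b c out)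
    case (Cons d ds)
    let ?x = "head_bit a" and ?y = "head_bit b"
    have *: "fold step ds (tl a, tl b, carry ?x ?y c, ((?x \<noteq> ?y) \<noteq> c) # out) = (a', b', c', out')"
      using Cons.prems by (simp add: step_def)
    have "int (nval (rev (((?x \<noteq> ?y) \<noteq> c) # out))) +
        2 ^ length (((?x \<noteq> ?y) \<noteq> c) # out) * (int (nval (tl a)) + \<sigma> * int (nval (tl b)) + \<sigma> * of_bool (carry ?x ?y c))
      = int (nval (rev out)) + 2 ^ length out * ((int (of_bool ((?x \<noteq> ?y) \<noteq> c)) + 2 * \<sigma> * int (of_bool (carry ?x ?y c)))
          + 2 * int (nval (tl a)) + 2 * \<sigma> * int (nval (tl b)))"
      by (simp add: nval_append algebra_simps)
    also have "\<dots> = int (nval (rev out)) + 2 ^ length out * (int (nval a) + \<sigma> * int (nval b) + \<sigma> * of_bool c)"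
      unfolding carry nval_head_tl[of a] nval_head_tl[of b] by (simp add: algebra_simps)
    finally have e: "int (nval (rev (((?x \<noteq> ?y) \<noteq> c) # out))) +
        2 ^ length (((?x \<noteq> ?y) \<noteq> c) # out) * (int (nval (tl a)) + \<sigma> * int (nval (tl b)) + \<sigma> * of_bool (carry ?x ?y c))
      = int (nval (rev out)) + 2 ^ length out * (int (nval a) + \<sigma> * int (nval b) + \<sigma> * of_bool c)" .
    show ?case
      using Cons.IH[OF *, unfolded e] unfolding drop_Suc length_Cons add_Suc add_Suc_right .
  qed auto
  obtain a' b' out' where r: "fold step (a @ b) (a, b, False, []) = (a', b', c, out')" "out = rev out'"
    using res unfolding serial_def step_def[symmetric] by (auto split: prod.splits)
  from inv[OF r(1)] have i: "a' = []" "b' = []" "length out' = length a + length b"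
    by simp_all
  from inv[OF r(1)] have "int (nval (rev out')) + 2 ^ length out' * (int (nval a') + \<sigma> * int (nval b') + \<sigma> * of_bool c) =
      int (nval (rev [])) + 2 ^ length ([] :: bool list) * (int (nval a) + \<sigma> * int (nval b) + \<sigma> * of_bool False)"
    by blast
  then show "int (nval out) + 2 ^ length out * \<sigma> * of_bool c = int (nval a) + \<sigma> * int (nval b)"
    by (cases c) (simp_all add: r(2) i)
  show "length out = length a + length b"
    by (simp add: r(2) i(3))
qed

lemma nval_add_bits [simp]: "nval (add_bits a b) = nval a + nval b"
proof -
  obtain c out where r: "serial (\<lambda>x y c. if x then y \<or> c else y \<and> c) a b = (c, out)"
    by fastforce
  have inv: "int (nval out) + 2 ^ length out * 1 * of_bool c = int (nval a) + 1 * int (nval b)"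
    "length out = length a + length b"
    by (rule serial_invariant[where \<sigma> = 1, OF _ r], simp split: if_splits)+
  \<comment> \<open>No overflow, as the sum is less than \<open>(nval a + 1) * (nval b + 1)\<close>
    and the output has \<open>length a + length b\<close> bits.\<close>
  have "nval a + nval b < 2 ^ length out"
  proof -
    have "nval a + 1 \<le> 2 ^ length a" "nval b + 1 \<le> 2 ^ length b"
      using nval_less[of a] nval_less[of b] by simp_all
    then have "(nval a + 1) * (nval b + 1) \<le> 2 ^ length a * 2 ^ length b"
      by (rule mult_mono) simp_all
    then show ?thesis
      by (simp add: inv(2) power_add)
  qed
  then have "int (nval a) + int (nval b) < 2 ^ length out"
    by (metis of_nat_add of_nat_less_iff of_nat_numeral of_nat_power)
  then have "\<not> c"
    using inv(1) by (auto simp: of_bool_def split: if_splits)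
  then show ?thesis
    using inv(1) by (simp add: add_bits_def r)
qed

lemma sub_bits:
  assumes "sub_bits a b = (c, out)"
  shows "c \<longleftrightarrow> nval a < nval b" "\<not> c \<Longrightarrow> nval out = nval a - nval b"
proof -
  have inv: "int (nval out) + 2 ^ length out * (-1) * of_bool c = int (nval a) + (-1) * int (nval b)"
    by (rule serial_invariant(1)[where \<sigma> = "-1", OF _ assms[unfolded sub_bits_def]]) (simp split: if_splits)
  have less: "int (nval out) < 2 ^ length out"
    using nval_less[of out] by (metis of_nat_less_iff of_nat_numeral of_nat_power)
  have "c \<Longrightarrow> int (nval out) - 2 ^ length out = int (nval a) - int (nval b)"
    and "\<not> c \<Longrightarrow> int (nval out) = int (nval a) - int (nval b)"
    using inv by simp_all
  with less show c: "c \<longleftrightarrow> nval a < nval b"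
    by (cases c) linarith+
  show "nval out = nval a - nval b" if "\<not> c"
    using inv that c by auto
qed

lemma nval_monus_bits [simp]: "nval (monus_bits a b) = nval a - nval b"
  using sub_bits[OF prod.collapse[symmetric], of a b]
  by (auto simp: monus_bits_def)

lemma le_bits [simp]: "le_bits a b \<longleftrightarrow> nval a \<le> nval b"
  using sub_bits(1)[OF prod.collapse[symmetric], of b a]
  by (auto simp: le_bits_def)

section \<open>Minimal initial energies\<close>

text \<open>A weight is a sign and an absolute value; \<^const>\<open>None\<close> stands for the update to infinity.\<close>

type_synonym weight = "(bool \<times> num_bits) option"

type_synonym 's graph = "('s \<times> weight \<times> 's) list"

definition weight_code :: "weight \<Rightarrow> update_code" where
  "weight_code w = (case w of None \<Rightarrow> Add_Infinity
     | Some (neg, b) \<Rightarrow> Add (if neg then - int (nval b) else int (nval b)))"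

definition edges :: "'s graph \<Rightarrow> ('s \<times> update_code \<times> 's) set" where
  "edges ts = (\<lambda>t. (fst t, weight_code (fst (snd t)), snd (snd t))) ` set ts"

definition before :: "weight \<Rightarrow> num_bits \<Rightarrow> num_bits" where
  "before w b = (case w of None \<Rightarrow> [] | Some p \<Rightarrow> if fst p then add_bits b (snd p) else monus_bits b (snd p))"

text \<open>For \<open>Add k\<close>, reaching at least b with b \<ge> 0 already implies the guard
  -k \<le> x, so the least sufficient energy is max 0 (b - k). Truncated subtraction computes this
  maximum.\<close>

lemma before:
  "(\<exists>y. update (weight_code w) (Some x) = Some y \<and> of_nat (nval b) \<le> y) \<longleftrightarrow> of_nat (nval (before w b)) \<le> x"
proof (cases w)
  case None
  then show ?thesis by (simp add: weight_code_def before_def infinity_ennreal_def)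
next
  case (Some p)
  define k where "k = (if fst p then - int (nval (snd p)) else int (nval (snd p)))"
  have u: "weight_code w = Add k"
    by (simp add: Some weight_code_def k_def split: prod.split)
  have n: "int (nval (before w b)) = max 0 (int (nval b) - k)"
    by (auto simp: Some before_def k_def)
  show ?thesis
  proof (cases x)
    case (real r)
    have "real (nval (before w b)) = max 0 (real (nval b) - real_of_int k)"
      using n by (metis of_int_0 of_int_diff of_int_max of_int_of_nat_eq)
    moreover have "of_nat (nval b) \<le> ennreal (r + real_of_int k) \<longleftrightarrow> real (nval b) \<le> r + real_of_int k"
      if "- real_of_int k \<le> r"
      using that by (simp add: ennreal_of_nat_eq_real_of_nat)
    ultimately show ?thesis
      using real by (auto simp: u update_Add_ennreal ennreal_of_nat_eq_real_of_nat simp del: update.simps)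
  next
    case top
    then show ?thesis
      using update_top[of "Add k"] by (simp add: u infinity_ennreal_def del: update.simps)
  qed
qed

text \<open>An entry \<open>(q, b)\<close> of a table says that energy \<open>b\<close> suffices in state \<open>q\<close>.\<close>

type_synonym 's table = "('s \<times> num_bits) list"

definition sat :: "'s table \<Rightarrow> 's \<Rightarrow> ennreal \<Rightarrow> bool" where
  "sat R q x \<longleftrightarrow> (\<exists>b. (q, b) \<in> set R \<and> of_nat (nval b) \<le> x)"

definition look_up :: "'s table \<Rightarrow> 's \<Rightarrow> num_bits option" where
  "look_up R q = fold (\<lambda>e acc. if fst e = q
     then (case acc of None \<Rightarrow> Some (snd e) | Some b \<Rightarrow> if le_bits b (snd e) then acc else Some (snd e))
     else acc) R None"

definition backward :: "'s graph \<Rightarrow> 's table \<Rightarrow> 's table" where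
  "backward ts R = concat (map (\<lambda>t. case look_up R (snd (snd t)) of None \<Rightarrow> []
     | Some b \<Rightarrow> [(fst t, before (fst (snd t)) b)]) ts)"

text \<open>\<open>ts\<close> merely counts the rounds. Each round prepends the original
  \<open>R\<close> instead of accumulating tables: shorter runs remain covered, and the length never
  exceeds \<open>length R + length ts\<close>.\<close>

definition rounds :: "'s graph \<Rightarrow> 's table \<Rightarrow> 's table" where
  "rounds ts R = fold (\<lambda>_ R'. R @ backward ts R') ts R"

definition zero_entry :: "'s table \<Rightarrow> 's \<Rightarrow> bool" where
  "zero_entry R q = list_ex (\<lambda>e. fst e = q \<and> le_bits (snd e) []) R"

definition has_entry :: "'s table \<Rightarrow> 's \<Rightarrow> bool" where
  "has_entry R q = list_ex (\<lambda>e. fst e = q) R"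

text \<open>States on a cycle that gains energy get an entry 0: from there, any energy can be reached.\<close>

definition gaining :: "'s graph \<Rightarrow> 's table \<Rightarrow> 's table" where
  "gaining ts R = map (\<lambda>s. (s, [])) (filter (\<lambda>s. has_entry (rounds ts R) s \<and>
     zero_entry (rounds ts [(s, [True])]) s) (map fst ts))"

definition credit :: "'s graph \<Rightarrow> 's table \<Rightarrow> 's table" where
  "credit ts R = rounds ts (R @ gaining ts R)"

lemma sat_mono: "sat R q x \<Longrightarrow> x \<le> y \<Longrightarrow> sat R q y"
  unfolding sat_def by (meson order_trans)

lemma sat_append: "sat (R @ R') q x \<longleftrightarrow> sat R q x \<or> sat R' q x"
  by (auto simp: sat_def)

lemma sat_zero: "sat R q 0 \<longleftrightarrow> zero_entry R q"
  by (force simp: sat_def zero_entry_def list_ex_iff)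

text \<open>With infinite energy every entry counts, so this question about a table is reachability
  in the bare graph.\<close>

lemma sat_top: "sat R q \<infinity> \<longleftrightarrow> has_entry R q"
  by (force simp: sat_def has_entry_def list_ex_iff)

lemma sat_look_up: "sat R q x \<longleftrightarrow> (\<exists>b. look_up R q = Some b \<and> of_nat (nval b) \<le> x)"
proof -
  have *: "(\<exists>b. fold (\<lambda>e acc. if fst e = q
     then (case acc of None \<Rightarrow> Some (snd e) | Some b \<Rightarrow> if le_bits b (snd e) then acc else Some (snd e))
     else acc) R acc = Some b \<and> of_nat (nval b) \<le> x) \<longleftrightarrow>
     sat R q x \<or> (\<exists>b. acc = Some b \<and> of_nat (nval b) \<le> x)" for acc
  proof (induction R arbitrary: acc)
    case Nil
    then show ?case by (auto simp: sat_def)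
  next
    case (Cons e R)
    have "sat (e # R) q x \<longleftrightarrow> (fst e = q \<and> of_nat (nval (snd e)) \<le> x) \<or> sat R q x"
      by (cases e) (auto simp: sat_def)
    moreover have le: "of_nat (nval b) \<le> x" if "nval b \<le> nval b'" "of_nat (nval b') \<le> x" for b b' :: num_bits
      using that by (meson of_nat_mono order_trans)
    have "(\<exists>b. (case acc of None \<Rightarrow> Some (snd e) | Some b \<Rightarrow> if le_bits b (snd e) then acc else Some (snd e)) = Some b
        \<and> of_nat (nval b) \<le> x) \<longleftrightarrow> of_nat (nval (snd e)) \<le> x \<or> (\<exists>b. acc = Some b \<and> of_nat (nval b) \<le> x)"
    proof (cases acc)
      case (Some b)
      then show ?thesis
        using le[of b "snd e"] le[of "snd e" b] by (auto simp: not_le dest: less_imp_le)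
    qed simp
    ultimately show ?case
      unfolding fold_simps Cons.IH by (cases "fst e = q") auto
  qed
  show ?thesis
    unfolding look_up_def using *[of None] by simp
qed

lemma sat_backward: "sat (backward ts R) q x \<longleftrightarrow> (\<exists>q' y. estep (edges ts) (q, x) (q', y) \<and> sat R q' y)"
proof -
  have *: "set (case v of None \<Rightarrow> [] | Some b \<Rightarrow> [g b]) = {z. \<exists>b. v = Some b \<and> z = g b}"
    for v and g :: "num_bits \<Rightarrow> 'a \<times> num_bits"
    by (cases v) auto
  have "sat (backward ts R) q x \<longleftrightarrow>
     (\<exists>t\<in>set ts. fst t = q \<and> (\<exists>b. look_up R (snd (snd t)) = Some b \<and> of_nat (nval (before (fst (snd t)) b)) \<le> x))"
    unfolding sat_def backward_def set_concat set_map image_image * by auto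
  also have "\<dots> \<longleftrightarrow> (\<exists>t\<in>set ts. fst t = q \<and> (\<exists>y. update (weight_code (fst (snd t))) (Some x) = Some y \<and> sat R (snd (snd t)) y))"
    unfolding sat_look_up before[symmetric] by blast
  also have "\<dots> \<longleftrightarrow> (\<exists>q' y. estep (edges ts) (q, x) (q', y) \<and> sat R q' y)"
    unfolding estep_def edges_def image_iff by (auto simp: Bex_def)
  finally show ?thesis .
qed

lemma relpowp_Suc_right_iff: "(R ^^ Suc n) x z \<longleftrightarrow> (\<exists>y. R x y \<and> (R ^^ n) y z)"
  by (auto simp del: relpowp.simps elim: relpowp_Suc_E2 intro: relpowp_Suc_I2)

lemma sat_rounds:
  "sat (rounds ts R) q x \<longleftrightarrow>
     (\<exists>j \<le> length ts. \<exists>q' y. steps (edges ts) j (q, x) (q', y) \<and> sat R q' y)"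
proof -
  have "fold (\<lambda>_. F) xs = F ^^ length xs" for F :: "'a table \<Rightarrow> 'a table" and xs :: "('a \<times> weight \<times> 'a) list"
    by (induction xs) (simp_all add: funpow_swap1 fun_eq_iff)
  then have r: "rounds ts R = ((\<lambda>R'. R @ backward ts R') ^^ length ts) R"
    by (simp add: rounds_def)
  have "sat (((\<lambda>R'. R @ backward ts R') ^^ n) R) q x \<longleftrightarrow>
     (\<exists>j \<le> n. \<exists>q' y. steps (edges ts) j (q, x) (q', y) \<and> sat R q' y)" for n
  proof (induction n arbitrary: q x)
    case (Suc n)
    have "sat (((\<lambda>R'. R @ backward ts R') ^^ Suc n) R) q x \<longleftrightarrow> sat R q x \<or>
       (\<exists>p z. estep (edges ts) (q, x) (p, z) \<and> (\<exists>j \<le> n. \<exists>q' y. steps (edges ts) j (p, z) (q', y) \<and> sat R q' y))"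
      by (simp add: sat_append sat_backward Suc.IH)
    also have "\<dots> \<longleftrightarrow> sat R q x \<or> (\<exists>j \<le> n. \<exists>q' y. steps (edges ts) (Suc j) (q, x) (q', y) \<and> sat R q' y)"
      unfolding relpowp_Suc_right_iff by (simp only: split_paired_Ex) blast
    also have "\<dots> \<longleftrightarrow> (\<exists>j \<le> Suc n. \<exists>q' y. steps (edges ts) j (q, x) (q', y) \<and> sat R q' y)"
    proof -
      have "(\<exists>j \<le> Suc n. P j) \<longleftrightarrow> P 0 \<or> (\<exists>j \<le> n. P (Suc j))" for P :: "nat \<Rightarrow> bool"
        using Ex_less_Suc2[of "Suc n" P] by (simp only: less_Suc_eq_le)
      then show ?thesis by simp
    qed
    finally show ?case .
  qed simp
  then show ?thesis unfolding r .
qed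

lemma card_targets: "card (snd ` snd ` set ts) \<le> length ts"
  by (metis card_image_le card_length finite_imageI finite_set le_trans)

lemma estep_target: "estep (edges ts) g g' \<Longrightarrow> fst g' \<in> snd ` snd ` set ts"
  unfolding estep_def edges_def by force

text \<open>
  Remove cycles from a run until it is short. Only cycles that gain energy cannot be removed, but
  then the run can be stopped at a point where the target table has a gaining entry.
\<close>

lemma short_run:
  assumes "steps (edges ts) n (q, x) (q', y)" "sat R q' y"
    and "x = \<infinity> \<or> (\<forall>s d z p u. 0 < d \<longrightarrow> d \<le> length ts \<longrightarrow> steps (edges ts) d (s, 0) (s, z) \<longrightarrow> z > 0 \<longrightarrow>
       reaches (edges ts) (s, \<infinity>) (p, u) \<longrightarrow> sat R p u \<longrightarrow> sat R s 0)"
  shows "sat (rounds ts R) q x"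
  using assms(1,2)
proof (induction n arbitrary: q' y rule: less_induct)
  case (less n)
  show ?case
  proof (cases "n \<le> length ts")
    case True
    then show ?thesis
      unfolding sat_rounds using less.prems by (intro exI[of _ n] conjI exI[of _ q'] exI[of _ y])
  next
    case False
    obtain f where f: "f 0 = (q, x)" "f n = (q', y)" "\<And>i. i < n \<Longrightarrow> estep (edges ts) (f i) (f (Suc i))"
      using less.prems(1) unfolding relpowp_fun_conv by blast
    have tgt: "fst (f i) \<in> snd ` snd ` set ts" if "0 < i" "i \<le> n" for i
      using estep_target[OF f(3)[of "i - 1"]] that by simp
    \<comment> \<open>Time 0 is left out: only states that are entered are targets of edges, of
      which there are at most \<open>length ts\<close>.\<close>
    define rep where "rep d \<longleftrightarrow> 0 < d \<and> (\<exists>i > 0. i + d \<le> n \<and> fst (f i) = fst (f (i + d)))" for d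
    have pigeon: "\<exists>d. rep d \<and> d < m"
      if "\<And>i. i < m \<Longrightarrow> 0 < j + i \<and> j + i \<le> n" "length ts < m" for j m
    proof -
      have "(\<lambda>i. fst (f (j + i))) ` {..<m} \<subseteq> snd ` snd ` set ts"
        using tgt that(1) by auto
      then have "card ((\<lambda>i. fst (f (j + i))) ` {..<m}) \<le> length ts"
        using card_targets[of ts] by (meson card_mono finite_imageI finite_set le_trans)
      then have "\<not> inj_on (\<lambda>i. fst (f (j + i))) {..<m}"
        using that(2) by (auto dest: card_image)
      then obtain a b where "a < b" "b < m" "fst (f (j + a)) = fst (f (j + b))"
        unfolding inj_on_def by (metis lessThan_iff linorder_neqE_nat)
      then show ?thesis
        using that(1)[of a] that(1)[of b] unfolding rep_def
        by (intro exI[of _ "b - a"] conjI exI[of _ "j + a"]) auto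
    qed
    have "\<exists>d. rep d"
      using pigeon[of n 1] False by auto
    \<comment> \<open>For the shortest repetition, more than \<open>length ts\<close> times within
      one round would contain a shorter one. Hence the cycle is short enough to be visible to the
      rounds in \<open>gaining\<close>.\<close>
    define d where "d = (LEAST d. rep d)"
    have "rep d"
      unfolding d_def using \<open>\<exists>d. rep d\<close> by (rule LeastI_ex)
    then obtain i where i: "0 < d" "0 < i" "i + d \<le> n" "fst (f i) = fst (f (i + d))"
      unfolding rep_def by blast
    have d: "d \<le> length ts"
    proof (rule ccontr)
      assume "\<not> d \<le> length ts"
      then obtain d' where "rep d'" "d' < d"
        using pigeon[of d "Suc i"] i by auto
      then show False
        unfolding d_def using not_less_Least by blast
    qed
    have path: "steps (edges ts) (l - k) (f k) (f l)" if "k \<le> l" "l \<le> n" for k l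
      using that f(3) by (intro relpowp_path) auto
    show ?thesis
    proof (cases "snd (f (i + d)) \<le> snd (f i)")
      case True
      \<comment> \<open>A cycle without gain is skipped; the rest of the run then starts with at
        least as much energy.\<close>
      have "steps (edges ts) (n - (i + d)) (fst (f i), snd (f (i + d))) (q', y)"
        using path[of "i + d" n] i f(2) by simp
      then obtain y' where y': "y \<le> y'" "steps (edges ts) (n - (i + d)) (f i) (q', y')"
        using steps_mono True by (metis prod.collapse)
      have "steps (edges ts) i (q, x) (f i)"
        using path[of 0 i] i f(1) by simp
      from relpowp_trans[OF this y'(2)] show ?thesis
        using i less.prems(2) y'(1) by (intro less.IH[of "i + (n - (i + d))" q' y']) (auto intro: sat_mono)
    next
      case False
      have c1: "(fst (f i), snd (f i)) = f i" and c2: "(fst (f i), snd (f (i + d))) = f (i + d)"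
        by (rule prod.collapse) (use i(4) in simp)
      have cyc: "steps (edges ts) d (fst (f i), snd (f i)) (fst (f i), snd (f (i + d)))"
        unfolding c1 c2 using path[of i "i + d"] i(3) by simp
      have fin: "snd (f i) \<noteq> \<infinity>"
        using False by (auto simp: infinity_ennreal_def)
      have pre: "steps (edges ts) i (q, x) (fst (f i), snd (f i))"
        unfolding c1 using path[of 0 i] i(3) f(1) by simp
      \<comment> \<open>A gain presupposes finite energy before it, and infinite energy is never
        lost.\<close>
      have "x \<noteq> \<infinity>"
        using steps_top[of i "edges ts" q "fst (f i)" "snd (f i)"] pre fin by blast
      obtain s m a b w \<delta> where r: "a > 0" "a + b = d" "steps (edges ts) b (fst (f i), snd (f i)) (s, m)"
        "steps (edges ts) a (s, m) (fst (f i), snd (f (i + d)))"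
        "steps (edges ts) a (s, 0) (fst (f i), w)" "steps (edges ts) b (fst (f i), w) (s, \<delta>)" "0 < \<delta>"
        using rotate_cycle[OF cyc _ fin i(1)] False by (metis linorder_not_le order_less_imp_le)
      have 1: "steps (edges ts) d (s, 0) (s, \<delta>)"
        using relpowp_trans[OF r(5,6)] r(2) by simp
      have 2: "steps (edges ts) (i + b) (q, x) (s, m)"
        by (rule relpowp_trans[OF pre r(3)])
      have "(estep (edges ts) ^^ (a + (n - (i + d)))) (s, m) (q', y)"
        by (rule relpowp_trans[OF r(4)]) (use path[of "i + d" n] i(3) f(2) c2 in simp)
      then obtain y' where "y \<le> y'" "(estep (edges ts) ^^ (a + (n - (i + d)))) (s, \<infinity>) (q', y')"
        using steps_mono by (metis infinity_ennreal_def top_greatest)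
      \<comment> \<open>The old target is still reachable from the lowest point \<open>s\<close>
        with infinite energy, so the hypothesis provides a zero entry. The run can now end at
        \<open>s\<close>, after \<open>i + b < n\<close> steps because \<open>a > 0\<close>.\<close>
      then have "sat R s 0"
        using assms(3) \<open>x \<noteq> \<infinity>\<close> 1 r(7) i(1) d sat_mono[OF less.prems(2)] relpowp_imp_rtranclp by meson
      then have "sat R s m"
        by (rule sat_mono) simp
      with 2 show ?thesis
        using r(1,2) i by (intro less.IH[of "i + b" s m]) auto
    qed
  qed
qed

text \<open>Soundness is pumping: at a gaining state any energy demanded by an entry of
  \<open>rounds ts R\<close> can be accumulated. For completeness, \<open>short_run\<close> is
  applied with \<open>R @ gaining ts R\<close> as the target, and its hypothesis holds because
  \<open>gaining\<close> detects every short gaining cycle from which \<open>R\<close> can be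
  reached.\<close>

theorem sat_credit:
  "sat (credit ts R) q x \<longleftrightarrow> (\<exists>q' y. reaches (edges ts) (q, x) (q', y) \<and> sat R q' y)"
proof
  assume "sat (credit ts R) q x"
  then obtain q' y where r: "reaches (edges ts) (q, x) (q', y)" "sat R q' y \<or> sat (gaining ts R) q' y"
    unfolding credit_def sat_rounds sat_append by (meson relpowp_imp_rtranclp)
  show "\<exists>q' y. reaches (edges ts) (q, x) (q', y) \<and> sat R q' y"
  proof (cases "sat R q' y")
    case False
    then have h: "has_entry (rounds ts R) q'" and z: "zero_entry (rounds ts [(q', [True])]) q'"
      using r(2) by (auto simp: sat_def gaining_def)
    obtain j p u where "steps (edges ts) j (q', 0) (p, u)" "sat [(q', [True])] p u"
      using z unfolding sat_zero[symmetric] sat_rounds by blast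
    then have pos: "reaches (edges ts) (q', 0) (q', u)" "1 \<le> u"
      by (auto simp: sat_def intro: relpowp_imp_rtranclp)
    \<comment> \<open>Each round of the cycle, shifted up by the energy collected so far, adds
      \<open>u \<ge> 1\<close>.\<close>
    have pump: "\<exists>v \<ge> of_nat n. reaches (edges ts) (q', y) (q', v)" for n
    proof (induction n)
      case (Suc n)
      then obtain v where v: "of_nat n \<le> v" "reaches (edges ts) (q', y) (q', v)"
        by blast
      obtain k where "steps (edges ts) k (q', 0) (q', u)"
        using rtranclp_imp_relpowp[OF pos(1)] by blast
      from steps_shift[OF this, of v] have "reaches (edges ts) (q', v) (q', u + v)"
        by (auto intro: relpowp_imp_rtranclp)
      moreover have "of_nat (Suc n) \<le> u + v"
        using pos(2) v(1) by (simp add: add_mono)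
      ultimately show ?case
        using v(2) by (meson rtranclp_trans)
    qed auto
    obtain b where b: "(q', b) \<in> set (rounds ts R)"
      using h by (auto simp: has_entry_def list_ex_iff)
    obtain v where v: "of_nat (nval b) \<le> v" "reaches (edges ts) (q', y) (q', v)"
      using pump by blast
    then have "sat (rounds ts R) q' v"
      using b by (auto simp: sat_def)
    then obtain p' u' where "reaches (edges ts) (q', v) (p', u')" "sat R p' u'"
      unfolding sat_rounds by (meson relpowp_imp_rtranclp)
    then show ?thesis
      using r(1) v(2) by (meson rtranclp_trans)
  qed (use r in blast)
next
  assume "\<exists>q' y. reaches (edges ts) (q, x) (q', y) \<and> sat R q' y"
  then obtain n q' y where run: "steps (edges ts) n (q, x) (q', y)" and sat: "sat (R @ gaining ts R) q' y"
    using rtranclp_imp_relpowp unfolding sat_append by meson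
  show "sat (credit ts R) q x"
    unfolding credit_def
  proof (rule short_run[OF run sat], rule disjI2, intro allI impI)
    fix s d z p u
    assume d: "0 < d" "d \<le> length ts" and cyc: "steps (edges ts) d (s, 0) (s, z)" "0 < z"
      and reach: "reaches (edges ts) (s, \<infinity>) (p, u)" "sat (R @ gaining ts R) p u"
    \<comment> \<open>With infinite energy every repetition can be cut out, so reachability is
      decided by plain rounds; this is why \<open>gaining\<close> can use them before any credit is
      available.\<close>
    have top: "has_entry (rounds ts R) s'" if h: "reaches (edges ts) (s', \<infinity>) (p', u')" "sat R p' u'" for s' p' u'
    proof -
      obtain n where "steps (edges ts) n (s', \<infinity>) (p', u')"
        using rtranclp_imp_relpowp[OF h(1)] by blast
      from short_run[OF this h(2)] show ?thesis
        unfolding sat_top by blast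
    qed
    have u: "u = \<infinity>"
      using reach(1) steps_top rtranclp_imp_relpowp by metis
    have "has_entry (rounds ts R) s"
    proof (cases "sat R p u")
      case True
      then show ?thesis using top reach(1) by blast
    next
      case False
      \<comment> \<open>A run that ends at a gaining state can be continued to \<open>R\<close>,
        since \<open>gaining\<close> only admits states with an entry in
        \<open>rounds ts R\<close>.\<close>
      then have "has_entry (rounds ts R) p"
        using reach(2) by (auto simp: sat_append sat_def gaining_def)
      then obtain p' u' where "reaches (edges ts) (p, \<infinity>) (p', u')" "sat R p' u'"
        unfolding sat_top[symmetric] sat_rounds by (meson relpowp_imp_rtranclp)
      then show ?thesis
        using top reach(1) u by (meson rtranclp_trans)
    qed
    moreover have "1 \<le> z"
    proof -
      have "z = \<infinity> \<or> (\<exists>m. z = of_nat m)"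
        using steps_nat[of d "edges ts" s 0] cyc(1) by simp
      then show ?thesis
        using cyc(2) by (auto simp: infinity_ennreal_def)
    qed
    then have "sat [(s, [True])] s z"
      by (simp add: sat_def)
    then have "zero_entry (rounds ts [(s, [True])]) s"
      unfolding sat_zero[symmetric] sat_rounds using d cyc(1) by blast
    moreover have "s \<in> set (map fst ts)"
    proof -
      obtain g where "estep (edges ts) (s, 0) g"
        using cyc(1) d(1) by (metis relpowp_E2 not_gr_zero)
      then show ?thesis
        by (auto simp: estep_def edges_def)
    qed
    ultimately have "(s, []) \<in> set (gaining ts R)"
      by (auto simp: gaining_def)
    then show "sat (R @ gaining ts R) s 0"
      unfolding sat_append sat_def by fastforce
  qed
qed

section \<open>Reachability and Buchi acceptance\<close>

definition zeros :: "'s list \<Rightarrow> 's table" where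
  "zeros qs = map (\<lambda>q. (q, [])) qs"

definition reach_table :: "'s graph \<Rightarrow> 's list \<Rightarrow> 's table" where
  "reach_table ts fs = credit ts (zeros fs)"

text \<open>From inside out: energies sufficient to reach \<open>s\<close>, restricted to accepting
  states; energies sufficient to reach such a state with what it demands; one step back, which makes
  the cycle nonempty. A cycle that can start with energy 0 cannot lose, so the zero entry is the
  whole test.\<close>

definition recurrent :: "'s graph \<Rightarrow> 's list \<Rightarrow> 's list" where
  "recurrent ts fs = filter (\<lambda>s. zero_entry (backward ts (credit ts
     (filter (\<lambda>e. list_ex (\<lambda>f. f = fst e) fs) (credit ts (zeros [s]))))) s) (map fst ts)"

text \<open>With infinite energy, every cycle through an accepting state will do.\<close>

definition boosted :: "'s graph \<Rightarrow> 's list \<Rightarrow> 's list" where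
  "boosted ts fs = (let R = credit ts (zeros (filter (\<lambda>f. has_entry (backward ts (credit ts (zeros [f]))) f) fs))
     in map fst (filter (\<lambda>t. fst (snd t) = None \<and> has_entry R (snd (snd t))) ts))"

definition buchi_table :: "'s graph \<Rightarrow> 's list \<Rightarrow> 's table" where
  "buchi_table ts fs = credit ts (zeros (recurrent ts fs @ boosted ts fs))"

definition lasso :: "('s \<times> update_code \<times> 's) set \<Rightarrow> 's set \<Rightarrow> 's \<Rightarrow> ennreal \<Rightarrow> bool" where
  "lasso E F q x \<longleftrightarrow> (\<exists>f\<in>F. \<exists>e e'. reaches E (q, x) (f, e) \<and> reaches1 E (f, e) (f, e') \<and> e \<le> e')"

lemma sat_zeros [simp]: "sat (zeros qs) q x \<longleftrightarrow> q \<in> set qs"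
  by (auto simp: sat_def zeros_def)

lemma sat_filter_fst: "sat (filter (\<lambda>e. P (fst e)) R) q x \<longleftrightarrow> P q \<and> sat R q x"
  by (auto simp: sat_def)

lemma sat_reach_table:
  "sat (reach_table ts fs) q x \<longleftrightarrow> (\<exists>f\<in>set fs. \<exists>y. reaches (edges ts) (q, x) (f, y))"
  unfolding reach_table_def sat_credit by auto

text \<open>The additional \<open>backward\<close> enforces at least one step, as needed for
  cycles.\<close>

lemma sat_backward_credit:
  "sat (backward ts (credit ts R)) q x \<longleftrightarrow> (\<exists>q' y. reaches1 (edges ts) (q, x) (q', y) \<and> sat R q' y)"
proof -
  have "(\<exists>p z. estep (edges ts) (q, x) (p, z) \<and> (\<exists>q' y. reaches (edges ts) (p, z) (q', y) \<and> sat R q' y))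
      \<longleftrightarrow> (\<exists>q' y. reaches1 (edges ts) (q, x) (q', y) \<and> sat R q' y)"
    unfolding tranclp_unfold_left relcompp_apply by (simp only: split_paired_Ex) blast
  then show ?thesis
    unfolding sat_backward sat_credit .
qed

lemma estep_source: "reaches1 (edges ts) (q, x) g \<Longrightarrow> q \<in> set (map fst ts)"
  by (auto dest!: tranclpD simp: estep_def edges_def)

lemma recurrent:
  "s \<in> set (recurrent ts fs) \<longleftrightarrow>
     (\<exists>f\<in>set fs. \<exists>y z. reaches1 (edges ts) (s, 0) (f, y) \<and> reaches (edges ts) (f, y) (s, z))"
proof -
  have "sat (backward ts (credit ts (filter (\<lambda>e. list_ex (\<lambda>f. f = fst e) fs) (credit ts (zeros [s]))))) s 0 \<longleftrightarrow>
     (\<exists>f\<in>set fs. \<exists>y z. reaches1 (edges ts) (s, 0) (f, y) \<and> reaches (edges ts) (f, y) (s, z))"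
    unfolding sat_backward_credit sat_filter_fst[where P = "\<lambda>q. list_ex (\<lambda>f. f = q) fs"] sat_credit
    by (auto simp: list_ex_iff)
  then show ?thesis
    unfolding recurrent_def sat_zero by (auto dest: estep_source[simplified])
qed

lemma reach_top:
  assumes "reaches E (q, x) (q', y)"
  shows "reaches E (q, \<infinity>) (q', \<infinity>)"
proof -
  obtain y' where "reaches E (q, \<infinity>) (q', y')"
    using reach_mono[OF assms, of \<infinity>] by (auto simp: infinity_ennreal_def)
  moreover from this have "y' = \<infinity>"
    using steps_top rtranclp_imp_relpowp by metis
  ultimately show ?thesis by simp
qed

lemma boosted:
  "s \<in> set (boosted ts fs) \<longleftrightarrow> (\<exists>f\<in>set fs. \<exists>v e. (s, Add_Infinity, v) \<in> edges ts \<and>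
     reaches (edges ts) (v, \<infinity>) (f, \<infinity>) \<and> reaches1 (edges ts) (f, \<infinity>) (f, e))"
proof -
  define cs where "cs = filter (\<lambda>f. has_entry (backward ts (credit ts (zeros [f]))) f) fs"
  have cs: "f \<in> set cs \<longleftrightarrow> f \<in> set fs \<and> (\<exists>e. reaches1 (edges ts) (f, \<infinity>) (f, e))" for f
    unfolding cs_def sat_top[symmetric] by (simp add: sat_backward_credit del: infinity_ennreal_def)
  have w: "w = None \<longleftrightarrow> weight_code w = Add_Infinity" for w
    by (auto simp: weight_code_def split: option.splits)
  have e: "(s, Add_Infinity, v) \<in> edges ts \<longleftrightarrow>
      (\<exists>t\<in>set ts. fst t = s \<and> weight_code (fst (snd t)) = Add_Infinity \<and> snd (snd t) = v)" for v
    unfolding edges_def image_iff by (rule bex_cong) auto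
  have "has_entry (credit ts (zeros cs)) v \<longleftrightarrow> (\<exists>f\<in>set cs. reaches (edges ts) (v, \<infinity>) (f, \<infinity>))" for v
    unfolding sat_top[symmetric] sat_credit using reach_top by fastforce
  then have "s \<in> set (boosted ts fs) \<longleftrightarrow>
      (\<exists>t\<in>set ts. fst t = s \<and> fst (snd t) = None \<and> (\<exists>f\<in>set cs. reaches (edges ts) (snd (snd t), \<infinity>) (f, \<infinity>)))"
    unfolding boosted_def Let_def cs_def[symmetric] by auto
  also have "\<dots> \<longleftrightarrow> (\<exists>v. (s, Add_Infinity, v) \<in> edges ts \<and> (\<exists>f\<in>set cs. reaches (edges ts) (v, \<infinity>) (f, \<infinity>)))"
    unfolding e w by blast
  finally show ?thesis
    unfolding Bex_def cs by blast
qed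

text \<open>Adding an integer to a finite energy keeps it finite, so the first infinite energy is
  due to an \<open>Add_Infinity\<close> edge.\<close>

lemma reach_infinity:
  assumes "reaches E (q, x) g" "snd g = \<infinity>" "x \<noteq> \<infinity>"
  shows "\<exists>s m v. reaches E (q, x) (s, m) \<and> (s, Add_Infinity, v) \<in> E \<and> reaches E (v, \<infinity>) g"
  using assms(1,2)
proof (induction rule: rtranclp_induct)
  case base
  then show ?case using assms(3) by simp
next
  case (step g g')
  show ?case
  proof (cases "snd g = \<infinity>")
    case True
    then show ?thesis
      using step by (meson rtranclp.rtrancl_into_rtrancl)
  next
    case False
    obtain u where u: "(fst g, u, fst g') \<in> E" "update u (Some (snd g)) = Some (snd g')"
      using step.hyps(2) unfolding estep_def by blast
    have "u = Add_Infinity"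
    proof (cases u)
      case (Add k)
      obtain r where "snd g = ennreal r" "0 \<le> r"
        using False by (metis ennreal_cases infinity_ennreal_def)
      then show ?thesis
        using u(2) step.prems by (auto simp: Add update_Add_ennreal simp del: update.simps split: if_splits)
    qed simp
    moreover have "reaches E (q, x) (fst g, snd g)"
      using step.hyps(1) by simp
    moreover have "reaches E (fst g', \<infinity>) g'"
      unfolding step.prems[symmetric] by simp
    ultimately show ?thesis
      using u(1) by blast
  qed
qed

text \<open>A lasso with finite energy at its accepting state is rotated to its lowest point, which
  is in \<open>recurrent\<close>. One with infinite energy has passed an \<open>Add_Infinity\<close>
  edge, because \<open>x\<close> is finite, and the source of that edge is in
  \<open>boosted\<close>.\<close>

theorem sat_buchi_table:
  assumes "x \<noteq> \<infinity>"
  shows "sat (buchi_table ts fs) q x \<longleftrightarrow> lasso (edges ts) (set fs) q x"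
proof
  let ?E = "edges ts"
  assume "sat (buchi_table ts fs) q x"
  then obtain s y where s: "reaches ?E (q, x) (s, y)" "s \<in> set (recurrent ts fs) \<or> s \<in> set (boosted ts fs)"
    unfolding buchi_table_def sat_credit sat_zeros by auto
  from s(2) show "lasso ?E (set fs) q x"
  proof
    assume "s \<in> set (recurrent ts fs)"
    then obtain f a z where f: "f \<in> set fs" "reaches1 ?E (s, 0) (f, a)" "reaches ?E (f, a) (s, z)"
      unfolding recurrent by blast
    obtain n where n: "n > 0" "steps ?E n (s, 0) (f, a)"
      using f(2) unfolding tranclp_power by blast
    obtain m where m: "steps ?E m (f, a) (s, z)"
      using rtranclp_imp_relpowp[OF f(3)] by blast
    have 1: "steps ?E n (s, y) (f, a + y)"
      using steps_shift[OF n(2), of y] by simp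
    have 2: "steps ?E m (f, a + y) (s, z + y)"
      using steps_shift[OF m] .
    \<comment> \<open>The cycle is known at \<open>s\<close>, but a lasso must close at
      \<open>f\<close>: going on from \<open>s\<close> once more returns to \<open>f\<close>, with
      the surplus \<open>z\<close>.\<close>
    have 3: "steps ?E n (s, z + y) (f, a + (z + y))"
      using steps_shift[OF n(2), of "z + y"] by simp
    have "reaches1 ?E (f, a + y) (f, a + (z + y))"
      using relpowp_trans[OF 2 3] n(1) unfolding tranclp_power by blast
    moreover have "reaches ?E (q, x) (f, a + y)"
      using s(1) relpowp_imp_rtranclp[OF 1] by (rule rtranclp_trans)
    moreover have "a + y \<le> a + (z + y)"
      by (intro add_left_mono) simp
    ultimately show ?thesis
      unfolding lasso_def using f(1) by blast
  next
    assume "s \<in> set (boosted ts fs)"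
    then obtain f v e where f: "f \<in> set fs" "(s, Add_Infinity, v) \<in> ?E" "reaches ?E (v, \<infinity>) (f, \<infinity>)"
      "reaches1 ?E (f, \<infinity>) (f, e)"
      unfolding boosted by blast
    have "estep ?E (s, y) (v, \<infinity>)"
      using f(2) unfolding estep_def by (intro exI[of _ Add_Infinity]) simp
    then have "reaches ?E (q, x) (f, \<infinity>)"
      using s(1) f(3) by (meson converse_rtranclp_into_rtranclp rtranclp_trans)
    moreover have "e = \<infinity>"
      using f(4) steps_top unfolding tranclp_power by metis
    ultimately show ?thesis
      unfolding lasso_def using f(1,4) by blast
  qed
next
  let ?E = "edges ts"
  assume "lasso ?E (set fs) q x"
  then obtain f e e' where f: "f \<in> set fs" "reaches ?E (q, x) (f, e)" "reaches1 ?E (f, e) (f, e')" "e \<le> e'"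
    unfolding lasso_def by blast
  have "\<exists>s m. reaches ?E (q, x) (s, m) \<and> (s \<in> set (recurrent ts fs) \<or> s \<in> set (boosted ts fs))"
  proof (cases "e = \<infinity>")
    case False
    obtain d where d: "d > 0" "steps ?E d (f, e) (f, e')"
      using f(3) unfolding tranclp_power by blast
    obtain s m a b w \<delta> where r: "a > 0" "a + b = d" "steps ?E b (f, e) (s, m)"
      "steps ?E a (s, m) (f, e')" "steps ?E a (s, 0) (f, w)" "steps ?E b (f, w) (s, \<delta>)"
      by (rule rotate_cycle[OF d(2) f(4) False d(1)]) blast
    have "reaches1 ?E (s, 0) (f, w)"
      using r(1,5) unfolding tranclp_power by blast
    then have "s \<in> set (recurrent ts fs)"
      unfolding recurrent using f(1) relpowp_imp_rtranclp[OF r(6)] by blast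
    moreover have "reaches ?E (q, x) (s, m)"
      using f(2) relpowp_imp_rtranclp[OF r(3)] by (rule rtranclp_trans)
    ultimately show ?thesis by blast
  next
    case True
    obtain s m v where s: "reaches ?E (q, x) (s, m)" "(s, Add_Infinity, v) \<in> ?E" "reaches ?E (v, \<infinity>) (f, e)"
      using reach_infinity[OF f(2) _ assms] True by auto
    then have "s \<in> set (boosted ts fs)"
      unfolding boosted using f(1,3) True by blast
    then show ?thesis using s(1) by blast
  qed
  then show "sat (buchi_table ts fs) q x"
    unfolding buchi_table_def sat_credit sat_zeros by auto
qed

section \<open>Infinite runs\<close>

text \<open>Real energies are not well-ordered, but finite energies on one run differ by integers.
  So among the visits to an accepting state that recurs, one with least integer part is chosen; a
  lower energy at a later visit would have a smaller integer part.\<close>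

lemma lasso_if_infinite_run:
  assumes run: "\<And>i. estep E (r i) (r (Suc i))" and r0: "r 0 = (q, x)"
    and inf: "infinite {i. fst (r i) \<in> F}" and F: "finite F"
  shows "lasso E F q x"
proof -
  have reach: "steps E (j - i) (r i) (r j)" if "i \<le> j" for i j
    using run that by (intro relpowp_path) auto
  have "{i. fst (r i) \<in> F} = (\<Union>f\<in>F. {i. fst (r i) = f})"
    by auto
  then obtain f where f: "f \<in> F" "infinite {i. fst (r i) = f}"
    using inf F by auto
  have "\<exists>i j. fst (r i) = f \<and> fst (r j) = f \<and> i < j \<and> snd (r i) \<le> snd (r j)"
  proof -
    \<comment> \<open>\<open>enn2real\<close> maps infinity to 0. Integer parts are compared only
      when the later energy is finite, and then so are all energies before it.\<close>
    define m where "m i = nat \<lfloor>enn2real (snd (r i))\<rfloor>" for i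
    obtain i where i: "fst (r i) = f" "\<And>j. fst (r j) = f \<Longrightarrow> m i \<le> m j"
    proof -
      have "{i. fst (r i) = f} \<noteq> {}"
        using f(2) by (metis finite.emptyI)
      then obtain i0 where "fst (r i0) = f"
        by blast
      then show ?thesis
        using that ex_has_least_nat[of "\<lambda>i. fst (r i) = f" i0 m] by blast
    qed
    obtain j where j: "fst (r j) = f" "i < j"
      using f(2) by (metis (mono_tags, lifting) finite_nat_set_iff_bounded_le linorder_not_le mem_Collect_eq)
    show ?thesis
    proof (cases "snd (r i) \<le> snd (r j)")
      case False
      have fin: "snd (r l) \<noteq> \<infinity> \<and> (\<exists>k. enn2real (snd (r j)) = enn2real (snd (r l)) + real_of_int k)" if "l \<le> j" for l
        using that
      proof (induction rule: inc_induct)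
        case base
        have "snd (r j) \<noteq> \<infinity>"
          using False by (auto simp: infinity_ennreal_def)
        then show ?case by (auto intro: exI[of _ 0])
      next
        case (step l)
        then obtain k where k: "enn2real (snd (r j)) = enn2real (snd (r (Suc l))) + real_of_int k" "snd (r (Suc l)) \<noteq> \<infinity>"
          by blast
        obtain u where "update u (Some (snd (r l))) = Some (snd (r (Suc l)))"
          using run[of l] unfolding estep_def by blast
        from update_finite[OF this k(2)] obtain k' where
          "snd (r l) \<noteq> \<infinity>" "enn2real (snd (r (Suc l))) = enn2real (snd (r l)) + real_of_int k'"
          by blast
        then show ?case
          using k(1) by (auto intro!: exI[of _ "k' + k"])
      qed
      obtain k where k: "enn2real (snd (r j)) = enn2real (snd (r i)) + real_of_int k"
        using fin[of i] j(2) by auto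
      have "enn2real (snd (r j)) < enn2real (snd (r i))"
      proof -
        obtain a b where "snd (r i) = ennreal a" "0 \<le> a" "snd (r j) = ennreal b" "0 \<le> b"
          using fin[of i] fin[of j] j(2) by (metis ennreal_cases infinity_ennreal_def less_imp_le order_refl)
        then show ?thesis
          using False by auto
      qed
      then have "k \<le> - 1"
        using k by simp
      then have "\<lfloor>enn2real (snd (r j))\<rfloor> < \<lfloor>enn2real (snd (r i))\<rfloor>"
        unfolding k by simp
      moreover have "0 \<le> \<lfloor>enn2real (snd (r j))\<rfloor>"
        by simp
      ultimately have "m j < m i"
        unfolding m_def by linarith
      then show ?thesis
        using i(2)[OF j(1)] by simp
    qed (use i(1) j in blast)
  qed
  then obtain i j where ij: "fst (r i) = f" "fst (r j) = f" "i < j" "snd (r i) \<le> snd (r j)"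
    by blast
  have ri: "r i = (f, snd (r i))" and rj: "r j = (f, snd (r j))"
    using ij(1,2) by (metis prod.collapse)+
  have "reaches E (q, x) (f, snd (r i))"
    using relpowp_imp_rtranclp[OF reach[of 0 i]] r0 ri by simp
  moreover have "reaches1 E (f, snd (r i)) (f, snd (r j))"
    unfolding ri[symmetric] rj[symmetric] tranclp_power
    using reach[of i j] ij(3) by (intro exI[of _ "j - i"]) simp
  ultimately show ?thesis
    unfolding lasso_def using f(1) ij(4) by blast
qed

lemma infinite_run_if_lasso:
  assumes "lasso E F q x"
  shows "\<exists>r. (\<forall>i. estep E (r i) (r (Suc i))) \<and> r 0 = (q, x) \<and> infinite {i. fst (r i) \<in> F}"
proof -
  obtain f e e' where f: "f \<in> F" "reaches E (q, x) (f, e)" "reaches1 E (f, e) (f, e')" "e \<le> e'"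
    using assms unfolding lasso_def by blast
  obtain d where d: "e' = e + d"
    using f(4) by (auto simp: le_iff_add)
  obtain N p where p: "p 0 = (q, x)" "p N = (f, e)" "\<And>i. i < N \<Longrightarrow> estep E (p i) (p (Suc i))"
    using rtranclp_imp_relpowp[OF f(2)] unfolding relpowp_fun_conv by blast
  obtain n c where c: "n > 0" "c 0 = (f, e)" "c n = (f, e')" "\<And>i. i < n \<Longrightarrow> estep E (c i) (c (Suc i))"
    using f(3) unfolding tranclp_power relpowp_fun_conv by blast
  \<comment> \<open>Endless repetition of the cycle; by the time of round \<open>k div n\<close> it
    has been raised that many times by the gain \<open>d\<close>.\<close>
  define g where "g k = (fst (c (k mod n)), snd (c (k mod n)) + of_nat (k div n) * d)" for k
  define r where "r k = (if k < N then p k else g (k - N))" for k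
  have g0: "g 0 = (f, e)"
    by (simp add: g_def c)
  have shift: "estep E (q1, x1) (q2, x2) \<Longrightarrow> estep E (q1, x1 + v) (q2, x2 + v)" for q1 x1 q2 x2 v
    using update_shift unfolding estep_def by fastforce
  have g: "estep E (g k) (g (Suc k))" for k
  proof (cases "Suc (k mod n) = n")
    case True
    have m: "Suc k mod n = 0" "Suc k div n = Suc (k div n)"
      using True c(1) by (simp_all add: mod_Suc div_Suc)
    have "estep E (c (k mod n)) (c n)"
      using c(4)[of "k mod n"] True by simp
    then have "estep E (fst (c (k mod n)), snd (c (k mod n)) + of_nat (k div n) * d) (f, e' + of_nat (k div n) * d)"
      by (intro shift) (simp add: c(3))
    moreover have "g (Suc k) = (f, e' + of_nat (k div n) * d)"
      by (simp add: g_def m c d algebra_simps)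
    ultimately show ?thesis
      by (simp add: g_def[of k])
  next
    case False
    have m: "Suc k mod n = Suc (k mod n)" "Suc k div n = k div n"
      using False by (simp_all add: mod_Suc div_Suc)
    have "k mod n < n"
      using c(1) by simp
    then have "estep E (c (k mod n)) (c (Suc (k mod n)))"
      by (rule c(4))
    then show ?thesis
      unfolding g_def m by (intro shift) simp
  qed
  have "estep E (r i) (r (Suc i))" for i
  proof -
    consider "Suc i < N" | "Suc i = N" | "N \<le> i" by linarith
    then show ?thesis
    proof cases
      case 1
      then show ?thesis using p(3)[of i] by (simp add: r_def)
    next
      case 2
      then show ?thesis using p(2) p(3)[of i] g0 by (auto simp: r_def)
    next
      case 3
      then show ?thesis using g[of "i - N"] by (simp add: r_def Suc_diff_le)
    qed
  qed
  moreover have "r 0 = (q, x)"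
    using p(1,2) g0 by (auto simp: r_def)
  moreover have "infinite {i. fst (r i) \<in> F}"
  proof (rule infinite_super)
    show "range (\<lambda>k. N + k * n) \<subseteq> {i. fst (r i) \<in> F}"
      using f(1) c(1,2) by (auto simp: r_def g_def)
    show "infinite (range (\<lambda>k. N + k * n))"
      using c(1) by (intro range_inj_infinite) (auto simp: inj_def)
  qed
  ultimately show ?thesis by blast
qed

section \<open>From automata to coded transitions\<close>

lemma global_step_transitions: "global_step (transitions ts) g g' \<longleftrightarrow> estep (set ts) g g'"
proof -
  have "(a, f, b) \<in> transitions ts \<longleftrightarrow> (\<exists>u. f = update u \<and> (a, u, b) \<in> set ts)" for a f b
    by (force simp: transitions_def)
  then show ?thesis
    unfolding global_step_def estep_def by (simp only:) blast
qed

lemma buchi_accepting_lasso: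
  assumes "finite F"
  shows "buchi_accepting (transitions ts) s0 F x0 \<longleftrightarrow> lasso (set ts) F s0 (ennreal x0)"
  unfolding buchi_accepting_def infinite_run_def global_step_transitions
  using lasso_if_infinite_run[OF _ _ _ assms, of "set ts"] infinite_run_if_lasso[of "set ts" F] by blast

lemma reachable_accepting_reach:
  "reachable_accepting (transitions ts) s0 F x0 \<longleftrightarrow>
     (\<exists>f\<in>F. \<exists>y. reaches (set ts) (s0, ennreal x0) (f, y))"
proof
  assume "reachable_accepting (transitions ts) s0 F x0"
  then obtain r where r: "r \<noteq> []" "\<And>i. Suc i < length r \<Longrightarrow> estep (set ts) (r ! i) (r ! Suc i)"
    "hd r = (s0, ennreal x0)" "fst (last r) \<in> F"
    unfolding reachable_accepting_def finite_run_def global_step_transitions by blast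
  have "steps (set ts) (length r - 1 - 0) (r ! 0) (r ! (length r - 1))"
    using r(2) by (intro relpowp_path) auto
  then have "reaches (set ts) (s0, ennreal x0) (fst (last r), snd (last r))"
    using r(1,3) by (auto simp: hd_conv_nth last_conv_nth intro: relpowp_imp_rtranclp)
  then show "\<exists>f\<in>F. \<exists>y. reaches (set ts) (s0, ennreal x0) (f, y)"
    using r(4) by blast
next
  assume "\<exists>f\<in>F. \<exists>y. reaches (set ts) (s0, ennreal x0) (f, y)"
  then obtain f y n p where f: "f \<in> F" and p: "p 0 = (s0, ennreal x0)" "p n = (f, y)"
    "\<And>i. i < n \<Longrightarrow> estep (set ts) (p i) (p (Suc i))"
    unfolding rtranclp_power relpowp_fun_conv by blast
  let ?r = "map p [0..<Suc n]"
  have "finite_run (transitions ts) ?r"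
    unfolding finite_run_def global_step_transitions using p(3) by (auto simp del: upt_Suc)
  moreover have "hd ?r = (s0, ennreal x0)" "last ?r = (f, y)"
    using p by (simp_all add: hd_map hd_upt del: upt_Suc) (simp add: last_map)
  ultimately show "reachable_accepting (transitions ts) s0 F x0"
    unfolding reachable_accepting_def using f by (intro exI[of _ ?r]) simp
qed

text \<open>The algorithm keeps the binary names of states as words and only compares them, so its
  graph is the image of the given one under \<open>encode_nat\<close>.\<close>

abbreviation image_edges :: "('a \<Rightarrow> 'b) \<Rightarrow> ('a \<times> update_code \<times> 'a) set \<Rightarrow> ('b \<times> update_code \<times> 'b) set" where
  "image_edges h E \<equiv> (\<lambda>(p, u, q). (h p, u, h q)) ` E"

context
  fixes h :: "'a \<Rightarrow> 'b" and E :: "('a \<times> update_code \<times> 'a) set"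
  assumes h: "inj h"
begin

lemma estep_image:
  "estep (image_edges h E) (h q, x) g \<longleftrightarrow> (\<exists>q' y. g = (h q', y) \<and> estep E (q, x) (q', y))"
proof -
  have "(h q, u, z) \<in> (\<lambda>(p, u, q). (h p, u, h q)) ` E \<longleftrightarrow> (\<exists>q'. z = h q' \<and> (q, u, q') \<in> E)" for u z
    using h by (force simp: inj_eq)
  then show ?thesis
    unfolding estep_def by (cases g) auto
qed

lemma steps_image:
  "steps (image_edges h E) n (h q, x) g \<longleftrightarrow>
     (\<exists>q' y. g = (h q', y) \<and> steps E n (q, x) (q', y))"
proof (induction n arbitrary: g)
  case (Suc n)
  have "steps (image_edges h E) (Suc n) (h q, x) g \<longleftrightarrow>
      (\<exists>p z. steps E n (q, x) (p, z) \<and> estep (image_edges h E) (h p, z) g)"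
    unfolding relpowp.simps relcompp_apply Suc.IH by blast
  also have "\<dots> \<longleftrightarrow> (\<exists>q' y. g = (h q', y) \<and> steps E (Suc n) (q, x) (q', y))"
    unfolding estep_image by auto
  finally show ?case .
qed auto

lemma reach_image:
  "reaches (image_edges h E) (h q, x) (h q', y) \<longleftrightarrow> reaches E (q, x) (q', y)"
  using h unfolding rtranclp_power steps_image by (auto simp: inj_eq)

lemma lasso_image:
  "lasso (image_edges h E) (h ` F) (h q) x \<longleftrightarrow> lasso E F q x"
proof -
  have "reaches1 (image_edges h E) (h q, x) (h q', y) \<longleftrightarrow> reaches1 E (q, x) (q', y)" for q x q' y
    using h unfolding tranclp_power steps_image by (auto simp: inj_eq)
  then show ?thesis
    unfolding lasso_def by (simp add: reach_image)
qed

end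

section \<open>The algorithm runs in polynomial time\<close>

lemma polytime_tl [polytime_intros]:
  fixes f :: "'a::encodable \<Rightarrow> 'b::encodable list"
  assumes "polytime f"
  shows "polytime (\<lambda>x. tl (f x))"
proof -
  have "polytime (\<lambda>x. case f x of [] \<Rightarrow> [] | a # as \<Rightarrow> as)"
    by (intro polytime_intros assms)
  moreover have "(case l of [] \<Rightarrow> [] | a # as \<Rightarrow> as) = tl l" for l :: "'b list"
    by (cases l) auto
  ultimately show ?thesis by simp
qed

lemma polytime_head_bit [polytime_intros]: "polytime f \<Longrightarrow> polytime (\<lambda>x. head_bit (f x))"
  unfolding head_bit_def by (intro polytime_intros)

lemma polytime_eq_bool [polytime_intros]:
  assumes "polytime f" "polytime g"
  shows "polytime (\<lambda>x. f x = (g x :: bool))"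
proof -
  have "polytime (\<lambda>x. if f x then g x else \<not> g x)"
    by (intro polytime_intros assms)
  moreover have "(\<lambda>x. if f x then g x else \<not> g x) = (\<lambda>x. f x = g x)"
    by auto
  ultimately show ?thesis by (simp only:)
qed

lemma polytime_eq_None [polytime_intros]:
  fixes f :: "'a::encodable \<Rightarrow> 'b::encodable option"
  assumes "polytime f"
  shows "polytime (\<lambda>x. f x = None)"
proof -
  have "polytime (\<lambda>x. case f x of None \<Rightarrow> True | Some _ \<Rightarrow> False)"
    by (intro polytime_intros assms)
  moreover have "(\<lambda>x. case f x of None \<Rightarrow> True | Some _ \<Rightarrow> False) = (\<lambda>x. f x = None)"
    by (auto split: option.split)
  ultimately show ?thesis by (simp only:)
qed

lemma sz_tl: "sz (tl xs) \<le> sz xs"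
  by (cases xs) auto

lemma polytime_serial:
  assumes "polytime (\<lambda>p. carry (fst p) (fst (snd p)) (snd (snd p)))" "polytime f" "polytime g"
  shows "polytime (\<lambda>x. serial carry (f x) (g x))"
proof -
  have carry: "polytime (\<lambda>x. carry (u x) (v x) (w x))" if "polytime u" "polytime v" "polytime w"
    for u v w :: "'x::encodable \<Rightarrow> bool"
    using polytime_comp[OF assms(1) polytime_Pair[OF that(1) polytime_Pair[OF that(2,3)]]] by simp
  have "polytime (\<lambda>p. fold (\<lambda>_ (a, b, c, out).
      (tl a, tl b, carry (head_bit a) (head_bit b) c, ((head_bit a \<noteq> head_bit b) \<noteq> c) # out))
      (fst p @ snd p) (fst p, snd p, False, []))"
  proof (rule polytime_fold_additive[where Q = "\<lambda>_. 10"])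
    fix x :: "num_bits \<times> num_bits" and d and s :: "num_bits \<times> num_bits \<times> bool \<times> num_bits"
    obtain a b c out where s: "s = (a, b, c, out)"
      by (cases s) auto
    show "sz (case s of (a, b, c, out) \<Rightarrow>
        (tl a, tl b, carry (head_bit a) (head_bit b) c, ((head_bit a \<noteq> head_bit b) \<noteq> c) # out)) \<le> sz s + 10"
      unfolding s using sz_tl[of a] sz_tl[of b] sz_bool[of "carry (head_bit a) (head_bit b) c"]
        sz_bool[of "(head_bit a \<noteq> head_bit b) \<noteq> c"] by simp
  qed (intro polytime_intros carry | auto)+
  then have "polytime (\<lambda>p. serial carry (fst p) (snd p))"
    unfolding serial_def by (intro polytime_intros)
  from polytime_comp2[OF this assms(2,3)] show ?thesis .
qed

lemma polytime_add_bits [polytime_intros]: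
  "polytime f \<Longrightarrow> polytime g \<Longrightarrow> polytime (\<lambda>x. add_bits (f x) (g x))"
  unfolding add_bits_def by (intro polytime_intros polytime_serial)

lemma polytime_sub_bits:
  "polytime f \<Longrightarrow> polytime g \<Longrightarrow> polytime (\<lambda>x. sub_bits (f x) (g x))"
  unfolding sub_bits_def by (intro polytime_intros polytime_serial)

lemma polytime_monus_bits [polytime_intros]:
  "polytime f \<Longrightarrow> polytime g \<Longrightarrow> polytime (\<lambda>x. monus_bits (f x) (g x))"
  unfolding monus_bits_def by (intro polytime_intros polytime_sub_bits)

lemma polytime_le_bits [polytime_intros]:
  "polytime f \<Longrightarrow> polytime g \<Longrightarrow> polytime (\<lambda>x. le_bits (f x) (g x))"
  unfolding le_bits_def by (intro polytime_intros polytime_sub_bits)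

lemma polytime_before [polytime_intros]:
  assumes "polytime f" "polytime g"
  shows "polytime (\<lambda>x. before (f x) (g x))"
  unfolding before_def
  by (intro polytime_intros assms polytime_comp[OF assms(1)] polytime_comp[OF assms(2)])

lemma polytime_look_up [polytime_intros]:
  fixes f :: "'a::encodable \<Rightarrow> word table"
  assumes "polytime f" "polytime g"
  shows "polytime (\<lambda>x. look_up (f x) (g x))"
proof -
  have "polytime (\<lambda>p :: word table \<times> word. look_up (fst p) (snd p))"
    unfolding look_up_def
  proof (rule polytime_fold_additive[where Q = "\<lambda>n. n + 2"])
    show "sz (if fst e = snd p then case acc of None \<Rightarrow> Some (snd e)
         | Some b \<Rightarrow> if le_bits b (snd e) then acc else Some (snd e) else acc) \<le> sz acc + (sz p + sz e + 2)"
      for p :: "word table \<times> word" and e :: "word \<times> num_bits" and acc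
      using sz_prod[of e] by (auto split: option.split)
  qed (intro polytime_intros | auto)+
  from polytime_comp2[OF this assms] show ?thesis .
qed

lemma polytime_backward [polytime_intros]:
  fixes f :: "'a::encodable \<Rightarrow> word graph"
  assumes "polytime f" "polytime g"
  shows "polytime (\<lambda>x. backward (f x) (g x))"
  unfolding backward_def
  by (intro polytime_intros assms polytime_comp[OF assms(1)] polytime_comp[OF assms(2)])

section \<open>Size of the tables during the rounds\<close>

lemma length_serial_snd:
  "length (add_bits a b) = length a + length b" "length (monus_bits a b) \<le> length a + length b"
proof -
  show "length (add_bits a b) = length a + length b"
    unfolding add_bits_def
    by (rule serial_invariant(2)[where \<sigma> = 1, OF _ prod.collapse[symmetric]]) (simp split: if_splits)
  have "length (snd (sub_bits a b)) = length a + length b"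
    unfolding sub_bits_def
    by (rule serial_invariant(2)[where \<sigma> = "-1", OF _ prod.collapse[symmetric]]) (simp split: if_splits)
  then show "length (monus_bits a b) \<le> length a + length b"
    by (simp add: monus_bits_def)
qed

text \<open>Lengths of numbers thus grow only linearly with the number of rounds.\<close>

lemma length_before: "length (before w b) \<le> length b + sz w"
proof (cases w)
  case (Some p)
  have "length (snd p) \<le> sz w"
    using length_le_sz[of "snd p"] sz_prod[of p] by (simp add: Some)
  then show ?thesis
    using length_serial_snd[of b "snd p"] by (simp add: Some before_def)
qed (simp add: before_def)

lemma sz_bits_le: "sz (b :: num_bits) \<le> 4 * length b + 1"
proof (induction b)
  case (Cons x b)
  then show ?case using sz_bool[of x] by simp
qed simp

definition bounded_table :: "nat \<Rightarrow> nat \<Rightarrow> word table \<Rightarrow> bool" where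
  "bounded_table S m R \<longleftrightarrow> (\<forall>e\<in>set R. sz (fst e) \<le> S \<and> length (snd e) \<le> m)"

lemma bounded_backward:
  assumes "bounded_table S m R" "sz ts \<le> S"
  shows "bounded_table S (m + S) (backward ts R)" "length (backward ts R) \<le> length ts"
proof -
  have "sz (fst e) \<le> S \<and> length (snd e) \<le> m + S" if e: "e \<in> set (backward ts R)" for e
  proof -
    obtain t where "t \<in> set ts" "e \<in> set (case look_up R (snd (snd t)) of None \<Rightarrow> []
        | Some b \<Rightarrow> [(fst t, before (fst (snd t)) b)])"
      using e unfolding backward_def set_concat set_map by blast
    then obtain b where t: "t \<in> set ts" "look_up R (snd (snd t)) = Some b" "e = (fst t, before (fst (snd t)) b)"
      by (cases "look_up R (snd (snd t))") auto
    have szt: "sz (fst t) \<le> S" "sz (fst (snd t)) \<le> S"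
      using sz_member_le[OF t(1)] assms(2) sz_prod[of t] sz_prod[of "snd t"] by simp_all
    \<comment> \<open>\<open>look_up\<close> selects a stored number and never combines numbers, so
      only \<open>before\<close> can lengthen one.\<close>
    have "\<exists>e\<in>set R. b = snd e"
    proof -
      have "fold (\<lambda>e acc. if fst e = q
         then (case acc of None \<Rightarrow> Some (snd e) | Some b \<Rightarrow> if le_bits b (snd e) then acc else Some (snd e))
         else acc) R acc = Some b \<Longrightarrow> acc = Some b \<or> (\<exists>e\<in>set R. b = snd e)" for q acc
        by (induction R arbitrary: acc) (auto split: option.splits if_splits)
      from this[of _ None] show ?thesis
        using t(2) unfolding look_up_def by blast
    qed
    then have "length b \<le> m"
      using assms(1) unfolding bounded_table_def by blast
    then show ?thesis
      using szt length_before[of "fst (snd t)" b] by (simp add: t(3))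
  qed
  then show "bounded_table S (m + S) (backward ts R)"
    unfolding bounded_table_def by blast
  show "length (backward ts R) \<le> length ts"
    unfolding backward_def by (induction ts) (auto split: option.split)
qed

lemma polytime_rounds [polytime_intros]:
  fixes f :: "'a::encodable \<Rightarrow> word graph"
  assumes "polytime f" "polytime g"
  shows "polytime (\<lambda>x. rounds (f x) (g x))"
proof -
  \<comment> \<open>Room for \<open>n\<close> entries, each with a state of size \<open>n\<close>
    and a number of at most \<open>n + n * n\<close> bits: the original length plus \<open>n\<close>
    for each of at most \<open>n\<close> rounds. The additive criterion does not fit here, as a
    round rewrites the table.\<close>
  let ?B = "\<lambda>n :: nat. Suc (n * Suc (Suc (n + (4 * (n + n * n) + 1))))"
  have "polytime (\<lambda>p :: word graph \<times> word table. rounds (fst p) (snd p))"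
    unfolding rounds_def
  proof (rule polytime_fold[where B = ?B])
    fix p :: "word graph \<times> word table" and ys zs
    assume ys: "fst p = ys @ zs"
    obtain ts R where p: "p = (ts, R)" by fastforce
    define S where "S = sz p"
    have S: "sz ts \<le> S" "sz R \<le> S" "length ts + length R \<le> S"
      using length_le_sz[of ts] length_le_sz[of R] by (simp_all add: S_def p)
    have "sz (fst e) \<le> S \<and> length (snd e) \<le> S" if "e \<in> set R" for e
      using sz_member_le[OF that] S(2) sz_prod[of e] length_le_sz[of "snd e"] by simp
    then have R: "bounded_table S S R"
      by (simp add: bounded_table_def)
    have inv: "bounded_table S (S + length xs * S) (fold (\<lambda>_ R'. R @ backward ts R') xs R) \<and>
        length (fold (\<lambda>_ R'. R @ backward ts R') xs R) \<le> length ts + length R" for xs :: "'x list"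
    proof (induction xs rule: rev_induct)
      case Nil
      then show ?case using R by simp
    next
      case (snoc x xs)
      define R' where "R' = fold (\<lambda>_ R'. R @ backward ts R') xs R"
      have 1: "bounded_table S (S + length xs * S + S) (backward ts R')" "length (backward ts R') \<le> length ts"
        using bounded_backward[of S "S + length xs * S" R' ts] snoc S(1) by (simp_all add: R'_def)
      have "bounded_table S (S + length xs * S + S) (R @ backward ts R')"
        using R 1(1) unfolding bounded_table_def by fastforce
      then show ?case
        using 1(2) by (simp add: R'_def algebra_simps)
    qed
    let ?R = "fold (\<lambda>_ R'. R @ backward ts R') ys R"
    have "length ys \<le> S"
      using S(3) ys by (simp add: p)
    then have "length ys * S \<le> S * S"
      by (rule mult_right_mono) simp
    then have b: "sz e \<le> Suc (S + (4 * (S + S * S) + 1))" if "e \<in> set ?R" for e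
    proof -
      have "sz (fst e) \<le> S" "length (snd e) \<le> S + length ys * S"
        using inv[of ys] that unfolding bounded_table_def by simp_all
      then have "length (snd e) \<le> S + S * S"
        using \<open>length ys * S \<le> S * S\<close> by (meson add_left_mono order_trans)
      then have "sz (snd e) \<le> 4 * (S + S * S) + 1"
        by (intro order_trans[OF sz_bits_le]) simp
      then show ?thesis
        using \<open>sz (fst e) \<le> S\<close> sz_prod[of e] by simp
    qed
    have "sz ?R \<le> Suc (length ?R * Suc (Suc (S + (4 * (S + S * S) + 1))))"
      by (rule sz_list_le) (rule b)
    also have "\<dots> \<le> ?B S"
      using inv[of ys] S(3) by (intro Suc_le_mono[THEN iffD2] mult_right_mono) simp_all
    finally show "sz (fold (\<lambda>_ R'. snd p @ backward (fst p) R') ys (snd p)) \<le> ?B (sz p)"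
      unfolding S_def by (simp add: p)
  qed (intro polytime_intros | auto)+
  from polytime_comp2[OF this assms] show ?thesis .
qed

lemma polytime_zero_entry [polytime_intros]:
  fixes f :: "'a::encodable \<Rightarrow> word table"
  assumes "polytime f" "polytime g"
  shows "polytime (\<lambda>x. zero_entry (f x) (g x))"
  unfolding zero_entry_def
  by (intro polytime_intros assms polytime_comp[OF assms(1)] polytime_comp[OF assms(2)])

lemma polytime_has_entry [polytime_intros]:
  fixes f :: "'a::encodable \<Rightarrow> word table"
  assumes "polytime f" "polytime g"
  shows "polytime (\<lambda>x. has_entry (f x) (g x))"
  unfolding has_entry_def
  by (intro polytime_intros assms polytime_comp[OF assms(1)] polytime_comp[OF assms(2)])

lemma polytime_credit [polytime_intros]:
  fixes f :: "'a::encodable \<Rightarrow> word graph"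
  assumes "polytime f" "polytime g"
  shows "polytime (\<lambda>x. credit (f x) (g x))"
  unfolding credit_def gaining_def
  by (intro polytime_intros assms polytime_comp[OF assms(1)] polytime_comp[OF assms(2)])

lemma polytime_zeros [polytime_intros]:
  fixes f :: "'a::encodable \<Rightarrow> word list"
  assumes "polytime f"
  shows "polytime (\<lambda>x. zeros (f x))"
  unfolding zeros_def by (intro polytime_intros assms)

lemma polytime_reach_table:
  "polytime (\<lambda>p :: word graph \<times> word list. reach_table (fst p) (snd p))"
  unfolding reach_table_def by (intro polytime_intros)

lemma polytime_buchi_table:
  "polytime (\<lambda>p :: word graph \<times> word list. buchi_table (fst p) (snd p))"
proof -
  have "polytime (\<lambda>p :: word graph \<times> word list. recurrent (fst p) (snd p))"
    unfolding recurrent_def by (intro polytime_intros)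
  moreover have "polytime (\<lambda>p :: word graph \<times> word list. boosted (fst p) (snd p))"
    unfolding boosted_def Let_def by (intro polytime_intros)
  ultimately show ?thesis
    unfolding buchi_table_def by (intro polytime_intros)
qed

section \<open>Reading and writing instances\<close>

text \<open>Total on words: any letter but \<open>One\<close> counts as 0. Words that are not
  canonical numerals are exposed when the result is printed again.\<close>

definition to_bits :: "word \<Rightarrow> num_bits" where
  "to_bits w = rev (map (\<lambda>a. a = One) w)"

text \<open>Drops the zeros at the most significant end, which is the end of the list.\<close>

definition trim :: "num_bits \<Rightarrow> num_bits" where
  "trim b = foldr (\<lambda>x t. if t = [] \<and> \<not> x then [] else x # t) b []"

definition word_of :: "num_bits \<Rightarrow> word" where
  "word_of b = (if trim b = [] then [Zero] else map (\<lambda>x. if x then One else Zero) (rev (trim b)))"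

definition parse_weight :: "word \<Rightarrow> weight" where
  "parse_weight u = (case u of [] \<Rightarrow> Some (False, [])
     | a # as \<Rightarrow> if a = Infinity then None
         else if a = Minus then Some (True, to_bits as) else Some (False, to_bits u))"

text \<open>A minus sign in front of zero is suppressed, in accordance with
  \<open>encode_int\<close>.\<close>

definition print_weight :: "weight \<Rightarrow> word" where
  "print_weight w = (case w of None \<Rightarrow> [Infinity]
     | Some p \<Rightarrow> if fst p \<and> trim (snd p) \<noteq> [] then Minus # word_of (snd p) else word_of (snd p))"

definition pieces :: "word \<Rightarrow> word list" where
  "pieces w = foldr (\<lambda>a ps. if a = Comma then [] # ps
     else (case ps of [] \<Rightarrow> [[a]] | p # ps' \<Rightarrow> (a # p) # ps')) w [[]]"

text \<open>A comma terminates every item, so the last piece is only what follows the last comma and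
  is dropped.\<close>

definition items :: "word \<Rightarrow> word list" where
  "items w = rev (tl (rev (pieces w)))"

definition print_list :: "word list \<Rightarrow> word" where
  "print_list xs = concat (map (\<lambda>x. x @ [Comma]) xs)"

text \<open>Transitions are separated by the same letter as their components, so they arrive as a
  flat list of words and are regrouped from its end. Incomplete leftovers vanish and are noticed on
  printing.\<close>

definition triples :: "word list \<Rightarrow> (word \<times> word \<times> word) list" where
  "triples xs = snd (foldr (\<lambda>p s. case fst s of [] \<Rightarrow> ([p], snd s)
     | a # c \<Rightarrow> (case c of [] \<Rightarrow> ([p, a], snd s) | b # _ \<Rightarrow> ([], (p, a, b) # snd s))) xs ([], []))"

definition upto_bar :: "word \<Rightarrow> word" where
  "upto_bar w = takeWhile (\<lambda>a. a \<noteq> Bar) w"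

definition after_bar :: "word \<Rightarrow> word" where
  "after_bar w = tl (dropWhile (\<lambda>a. a \<noteq> Bar) w)"

type_synonym parsed = "word list \<times> word graph \<times>
  word \<times> word list \<times> word"

definition parse :: "word \<Rightarrow> parsed" where
  "parse w =
     (items (upto_bar w),
      map (\<lambda>t. (fst t, parse_weight (fst (snd t)), snd (snd t))) (triples (items (upto_bar (after_bar w)))),
      upto_bar (after_bar (after_bar w)),
      items (upto_bar (after_bar (after_bar (after_bar w)))),
      after_bar (after_bar (after_bar (after_bar w))))"

definition print_instance :: "parsed \<Rightarrow> word" where
  "print_instance I = (case I of (ss, ts, s0, fs, name) \<Rightarrow>
     print_list ss @ [Bar] @ print_list (concat (map (\<lambda>t. [fst t, print_weight (fst (snd t)), snd (snd t)]) ts)) @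
     [Bar] @ s0 @ [Bar] @ print_list fs @ [Bar] @ name)"

definition mem :: "word \<Rightarrow> word list \<Rightarrow> bool" where
  "mem x xs = list_ex (\<lambda>y. y = x) xs"

text \<open>Printing the result of parsing and comparing it with the input detects every malformed input.\<close>

definition well_formed :: "word \<Rightarrow> parsed \<Rightarrow> bool" where
  "well_formed w I = (print_instance I = w \<and> (case I of (ss, ts, s0, fs, name) \<Rightarrow>
     list_all (\<lambda>s. word_of (to_bits s) = s) ss \<and>
     list_all (\<lambda>t. mem (fst t) ss \<and> mem (snd (snd t)) ss) ts \<and> mem s0 ss \<and> list_all (\<lambda>f. mem f ss) fs))"

text \<open>Every member of the threshold problem contains \<open>Bar\<close>, so the empty word is
  a safe negative answer for malformed inputs and for states without an entry.\<close>

definition threshold_query ::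
  "(word graph \<Rightarrow> word list \<Rightarrow> word table) \<Rightarrow> word \<Rightarrow> word" where
  "threshold_query tab w = (if well_formed w (parse w)
     then (case parse w of (ss, ts, s0, fs, name) \<Rightarrow>
       (case look_up (tab ts fs) s0 of None \<Rightarrow> [] | Some b \<Rightarrow> word_of b @ [Bar] @ name)) else [])"

lemma mem_iff [simp]: "mem x xs \<longleftrightarrow> x \<in> set xs"
  by (auto simp: mem_def list_ex_iff)

text \<open>Both parts are proved together: the numeral for a further bit depends on whether the
  remaining bits trim to nothing.\<close>

lemma word_of: "word_of b = encode_nat (nval b)" "trim b = [] \<longleftrightarrow> nval b = 0"
proof (induction b)
  case Nil
  {
    case 1
    then show ?case by (simp add: word_of_def trim_def encode_nat.simps encode_digit_def)
  next
    case 2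
    then show ?case by (simp add: trim_def)
  }
next
  case (Cons x b)
  have t: "trim (y # b) = (if trim b = [] \<and> \<not> y then [] else y # trim b)" for y
    by (simp add: trim_def)
  {
    case 1
    show ?case
    proof (cases "nval b = 0")
      case True
      then have "trim b = []"
        using Cons.IH(2) by simp
      then show ?thesis
        using True by (cases x) (simp_all add: word_of_def t encode_nat.simps encode_digit_def)
    next
      case False
      then have tb: "trim b \<noteq> []"
        using Cons.IH(2) by simp
      have "encode_nat (nval (x # b)) = encode_nat (nval b) @ [encode_digit (of_bool x)]"
        using False by (subst encode_nat.simps) (cases x; simp)
      then show ?thesis
        using tb Cons.IH(1) by (cases x) (simp_all add: word_of_def t encode_digit_def)
    qed
  next
    case 2
    then show ?case using Cons.IH(2) by (auto simp: t)
  }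
qed

section \<open>Unique readability of the encodings\<close>

lemma encode_nat_letters: "set (encode_nat n) \<subseteq> {Zero, One}"
proof (induction n rule: encode_nat.induct)
  case (1 n)
  then show ?case
    by (subst encode_nat.simps) (auto simp: encode_digit_def)
qed

lemma encode_nat_nonempty: "encode_nat n \<noteq> []"
  by (subst encode_nat.simps) simp

lemma nval_to_bits [simp]: "nval (to_bits (encode_nat n)) = n"
proof (induction n rule: encode_nat.induct)
  case (1 n)
  show ?case
  proof (cases "n < 2")
    case True
    then show ?thesis
      by (subst encode_nat.simps) (auto simp: encode_digit_def to_bits_def less_2_cases_iff)
  next
    case False
    then have "to_bits (encode_nat n) = (n mod 2 \<noteq> 0) # to_bits (encode_nat (n div 2))"
      by (subst encode_nat.simps) (simp add: to_bits_def encode_digit_def)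
    then show ?thesis
      using 1 False by (auto simp: of_bool_def) presburger
  qed
qed

lemma inj_encode_nat: "inj encode_nat"
  by (metis injI nval_to_bits)

lemma encode_update_letters: "set (encode_update u) \<subseteq> {Zero, One, Minus, Infinity}"
proof (cases u)
  case (Add k)
  then show ?thesis
    using encode_nat_letters[of "nat k"] encode_nat_letters[of "nat (- k)"] by (auto simp: encode_int_def)
qed simp

lemma print_weight: "print_weight w = encode_update (weight_code w)"
  by (auto simp: print_weight_def weight_code_def encode_int_def word_of split: option.split prod.split)

lemma parse_weight: "weight_code (parse_weight (encode_update u)) = u"
proof (cases u)
  case (Add k)
  show ?thesis
  proof (cases "k < 0")
    case True
    then show ?thesis
      by (simp add: Add encode_int_def parse_weight_def weight_code_def)
  next
    case False
    obtain a as where a: "encode_nat (nat k) = a # as"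
      using encode_nat_nonempty by (meson neq_Nil_conv)
    then have "a \<in> {Zero, One}"
      using encode_nat_letters[of "nat k"] by auto
    then show ?thesis
      using False a nval_to_bits[of "nat k"] by (auto simp: Add encode_int_def parse_weight_def weight_code_def)
  qed
qed (simp add: parse_weight_def weight_code_def)

lemma bar_simps [simp]:
  assumes "Bar \<notin> set p"
  shows "upto_bar (p @ Bar # r) = p" "after_bar (p @ Bar # r) = r"
proof -
  have "\<forall>x\<in>set p. x \<noteq> Bar"
    using assms by metis
  then show "upto_bar (p @ Bar # r) = p" "after_bar (p @ Bar # r) = r"
    by (simp_all add: upto_bar_def after_bar_def takeWhile_append2 dropWhile_append2)
qed

lemma pieces_append: "Comma \<notin> set x \<Longrightarrow> pieces (x @ Comma # r) = x # pieces r"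
  by (induction x) (auto simp: pieces_def)

lemma items_print_list [simp]:
  assumes "\<forall>x\<in>set xs. Comma \<notin> set x"
  shows "items (print_list xs) = xs"
proof -
  have "pieces (print_list xs) = xs @ [[]]"
    using assms by (induction xs) (simp_all add: print_list_def pieces_append, simp add: pieces_def)
  then show ?thesis
    by (simp add: items_def)
qed

lemma triples_concat [simp]: "triples (concat (map (\<lambda>t. [fst t, fst (snd t), snd (snd t)]) xs)) = xs"
proof -
  have "foldr (\<lambda>p s. case fst s of [] \<Rightarrow> ([p], snd s)
     | a # c \<Rightarrow> (case c of [] \<Rightarrow> ([p, a], snd s) | b # _ \<Rightarrow> ([], (p, a, b) # snd s)))
     (concat (map (\<lambda>t. [fst t, fst (snd t), snd (snd t)]) xs)) ([], []) = ([], xs)"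
    by (induction xs) simp_all
  then show ?thesis
    unfolding triples_def by simp
qed

lemma encode_list_print: "encode_list e xs = print_list (map e xs)"
  by (simp add: encode_list_def print_list_def comp_def)

lemma encode_transitions_print:
  "encode_list encode_transition ts =
     print_list (concat (map (\<lambda>(s, u, t). [encode_nat s, encode_update u, encode_nat t]) ts))"
  by (induction ts) (auto simp: encode_list_def print_list_def)

lemma bar_print_list: "(\<forall>x\<in>set xs. Bar \<notin> set x) \<Longrightarrow> Bar \<notin> set (print_list xs)"
  by (auto simp: print_list_def)

lemma encode_nat_no_separator [simp]: "Bar \<notin> set (encode_nat n)" "Comma \<notin> set (encode_nat n)"
  using encode_nat_letters[of n] by auto

lemma encode_update_no_separator [simp]: "Bar \<notin> set (encode_update u)" "Comma \<notin> set (encode_update u)"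
  using encode_update_letters[of u] by auto

lemma parse_encode_instance:
  "parse (encode_instance ss ts s0 fs w) =
     (map encode_nat ss, map (\<lambda>(s, u, t). (encode_nat s, parse_weight (encode_update u), encode_nat t)) ts,
      encode_nat s0, map encode_nat fs, w)"
proof -
  define us where "us = map (\<lambda>(s, u, t). (encode_nat s, encode_update u, encode_nat t)) ts"
  have us: "concat (map (\<lambda>(s, u, t). [encode_nat s, encode_update u, encode_nat t]) ts) =
      concat (map (\<lambda>t. [fst t, fst (snd t), snd (snd t)]) us)"
    by (simp add: us_def comp_def case_prod_unfold)
  have sep: "Bar \<notin> set x" "Comma \<notin> set x"
    if "x \<in> set (concat (map (\<lambda>t. [fst t, fst (snd t), snd (snd t)]) us))" for x
    using that by (auto simp: us_def)
  have e: "encode_instance ss ts s0 fs w = print_list (map encode_nat ss) @ Bar #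
     print_list (concat (map (\<lambda>t. [fst t, fst (snd t), snd (snd t)]) us)) @ Bar #
     encode_nat s0 @ Bar # print_list (map encode_nat fs) @ Bar # w"
    by (simp add: encode_instance_def encode_list_print[of encode_nat] encode_transitions_print us)
  have 1: "Bar \<notin> set (print_list (map encode_nat xs))" for xs
    by (rule bar_print_list) auto
  have 2: "Bar \<notin> set (print_list (concat (map (\<lambda>t. [fst t, fst (snd t), snd (snd t)]) us)))"
    by (rule bar_print_list) (use sep(1) in blast)
  have 3: "items (print_list (concat (map (\<lambda>t. [fst t, fst (snd t), snd (snd t)]) us))) =
      concat (map (\<lambda>t. [fst t, fst (snd t), snd (snd t)]) us)"
    by (rule items_print_list) (use sep(2) in blast)
  show ?thesis
    unfolding parse_def e
    by (simp add: 1 2 3) (simp add: us_def case_prod_unfold)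
qed

lemma print_encode_instance:
  assumes "ts' = map (\<lambda>(s, u, t). (encode_nat s, v u, encode_nat t)) ts" "\<And>u. weight_code (v u) = u"
  shows "print_instance (map encode_nat ss, ts', encode_nat s0, map encode_nat fs, w) = encode_instance ss ts s0 fs w"
proof -
  have "concat (map (\<lambda>t. [fst t, print_weight (fst (snd t)), snd (snd t)]) ts') =
     concat (map (\<lambda>(s, u, t). [encode_nat s, encode_update u, encode_nat t]) ts)"
    unfolding assms(1) by (simp add: print_weight assms(2) comp_def case_prod_unfold)
  then show ?thesis
    by (simp add: print_instance_def encode_instance_def encode_list_print[of encode_nat] encode_transitions_print)
qed

lemma transitions_valid:
  "int_automaton (set ss) (transitions ts) \<longleftrightarrow> (\<forall>(s, u, t)\<in>set ts. s \<in> set ss \<and> t \<in> set ss)"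
  by (auto simp: int_automaton_def transitions_def int_updates_def)

lemma well_formed_encode_instance:
  assumes "valid_instance names ss ts s0 fs w"
  shows "well_formed (encode_instance ss ts s0 fs w) (parse (encode_instance ss ts s0 fs w))"
proof -
  have "print_instance (parse (encode_instance ss ts s0 fs w)) = encode_instance ss ts s0 fs w"
    unfolding parse_encode_instance by (rule print_encode_instance[OF refl parse_weight])
  then show ?thesis
    using assms
    by (auto simp: well_formed_def parse_encode_instance valid_instance_def transitions_valid word_of list_all_iff)
qed

text \<open>All states that occur belong to the state list, whose words are canonical numerals.
  Decoding them therefore yields an instance whose encoding is the printed one, that is, the
  input.\<close>

lemma well_formed_instance:
  assumes "well_formed x (parse x)"
  obtains ss ts s0 fs w where "x = encode_instance ss ts s0 fs w"
    "int_automaton (set ss) (transitions ts)" "s0 \<in> set ss" "set fs \<subseteq> set ss"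
proof -
  obtain ss ts s0 fs w where p: "parse x = (ss, ts, s0, fs, w)"
    by (metis prod.exhaust)
  have x: "x = print_instance (ss, ts, s0, fs, w)"
    and canon: "\<And>s. s \<in> set ss \<Longrightarrow> word_of (to_bits s) = s"
    and mems: "\<And>t. t \<in> set ts \<Longrightarrow> fst t \<in> set ss \<and> snd (snd t) \<in> set ss" "s0 \<in> set ss" "set fs \<subseteq> set ss"
    using assms unfolding well_formed_def p by (auto simp: list_all_iff)
  define num where "num s = nval (to_bits s)" for s
  have num: "encode_nat (num s) = s" if "s \<in> set ss" for s
    using canon[OF that] by (simp add: num_def word_of)
  define ts' where "ts' = map (\<lambda>t. (num (fst t), weight_code (fst (snd t)), num (snd (snd t)))) ts"
  have "map encode_nat (map num xs) = xs" if "set xs \<subseteq> set ss" for xs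
    using that num by (induction xs) auto
  note maps = this[OF order_refl] this[OF mems(3)]
  have "concat (map (\<lambda>t. [fst t, print_weight (fst (snd t)), snd (snd t)]) ts) =
     concat (map (\<lambda>(s, u, t). [encode_nat s, encode_update u, encode_nat t]) ts')"
    unfolding ts'_def by (intro arg_cong[where f = concat]) (use mems(1) num in \<open>auto simp: print_weight\<close>)
  then have "x = encode_instance (map num ss) ts' (num s0) (map num fs) w"
    unfolding x using maps num[OF mems(2)]
    by (simp add: print_instance_def encode_instance_def encode_list_print[of encode_nat] encode_transitions_print)
  moreover have "int_automaton (set (map num ss)) (transitions ts')"
    unfolding transitions_valid using mems(1) by (auto simp: ts'_def)
  moreover have "num s0 \<in> set (map num ss)" "set (map num fs) \<subseteq> set (map num ss)"
    using mems(2,3) by auto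
  ultimately show ?thesis
    by (rule that)
qed

text \<open>The first \<open>Bar\<close> separates number and name, as no numeral contains it, and a
  numeral without sign encodes a single integer.\<close>

lemma threshold_word:
  "encode_nat n @ [Bar] @ w \<in> integer_threshold_problem names val \<longleftrightarrow> w \<in> names \<and> real n \<le> val w"
proof
  assume "encode_nat n @ [Bar] @ w \<in> integer_threshold_problem names val"
  then obtain k v where k: "encode_nat n @ Bar # w = encode_int k @ Bar # v" "v \<in> names" "real_of_int k \<le> val v"
    unfolding integer_threshold_problem_def by auto
  have i: "encode_int k = encode_update (Add k)"
    by simp
  have "encode_nat n = encode_int k" "w = v"
    using bar_simps[of "encode_nat n" w] bar_simps[of "encode_int k" v] encode_update_no_separator(1)[of "Add k"] k(1)
    by (simp_all add: i[symmetric])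
  moreover from this(1) have "k = int n"
    using encode_nat_letters[of n] encode_nat_nonempty inj_encode_nat
    by (auto simp: encode_int_def inj_eq split: if_splits)
  ultimately show "w \<in> names \<and> real n \<le> val w"
    using k by simp
next
  assume "w \<in> names \<and> real n \<le> val w"
  then show "encode_nat n @ [Bar] @ w \<in> integer_threshold_problem names val"
    unfolding integer_threshold_problem_def by (auto intro!: exI[of _ "int n"] exI[of _ w] simp: encode_int_def)
qed

lemma Nil_not_threshold: "[] \<notin> integer_threshold_problem names val"
  by (simp add: integer_threshold_problem_def)

section \<open>Polynomial-time parsing\<close>

lemma polytime_to_bits [polytime_intros]: "polytime f \<Longrightarrow> polytime (\<lambda>x. to_bits (f x))"
  unfolding to_bits_def by (intro polytime_intros)

lemma polytime_trim [polytime_intros]: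
  assumes "polytime f"
  shows "polytime (\<lambda>x. trim (f x))"
proof -
  have "polytime (\<lambda>x :: num_bits. trim x)"
    unfolding trim_def foldr_conv_fold
  proof (rule polytime_fold_additive[where Q = "\<lambda>n. n + 1"])
    show "sz (if t = [] \<and> \<not> a then [] else a # t) \<le> sz t + (sz x + sz a + 1)" for x :: num_bits and a t
      by simp
  qed (intro polytime_intros | auto)+
  from polytime_comp[OF this assms] show ?thesis .
qed

lemma polytime_word_of [polytime_intros]: "polytime f \<Longrightarrow> polytime (\<lambda>x. word_of (f x))"
  unfolding word_of_def by (intro polytime_intros)

lemma polytime_parse_weight [polytime_intros]:
  assumes "polytime f"
  shows "polytime (\<lambda>x. parse_weight (f x))"
  unfolding parse_weight_def by (intro polytime_intros polytime_comp[OF assms] assms)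

lemma polytime_print_weight [polytime_intros]: "polytime f \<Longrightarrow> polytime (\<lambda>x. print_weight (f x))"
  unfolding print_weight_def by (intro polytime_intros)

lemma polytime_items [polytime_intros]:
  assumes "polytime f"
  shows "polytime (\<lambda>x. items (f x))"
proof -
  have "polytime (\<lambda>x :: word. pieces x)"
    unfolding pieces_def foldr_conv_fold
  proof (rule polytime_fold_additive[where Q = "\<lambda>n. n + 3"])
    show "sz (if a = Comma then [] # ps else case ps of [] \<Rightarrow> [[a]] | p # ps' \<Rightarrow> (a # p) # ps') \<le> sz ps + (sz x + sz a + 3)"
      for x :: "word" and a ps
      by (auto split: list.split)
  qed (intro polytime_intros | auto)+
  from polytime_comp[OF this assms] show ?thesis
    unfolding items_def by (intro polytime_intros)
qed

lemma polytime_print_list [polytime_intros]: "polytime f \<Longrightarrow> polytime (\<lambda>x. print_list (f x))"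
  unfolding print_list_def by (intro polytime_intros)

lemma polytime_triples [polytime_intros]:
  assumes "polytime f"
  shows "polytime (\<lambda>x. triples (f x))"
proof -
  have "polytime (\<lambda>x :: word list. triples x)"
    unfolding triples_def foldr_conv_fold
  proof (intro polytime_snd, rule polytime_fold_additive[where Q = "\<lambda>n. n + 5"])
    show "sz (case fst s of [] \<Rightarrow> ([p], snd s)
        | a # c \<Rightarrow> (case c of [] \<Rightarrow> ([p, a], snd s) | b # _ \<Rightarrow> ([], (p, a, b) # snd s))) \<le> sz s + (sz x + sz p + 5)"
      for x :: "word list" and p and s :: "word list \<times> (word \<times> word \<times> word) list"
      by (cases s) (auto split: list.split)
  qed (intro polytime_intros | auto)+
  from polytime_comp[OF this assms] show ?thesis .
qed

lemma polytime_upto_bar [polytime_intros]: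
  assumes "polytime f"
  shows "polytime (\<lambda>x. upto_bar (f x))"
proof -
  \<comment> \<open>Scanning from the right and starting afresh at every \<open>Bar\<close> leaves
    what precedes the first one.\<close>
  have "polytime (\<lambda>x :: word. foldr (\<lambda>a acc. if a = Bar then [] else a # acc) x [])"
    unfolding foldr_conv_fold
  proof (rule polytime_fold_additive[where Q = "\<lambda>n. n + 1"])
    show "sz (if a = Bar then [] else a # acc) \<le> sz acc + (sz x + sz a + 1)" for x :: "word" and a acc
      using sz_pos[of acc] by simp
  qed (intro polytime_intros | auto)+
  moreover have "foldr (\<lambda>a acc. if a = Bar then [] else a # acc) x [] = upto_bar x" for x
    unfolding upto_bar_def by (induction x) auto
  ultimately have "polytime upto_bar"
    by (simp add: fun_eq_iff)
  from polytime_comp[OF this assms] show ?thesis .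
qed

lemma polytime_after_bar [polytime_intros]:
  assumes "polytime f"
  shows "polytime (\<lambda>x. after_bar (f x))"
proof -
  \<comment> \<open>One step of \<open>dropWhile\<close>, idle as soon as a \<open>Bar\<close> is in
    front or nothing is left; the word itself counts the steps.\<close>
  define F :: "letter \<Rightarrow> word \<Rightarrow> word"
    where "F = (\<lambda>_ u. case u of [] \<Rightarrow> [] | a # as \<Rightarrow> if a = Bar then u else as)"
  have "polytime (\<lambda>x :: word. fold (\<lambda>a u. F a u) x x)"
  proof (rule polytime_fold_additive[where Q = "\<lambda>n. n"])
    show "sz (F a u) \<le> sz u + (sz x + sz a)" for x :: "word" and a u
      by (auto simp: F_def split: list.split)
  qed (unfold F_def, (intro polytime_intros | auto)+)
  moreover have "length u \<le> length xs \<Longrightarrow> fold F xs u = dropWhile (\<lambda>a. a \<noteq> Bar) u" for xs u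
  proof (induction xs arbitrary: u)
    case (Cons x xs)
    have fixed: "fold F ys (Bar # as) = Bar # as" for ys as
      by (induction ys) (simp_all add: F_def)
    show ?case
    proof (cases u)
      case Nil
      then show ?thesis using Cons by (simp add: F_def)
    next
      case (Cons a as)
      then show ?thesis
        using Cons.IH[of as] Cons.prems fixed by (cases "a = Bar") (simp_all add: F_def)
    qed
  qed simp
  ultimately have "polytime (\<lambda>x. tl (dropWhile (\<lambda>a. a \<noteq> Bar) x))"
    by (intro polytime_intros) simp
  from polytime_comp[OF this assms] show ?thesis
    unfolding after_bar_def .
qed

lemma polytime_mem [polytime_intros]:
  assumes "polytime f" "polytime g"
  shows "polytime (\<lambda>x. mem (f x) (g x))"
  unfolding mem_def
  by (intro polytime_intros assms polytime_comp[OF assms(1)] polytime_comp[OF assms(2)])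

lemma polytime_parse: "polytime parse"
  unfolding parse_def by (intro polytime_intros)

lemma polytime_well_formed: "polytime (\<lambda>w. well_formed w (parse w))"
proof -
  have "polytime (\<lambda>p. well_formed (fst p) (snd p))"
    unfolding well_formed_def print_instance_def by (intro polytime_intros)
  from polytime_comp2[OF this polytime_id polytime_parse] show ?thesis .
qed

lemma polytime_threshold_query:
  assumes "polytime (\<lambda>p. tab (fst p) (snd p))"
  shows "polytime (threshold_query tab)"
proof -
  have tab: "polytime (\<lambda>x. tab (f x) (g x))" if "polytime f" "polytime g" for f g
    using polytime_comp2[OF assms that] .
  show ?thesis
    unfolding threshold_query_def
    by (intro polytime_intros polytime_well_formed tab polytime_comp[OF polytime_parse])
qed

section \<open>Decidability\<close>

text \<open>\<open>P\<close> stands for either acceptance condition. The reduction itself does not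
  examine the name of the initial energy: its legality is decided by the threshold problem along
  with the comparison.\<close>

lemma decidable_instances:
  fixes names :: "word set" and val :: "word \<Rightarrow> real"
  assumes val: "\<And>w. w \<in> names \<Longrightarrow> 0 \<le> val w"
    and threshold: "decidable_in_ptime (integer_threshold_problem names val)"
    and tab: "polytime (\<lambda>p. tab (fst p) (snd p))"
    and correct: "\<And>ts ts' fs s0 x. edges ts' = image_edges encode_nat (set ts) \<Longrightarrow>
      sat (tab ts' (map encode_nat fs)) (encode_nat s0) (ennreal x) \<longleftrightarrow> P (transitions ts) s0 (set fs) x"
  shows "decidable_in_ptime {encode_instance ss ts s0 fs w | ss ts s0 fs w.
     valid_instance names ss ts s0 fs w \<and> P (transitions ts) s0 (set fs) (val w)}" (is "decidable_in_ptime ?L")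
proof (rule decidable_by_reduction[OF polytime_threshold_query[OF tab] threshold])
  fix x
  have query: "threshold_query tab (encode_instance ss ts s0 fs w) \<in> integer_threshold_problem names val \<longleftrightarrow>
      w \<in> names \<and> P (transitions ts) s0 (set fs) (val w)"
    if wf: "well_formed (encode_instance ss ts s0 fs w) (parse (encode_instance ss ts s0 fs w))" for ss ts s0 fs w
  proof -
    define ts' where "ts' = map (\<lambda>(s, u, t). (encode_nat s, parse_weight (encode_update u), encode_nat t)) ts"
    define R where "R = tab ts' (map encode_nat fs)"
    have e: "edges ts' = image_edges encode_nat (set ts)"
      unfolding edges_def ts'_def set_map image_image by (rule image_cong) (auto simp: parse_weight)
    have "threshold_query tab (encode_instance ss ts s0 fs w) =
        (case look_up R (encode_nat s0) of None \<Rightarrow> [] | Some b \<Rightarrow> encode_nat (nval b) @ [Bar] @ w)"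
      unfolding threshold_query_def if_P[OF wf]
      by (simp add: parse_encode_instance ts'_def R_def word_of cong: option.case_cong)
    then have "threshold_query tab (encode_instance ss ts s0 fs w) \<in> integer_threshold_problem names val \<longleftrightarrow>
        (\<exists>b. look_up R (encode_nat s0) = Some b \<and> w \<in> names \<and> real (nval b) \<le> val w)"
      by (simp add: Nil_not_threshold threshold_word[simplified] split: option.split)
    \<comment> \<open>As legal names denote nonnegative reals, \<open>ennreal\<close> truncates
      nothing and the comparison is the one of reals.\<close>
    also have "\<dots> \<longleftrightarrow> w \<in> names \<and> sat R (encode_nat s0) (ennreal (val w))"
      unfolding sat_look_up using val[of w] by (auto simp: ennreal_of_nat_eq_real_of_nat)
    finally show ?thesis
      unfolding R_def using correct[OF e] by simp
  qed
  show "x \<in> ?L \<longleftrightarrow> threshold_query tab x \<in> integer_threshold_problem names val"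
  proof
    assume "x \<in> ?L"
    then obtain ss ts s0 fs w where x: "x = encode_instance ss ts s0 fs w" "valid_instance names ss ts s0 fs w"
      "P (transitions ts) s0 (set fs) (val w)"
      by blast
    then show "threshold_query tab x \<in> integer_threshold_problem names val"
      using query[OF well_formed_encode_instance[OF x(2)]] by (simp add: valid_instance_def)
  next
    assume q: "threshold_query tab x \<in> integer_threshold_problem names val"
    then have wf: "well_formed x (parse x)"
      using Nil_not_threshold by (auto simp: threshold_query_def split: if_splits)
    then obtain ss ts s0 fs w where x: "x = encode_instance ss ts s0 fs w"
      "int_automaton (set ss) (transitions ts)" "s0 \<in> set ss" "set fs \<subseteq> set ss"
      by (rule well_formed_instance)
    have "w \<in> names \<and> P (transitions ts) s0 (set fs) (val w)"
      using q query wf unfolding x(1) by blast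
    then show "x \<in> ?L"
      using x unfolding valid_instance_def by blast
  qed
qed

theorem theorem4:
  fixes names :: "letter list set" and val :: "letter list \<Rightarrow> real"
  assumes "\<And>w. w \<in> names \<Longrightarrow> 0 \<le> val w"
    and "\<And>w. w \<in> names \<Longrightarrow> computable_real (val w)"
    and "decidable_in_ptime (integer_threshold_problem names val)"
  shows "decidable_in_ptime (reachability_problem names val) \<and>
         decidable_in_ptime (buchi_problem names val)"
proof
  show "decidable_in_ptime (reachability_problem names val)"
    unfolding reachability_problem_def
  proof (rule decidable_instances[OF assms(1,3) polytime_reach_table])
    fix ts ts' fs s0 x
    assume e: "edges ts' = image_edges encode_nat (set ts)"
    show "sat (reach_table ts' (map encode_nat fs)) (encode_nat s0) (ennreal x) \<longleftrightarrow>
        reachable_accepting (transitions ts) s0 (set fs) x"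
      unfolding sat_reach_table e reachable_accepting_reach by (simp add: reach_image[OF inj_encode_nat])
  qed
  show "decidable_in_ptime (buchi_problem names val)"
    unfolding buchi_problem_def
  proof (rule decidable_instances[OF assms(1,3) polytime_buchi_table])
    fix ts ts' fs s0 x
    assume e: "edges ts' = image_edges encode_nat (set ts)"
    have "ennreal x \<noteq> \<infinity>"
      by simp
    then show "sat (buchi_table ts' (map encode_nat fs)) (encode_nat s0) (ennreal x) \<longleftrightarrow>
        buchi_accepting (transitions ts) s0 (set fs) x"
      by (simp add: sat_buchi_table e buchi_accepting_lasso lasso_image[OF inj_encode_nat] del: infinity_ennreal_def)
  qed
qed

end
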